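(* Let $R$ be a local domain possessing an operation $cl$ that obeys the big axioms. If $\alpha:R\to M$ is a phantom extension (with respect to $cl$), then $M$ can be modified into a balanced big Cohen-Macaulay module over $R$.
   Context: A local ring is a commutative Noetherian local ring. Let $(R,\mathfrak{m})$ be a local domain; modules are arbitrary, not necessarily finitely generated. Big axioms: an operation $cl$ assigning to each $R$-module $M$ and submodule $N\subseteq M$ a subset $N^{cl}_M\subseteq M$ obeys the big axioms if the following hold for arbitrary $R$-modules: (1) $N_M^{cl}$ is a submodule of $M$ containing $N$. (2) $(N_M^{cl})_M^{cl}=N_M^{cl}$. (3) If $N\subseteq M\subseteq W$, then $N_W^{cl}\subseteq M_W^{cl}$. (4) If $f:M\to W$ is a homomorphism and $N\subseteq M$, then $f(N_M^{cl})\subseteq f(N)_W^{cl}$. (5) If $N_M^{cl}=N$, then $0_{M/N}^{cl}=0$. (6) $\mathfrak{m}_R^{cl}=\mathfrak{m}$. (7) Let $x_1,\ldots,x_{k+1}$ be a partial system of parameters for $R$ ($k\ge 0$), and let $J=(x_1,\ldots,x_k)$ ($J=0$ if $k=0$). If there is a surjective homomorphism $f:M\to R/J$ and $v\in M$ with $f(v)=x_{k+1}+J$, then $(Rv)_M^{cl}\cap\ker f\subseteq (Jv)_M^{cl}$. Phantom extensions: write $(-)^\vee=\mathrm{Hom}_R(-,R)$. Given an injection $\alpha:R\to M$, let $0\to R\xrightarrow{\alpha}M\xrightarrow{\beta}Q\to 0$ be the resulting short exact sequence. Choose a free presentation $G\xrightarrow{\nu}F\xrightarrow{\mu}Q\to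 0$ ($F,G$ free, possibly of infinite rank) and a lift $\tilde\mu:F\to M$ with $\beta\circ\tilde\mu=\mu$, and let $\tilde\nu=\alpha^{-1}\circ\tilde\mu\circ\nu:G\to R$ (well defined since $\tilde\mu\circ\nu$ maps into $\mathrm{Im}\,\alpha$). Let $\nu^\vee:F^\vee\to G^\vee$, $h\mapsto h\circ\nu$. Then $\alpha$ is a phantom extension (or $M$ is a phantom extension of $R$ via $\alpha$) if $\tilde\nu\in(\mathrm{Im}\,\nu^\vee)^{cl}_{G^\vee}$; this does not depend on the choices of free presentation and lift. Module modifications: given a relation $x_1u_1+\cdots+x_{k+1}u_{k+1}=0$ in an $R$-module $M$ with $x_1,\ldots,x_{k+1}$ a partial system of parameters for $R$ ($k\ge0$), the module modification of $M$ with respect to this relation is $M'=(M\oplus R^k)/R(u_{k+1},x_1,\ldots,x_k)$ together with the map $M\to M'$, $u\mapsto\overline{(u,\mathbf{0})}$. That $M$ can be modified into a module $B$ means that $B$ is the direct limit of a (possibly transfinite) sequence of modules starting with $M$ in which each successor term is a module modification of its predecessor and each term at a limit stage is the direct limit of the previous terms. A balanced big Cohen-Macaulay module over $R$ is an $R$-module $B$ with $B\neq\mathfrak{m}B$ such that every partial system of parameters for $R$ is a regular sequence on $B$. *)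

theory Defs
  imports "HOL-Algebra.Ring_Divisibility" "HOL-Algebra.Module" "HOL-Library.FuncSet" "HOL-Library.Extended_Nat"
begin

section \<open>Local domains and systems of parameters\<close>

definition local_domain :: "'a ring \<Rightarrow> 'a set \<Rightarrow> bool" where
  "local_domain R \<mm> \<longleftrightarrow>
     noetherian_domain R \<and> maximalideal \<mm> R \<and> (\<forall>I. maximalideal I R \<longrightarrow> I = \<mm>)"

definition krull_dim :: "'a ring \<Rightarrow> enat" where
  "krull_dim R =
     Sup {enat n | n. \<exists>P :: nat \<Rightarrow> 'a set.
                        (\<forall>i\<le>n. primeideal (P i) R) \<and> (\<forall>i<n. P i \<subset> P (Suc i))}"

definition radical :: "'a ring \<Rightarrow> 'a set \<Rightarrow> 'a set" where
  "radical R I = {r \<in> carrier R. \<exists>n::nat. r [^]\<^bsub>R\<^esub> n \<in> I}"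

text \<open>In a local ring an ideal is \<open>\<mm>\<close>-primary iff its radical is \<open>\<mm>\<close>.\<close>

definition system_of_parameters :: "'a ring \<Rightarrow> 'a set \<Rightarrow> 'a list \<Rightarrow> bool" where
  "system_of_parameters R \<mm> xs \<longleftrightarrow>
     enat (length xs) = krull_dim R \<and> set xs \<subseteq> \<mm> \<and> radical R (Idl\<^bsub>R\<^esub> (set xs)) = \<mm>"

definition partial_sop :: "'a ring \<Rightarrow> 'a set \<Rightarrow> 'a list \<Rightarrow> bool" where
  "partial_sop R \<mm> xs \<longleftrightarrow> (\<exists>ys. system_of_parameters R \<mm> (xs @ ys))"


section \<open>Modules\<close>

text \<open>
  A module record inherits the ring fields \<open>mult\<close> and \<open>one\<close>, which are meaningless for
  modules. They are left \<open>undefined\<close> in the constructions below.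
\<close>

definition module_homs :: "'a ring \<Rightarrow> ('a, 'b) module \<Rightarrow> ('a, 'c) module \<Rightarrow> ('b \<Rightarrow> 'c) set" where
  "module_homs R M N =
     {f \<in> carrier M \<rightarrow> carrier N.
        (\<forall>x\<in>carrier M. \<forall>y\<in>carrier M. f (x \<oplus>\<^bsub>M\<^esub> y) = f x \<oplus>\<^bsub>N\<^esub> f y) \<and>
        (\<forall>a\<in>carrier R. \<forall>x\<in>carrier M. f (a \<odot>\<^bsub>M\<^esub> x) = a \<odot>\<^bsub>N\<^esub> f x)}"

definition module_isos :: "'a ring \<Rightarrow> ('a, 'b) module \<Rightarrow> ('a, 'c) module \<Rightarrow> ('b \<Rightarrow> 'c) set" where
  "module_isos R M N = {f \<in> module_homs R M N. bij_betw f (carrier M) (carrier N)}"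

definition generated_submodule :: "'a ring \<Rightarrow> ('a, 'b) module \<Rightarrow> 'b set \<Rightarrow> 'b set" where
  "generated_submodule R M S = \<Inter>{H. submodule H R M \<and> S \<subseteq> H}"

definition ideal_smult :: "'a ring \<Rightarrow> 'a set \<Rightarrow> ('a, 'b) module \<Rightarrow> 'b set" where
  "ideal_smult R I M = generated_submodule R M {a \<odot>\<^bsub>M\<^esub> x | a x. a \<in> I \<and> x \<in> carrier M}"

definition ring_module :: "'a ring \<Rightarrow> ('a, 'a) module" where
  "ring_module R =
     \<lparr>carrier = carrier R, monoid.mult = undefined, monoid.one = undefined,
      ring.zero = \<zero>\<^bsub>R\<^esub>, ring.add = (\<oplus>\<^bsub>R\<^esub>), smult = (\<otimes>\<^bsub>R\<^esub>)\<rparr>"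

definition quotient_module :: "('a, 'b) module \<Rightarrow> 'b set \<Rightarrow> ('a, 'b set) module" where
  "quotient_module M N =
     \<lparr>carrier = a_rcosets\<^bsub>M\<^esub> N, monoid.mult = undefined, monoid.one = undefined,
      ring.zero = N, ring.add = (<+>\<^bsub>M\<^esub>), smult = (\<lambda>a X. \<Union>x\<in>X. N +>\<^bsub>M\<^esub> (a \<odot>\<^bsub>M\<^esub> x))\<rparr>"

definition module_sum :: "('a, 'b) module \<Rightarrow> ('a, 'c) module \<Rightarrow> ('a, 'b \<times> 'c) module" where
  "module_sum M N =
     \<lparr>carrier = carrier M \<times> carrier N, monoid.mult = undefined, monoid.one = undefined,
      ring.zero = (\<zero>\<^bsub>M\<^esub>, \<zero>\<^bsub>N\<^esub>),
      ring.add = (\<lambda>(x, y) (x', y'). (x \<oplus>\<^bsub>M\<^esub> x', y \<oplus>\<^bsub>N\<^esub> y')),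
      smult = (\<lambda>a (x, y). (a \<odot>\<^bsub>M\<^esub> x, a \<odot>\<^bsub>N\<^esub> y))\<rparr>"

definition power_module :: "'a ring \<Rightarrow> nat \<Rightarrow> ('a, nat \<Rightarrow> 'a) module" where
  "power_module R k =
     \<lparr>carrier = {..<k} \<rightarrow>\<^sub>E carrier R, monoid.mult = undefined, monoid.one = undefined,
      ring.zero = (\<lambda>i\<in>{..<k}. \<zero>\<^bsub>R\<^esub>),
      ring.add = (\<lambda>x y. \<lambda>i\<in>{..<k}. x i \<oplus>\<^bsub>R\<^esub> y i),
      smult = (\<lambda>a x. \<lambda>i\<in>{..<k}. a \<otimes>\<^bsub>R\<^esub> x i)\<rparr>"

definition free_module :: "'a ring \<Rightarrow> ('a, 'b) module \<Rightarrow> bool" where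
  "free_module R F \<longleftrightarrow> module R F \<and>
     (\<exists>B\<subseteq>carrier F. \<forall>x\<in>carrier F.
        \<exists>!c. c \<in> B \<rightarrow>\<^sub>E carrier R \<and> finite {b \<in> B. c b \<noteq> \<zero>\<^bsub>R\<^esub>} \<and>
             x = (\<Oplus>\<^bsub>F\<^esub> b \<in> {b \<in> B. c b \<noteq> \<zero>\<^bsub>R\<^esub>}. c b \<odot>\<^bsub>F\<^esub> b))"

text \<open>
  \<open>Hom(G, R)\<close>; its elements are normalised to be \<open>undefined\<close> outside the carrier of \<open>G\<close>.
\<close>

definition dual_module :: "'a ring \<Rightarrow> ('a, 'b) module \<Rightarrow> ('a, 'b \<Rightarrow> 'a) module" where
  "dual_module R G =
     \<lparr>carrier = module_homs R G (ring_module R) \<inter> extensional (carrier G),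
      monoid.mult = undefined, monoid.one = undefined,
      ring.zero = (\<lambda>g\<in>carrier G. \<zero>\<^bsub>R\<^esub>),
      ring.add = (\<lambda>h h'. \<lambda>g\<in>carrier G. h g \<oplus>\<^bsub>R\<^esub> h' g),
      smult = (\<lambda>a h. \<lambda>g\<in>carrier G. a \<otimes>\<^bsub>R\<^esub> h g)\<rparr>"


section \<open>Closure operations\<close>

text \<open>
  The type \<open>'u\<close> plays the role of the universe: ``all \<open>R\<close>-modules'' means all \<open>R\<close>-modules
  whose carrier is a set of elements of \<open>'u\<close>, and a closure operation maps such a module \<open>M\<close>
  and a submodule \<open>N\<close> to the set \<open>cl M N\<close>. Since \<open>'u\<close> is arbitrary, it can be taken as large
  as desired; an operation on the class of all modules restricts to each \<open>'u\<close>.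

  Some modules to which a closure is applied (quotients, duals, \<open>R\<close> itself) have carriers in
  another type. Their closure is computed in an isomorphic copy inside \<open>'u\<close>. By functoriality
  (axiom 4 below) the result does not depend on the copy. If there is no copy in \<open>'u\<close>, then
  \<open>closure_in\<close> is empty, so a statement that some element lies in such a closure includes that
  \<open>'u\<close> is large enough.
\<close>

type_synonym ('a, 'u) closure_op = "('a, 'u) module \<Rightarrow> 'u set \<Rightarrow> 'u set"

definition closure_in ::
    "'a ring \<Rightarrow> ('a, 'u) closure_op \<Rightarrow> ('a, 'x) module \<Rightarrow> 'x set \<Rightarrow> 'x set" where
  "closure_in R cl X N =
     {x \<in> carrier X. \<exists>D \<theta>. module R D \<and> \<theta> \<in> module_isos R X D \<and> \<theta> x \<in> cl D (\<theta> ` N)}"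

definition big_axioms :: "'a ring \<Rightarrow> 'a set \<Rightarrow> ('a, 'u) closure_op \<Rightarrow> bool" where
  "big_axioms R \<mm> cl \<longleftrightarrow>
     \<comment> \<open>(1)\<close>
     (\<forall>M N. module R M \<and> submodule N R M \<longrightarrow> submodule (cl M N) R M \<and> N \<subseteq> cl M N) \<and>
     \<comment> \<open>(2)\<close>
     (\<forall>M N. module R M \<and> submodule N R M \<longrightarrow> cl M (cl M N) = cl M N) \<and>
     \<comment> \<open>(3)\<close>
     (\<forall>W M N. module R W \<and> submodule N R W \<and> submodule M R W \<and> N \<subseteq> M
        \<longrightarrow> cl W N \<subseteq> cl W M) \<and>
     \<comment> \<open>(4)\<close>
     (\<forall>M W f N. module R M \<and> module R W \<and> f \<in> module_homs R M W \<and> submodule N R M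
        \<longrightarrow> f ` cl M N \<subseteq> cl W (f ` N)) \<and>
     \<comment> \<open>(5)\<close>
     (\<forall>M N. module R M \<and> submodule N R M \<and> cl M N = N
        \<longrightarrow> closure_in R cl (quotient_module M N) {\<zero>\<^bsub>quotient_module M N\<^esub>}
              = {\<zero>\<^bsub>quotient_module M N\<^esub>}) \<and>
     \<comment> \<open>(6)\<close>
     closure_in R cl (ring_module R) \<mm> = \<mm> \<and>
     \<comment> \<open>(7)\<close>
     (\<forall>xs x M f v. let J = Idl\<^bsub>R\<^esub> (set xs); RJ = quotient_module (ring_module R) J in
        partial_sop R \<mm> (xs @ [x]) \<and> module R M \<and>
        f \<in> module_homs R M RJ \<and> f ` carrier M = carrier RJ \<and>
        v \<in> carrier M \<and> f v = J +>\<^bsub>ring_module R\<^esub> x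
        \<longrightarrow> cl M {a \<odot>\<^bsub>M\<^esub> v | a. a \<in> carrier R} \<inter> a_kernel M RJ f
              \<subseteq> cl M {a \<odot>\<^bsub>M\<^esub> v | a. a \<in> J})"


section \<open>Phantom extensions\<close>

definition free_presentation ::
    "'a ring \<Rightarrow> ('a, 'g) module \<Rightarrow> ('g \<Rightarrow> 'f) \<Rightarrow> ('a, 'f) module \<Rightarrow> ('f \<Rightarrow> 'q)
       \<Rightarrow> ('a, 'q) module \<Rightarrow> bool" where
  "free_presentation R G \<nu> F \<mu> Q \<longleftrightarrow>
     free_module R G \<and> free_module R F \<and>
     \<nu> \<in> module_homs R G F \<and> \<mu> \<in> module_homs R F Q \<and>
     \<mu> ` carrier F = carrier Q \<and> \<nu> ` carrier G = a_kernel F Q \<mu>"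

definition image_dual_map ::
    "'a ring \<Rightarrow> ('a, 'g) module \<Rightarrow> ('g \<Rightarrow> 'f) \<Rightarrow> ('a, 'f) module \<Rightarrow> ('g \<Rightarrow> 'a) set" where
  "image_dual_map R G \<nu> F = (\<lambda>h. \<lambda>g\<in>carrier G. h (\<nu> g)) ` carrier (dual_module R F)"

text \<open>
  The free presentation and the lift \<open>\<mu>'\<close> of \<open>\<mu>\<close> are chosen; the condition does not depend on
  the choice. The membership in \<open>closure_in\<close> forces the dual of \<open>G\<close> to have a copy in \<open>'u\<close>.
  With a universal quantifier the condition would hold vacuously if \<open>'u\<close> were too small.
\<close>

definition phantom_extension ::
    "'a ring \<Rightarrow> ('a, 'u) closure_op \<Rightarrow> ('a, 'u) module \<Rightarrow> ('a \<Rightarrow> 'u) \<Rightarrow> bool" where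
  "phantom_extension R cl M \<alpha> \<longleftrightarrow>
     module R M \<and> \<alpha> \<in> module_homs R (ring_module R) M \<and> inj_on \<alpha> (carrier R) \<and>
     (let N = \<alpha> ` carrier R; Q = quotient_module M N; \<beta> = (\<lambda>m. N +>\<^bsub>M\<^esub> m) in
      \<exists>(G :: ('a, 'u) module) \<nu> (F :: ('a, 'u) module) \<mu> \<mu>'.
        free_presentation R G \<nu> F \<mu> Q \<and>
        \<mu>' \<in> module_homs R F M \<and> (\<forall>x\<in>carrier F. \<beta> (\<mu>' x) = \<mu> x) \<and>
        (\<lambda>g\<in>carrier G. inv_into (carrier R) \<alpha> (\<mu>' (\<nu> g)))
          \<in> closure_in R cl (dual_module R G) (image_dual_map R G \<nu> F))"


section \<open>Direct limits\<close>

text \<open>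
  \<open>r\<close> is a non-strict order on the index set \<open>I\<close>, and \<open>\<phi> i j\<close> is the map from \<open>N i\<close> to \<open>N j\<close>
  for \<open>(i, j) \<in> r\<close>. The direct limit is the disjoint union of the modules \<open>N i\<close>, \<open>i \<in> I\<close>, modulo
  identification of elements that have the same image at some later stage.
\<close>

definition direct_system ::
    "'a ring \<Rightarrow> 'i set \<Rightarrow> 'i rel \<Rightarrow> ('i \<Rightarrow> ('a, 'b) module) \<Rightarrow> ('i \<Rightarrow> 'i \<Rightarrow> 'b \<Rightarrow> 'b) \<Rightarrow> bool" where
  "direct_system R I r N \<phi> \<longleftrightarrow>
     (\<forall>i\<in>I. module R (N i)) \<and>
     (\<forall>i\<in>I. \<forall>j\<in>I. (i, j) \<in> r \<longrightarrow> \<phi> i j \<in> module_homs R (N i) (N j)) \<and>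
     (\<forall>i\<in>I. \<forall>x\<in>carrier (N i). \<phi> i i x = x) \<and>
     (\<forall>i\<in>I. \<forall>j\<in>I. \<forall>k\<in>I. (i, j) \<in> r \<and> (j, k) \<in> r
        \<longrightarrow> (\<forall>x\<in>carrier (N i). \<phi> j k (\<phi> i j x) = \<phi> i k x))"

definition limit_class ::
    "'i set \<Rightarrow> 'i rel \<Rightarrow> ('i \<Rightarrow> ('a, 'b) module) \<Rightarrow> ('i \<Rightarrow> 'i \<Rightarrow> 'b \<Rightarrow> 'b) \<Rightarrow> 'i \<Rightarrow> 'b \<Rightarrow> ('i \<times> 'b) set"
  where
  "limit_class I r N \<phi> i x =
     {(j, y). j \<in> I \<and> y \<in> carrier (N j) \<and>
              (\<exists>k\<in>I. (i, k) \<in> r \<and> (j, k) \<in> r \<and> \<phi> i k x = \<phi> j k y)}"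

definition direct_limit_module ::
    "'i set \<Rightarrow> 'i rel \<Rightarrow> ('i \<Rightarrow> ('a, 'b) module) \<Rightarrow> ('i \<Rightarrow> 'i \<Rightarrow> 'b \<Rightarrow> 'b)
       \<Rightarrow> ('a, ('i \<times> 'b) set) module" where
  "direct_limit_module I r N \<phi> =
     \<lparr>carrier = {limit_class I r N \<phi> i x | i x. i \<in> I \<and> x \<in> carrier (N i)},
      monoid.mult = undefined, monoid.one = undefined,
      ring.zero = (\<Union>i\<in>I. limit_class I r N \<phi> i \<zero>\<^bsub>N i\<^esub>),
      ring.add = (\<lambda>X Y. \<Union>{limit_class I r N \<phi> k (\<phi> i k x \<oplus>\<^bsub>N k\<^esub> \<phi> j k y) | i x j y k.
                       (i, x) \<in> X \<and> (j, y) \<in> Y \<and> k \<in> I \<and> (i, k) \<in> r \<and> (j, k) \<in> r}),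
      smult = (\<lambda>a X. \<Union>{limit_class I r N \<phi> i (a \<odot>\<^bsub>N i\<^esub> x) | i x. (i, x) \<in> X})\<rparr>"

definition is_direct_limit ::
    "'a ring \<Rightarrow> 'i set \<Rightarrow> 'i rel \<Rightarrow> ('i \<Rightarrow> ('a, 'b) module) \<Rightarrow> ('i \<Rightarrow> 'i \<Rightarrow> 'b \<Rightarrow> 'b)
       \<Rightarrow> ('a, 'c) module \<Rightarrow> ('i \<Rightarrow> 'b \<Rightarrow> 'c) \<Rightarrow> bool" where
  "is_direct_limit R I r N \<phi> L \<psi> \<longleftrightarrow>
     module R L \<and>
     (\<exists>\<theta>\<in>module_isos R (direct_limit_module I r N \<phi>) L.
        \<forall>i\<in>I. \<forall>x\<in>carrier (N i). \<psi> i x = \<theta> (limit_class I r N \<phi> i x))"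


section \<open>Module modifications\<close>

text \<open>
  \<open>(M \<oplus> R\<^sup>k) / R(u, x\<^sub>1, \<dots>, x\<^sub>k)\<close> with \<open>xs = [x\<^sub>1, \<dots>, x\<^sub>k]\<close>, and the class of \<open>(w, 0)\<close> in it.
\<close>

definition modification_relation :: "'a ring \<Rightarrow> ('a, 'b) module \<Rightarrow> 'a list \<Rightarrow> 'b \<Rightarrow> ('b \<times> (nat \<Rightarrow> 'a)) set"
  where
  "modification_relation R M xs u =
     generated_submodule R (module_sum M (power_module R (length xs)))
       {(u, \<lambda>i\<in>{..<length xs}. xs ! i)}"

definition modification :: "'a ring \<Rightarrow> ('a, 'b) module \<Rightarrow> 'a list \<Rightarrow> 'b
     \<Rightarrow> ('a, ('b \<times> (nat \<Rightarrow> 'a)) set) module" where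
  "modification R M xs u =
     quotient_module (module_sum M (power_module R (length xs))) (modification_relation R M xs u)"

definition modification_map :: "'a ring \<Rightarrow> ('a, 'b) module \<Rightarrow> 'a list \<Rightarrow> 'b
     \<Rightarrow> 'b \<Rightarrow> ('b \<times> (nat \<Rightarrow> 'a)) set" where
  "modification_map R M xs u w =
     modification_relation R M xs u
       +>\<^bsub>module_sum M (power_module R (length xs))\<^esub> (w, \<zero>\<^bsub>power_module R (length xs)\<^esub>)"

text \<open>
  \<open>M'\<close> together with \<open>f : M \<rightarrow> M'\<close> is, up to isomorphism under \<open>M\<close>, the modification of \<open>M\<close>
  with respect to some relation \<open>x\<^sub>1 u\<^sub>1 + \<dots> + x\<^sub>k u\<^sub>k + x u = 0\<close>, with \<open>x\<close> and \<open>u\<close> in the last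
  place.
\<close>

definition is_module_modification ::
    "'a ring \<Rightarrow> 'a set \<Rightarrow> ('a, 'b) module \<Rightarrow> ('a, 'c) module \<Rightarrow> ('b \<Rightarrow> 'c) \<Rightarrow> bool" where
  "is_module_modification R \<mm> M M' f \<longleftrightarrow>
     module R M' \<and>
     (\<exists>xs x us u. partial_sop R \<mm> (xs @ [x]) \<and> length us = length xs \<and>
        set us \<subseteq> carrier M \<and> u \<in> carrier M \<and>
        (\<Oplus>\<^bsub>M\<^esub> i \<in> {..<length xs}. (xs ! i) \<odot>\<^bsub>M\<^esub> (us ! i)) \<oplus>\<^bsub>M\<^esub> (x \<odot>\<^bsub>M\<^esub> u) = \<zero>\<^bsub>M\<^esub> \<and>
        (\<exists>\<theta>\<in>module_isos R (modification R M xs u) M'.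
           \<forall>w\<in>carrier M. f w = \<theta> (modification_map R M xs u w)))"

text \<open>
  The transfinite sequence is indexed by a nonempty well-order \<open>r\<close>, where \<open>underS r j\<close> is the set
  of strict predecessors of \<open>j\<close>. An index with strict predecessors is a successor if these have a
  greatest element and a limit otherwise. A sequence with a last term has that term as its direct
  limit, so finite sequences, including the one consisting of \<open>M\<close> alone, are covered.
\<close>

definition modification_sequence ::
    "'a ring \<Rightarrow> 'a set \<Rightarrow> ('a, 'b) module \<Rightarrow> 'i rel \<Rightarrow> ('i \<Rightarrow> ('a, 'b) module)
       \<Rightarrow> ('i \<Rightarrow> 'i \<Rightarrow> 'b \<Rightarrow> 'b) \<Rightarrow> bool" where
  "modification_sequence R \<mm> M r N \<phi> \<longleftrightarrow>
     Well_order r \<and> Field r \<noteq> {} \<and> direct_system R (Field r) r N \<phi> \<and>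
     (\<forall>j\<in>Field r.
        (underS r j = {} \<longrightarrow> N j = M) \<and>
        (\<forall>i. i \<in> underS r j \<and> (\<forall>k\<in>underS r j. (k, i) \<in> r)
             \<longrightarrow> is_module_modification R \<mm> (N i) (N j) (\<phi> i j)) \<and>
        (underS r j \<noteq> {} \<and> \<not> (\<exists>i\<in>underS r j. \<forall>k\<in>underS r j. (k, i) \<in> r)
             \<longrightarrow> is_direct_limit R (underS r j) r N \<phi> (N j) (\<lambda>i. \<phi> i j)))"

definition can_be_modified_into ::
    "'a ring \<Rightarrow> 'a set \<Rightarrow> ('a, 'u) module \<Rightarrow> ('a, 'u) module \<Rightarrow> bool" where
  "can_be_modified_into R \<mm> M B \<longleftrightarrow>
     (\<exists>(r :: 'u rel) N \<phi> \<psi>. modification_sequence R \<mm> M r N \<phi> \<and>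
        is_direct_limit R (Field r) r N \<phi> B \<psi>)"


section \<open>Balanced big Cohen--Macaulay modules\<close>

definition regular_sequence :: "'a ring \<Rightarrow> ('a, 'b) module \<Rightarrow> 'a list \<Rightarrow> bool" where
  "regular_sequence R B xs \<longleftrightarrow>
     ideal_smult R (Idl\<^bsub>R\<^esub> (set xs)) B \<noteq> carrier B \<and>
     (\<forall>i<length xs.
        let Q = quotient_module B (ideal_smult R (Idl\<^bsub>R\<^esub> (set (take i xs))) B) in
        \<forall>q\<in>carrier Q. (xs ! i) \<odot>\<^bsub>Q\<^esub> q = \<zero>\<^bsub>Q\<^esub> \<longrightarrow> q = \<zero>\<^bsub>Q\<^esub>)"

definition balanced_big_CM :: "'a ring \<Rightarrow> 'a set \<Rightarrow> ('a, 'b) module \<Rightarrow> bool" where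
  "balanced_big_CM R \<mm> B \<longleftrightarrow>
     module R B \<and> ideal_smult R \<mm> B \<noteq> carrier B \<and>
     (\<forall>xs. partial_sop R \<mm> xs \<longrightarrow> regular_sequence R B xs)"

end

theory Submission
  imports Defs
begin

text \<open>
  Let \<open>e = \<alpha>(1)\<close>. The proof replaces phantomness of \<open>\<alpha>\<close> by a condition on the pair \<open>(M, e)\<close>
  that survives both module modifications and direct limits. Call \<open>e\<close> linearly phantom
  if, whenever a finite linear system \<open>A y = b e\<close> over \<open>R\<close> is solvable in \<open>M\<close>, the vector \<open>b\<close>
  lies in the closure of the column space of \<open>A\<close> in \<open>R\<^sup>m\<close>.

  \<^item> A phantom extension has this property: a solution \<open>y\<close> determines a map from the dual of \<open>G\<close> to
    \<open>R\<^sup>m\<close> that carries the phantom condition to \<open>R\<^sup>m\<close>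
    (\<open>linearly_phantom_of_phantom_extension\<close>).
  \<^item> It passes to direct limits, since a solution involves finitely many elements
    (\<open>linearly_phantom_direct_limit\<close>).
  \<^item> It passes to a modification of \<open>M\<close>: a system that is solvable in \<open>M'\<close> becomes a system
    over \<open>M\<close> with the given relation as an additional equation, and the colon-capturing axiom
    removes the additional coordinate (\<open>linearly_phantom_modification\<close>).
  \<^item> It implies \<open>M \<noteq> \<mm>M\<close>: if \<open>e = a\<^sub>1 y\<^sub>1 + \<dots> + a\<^sub>n y\<^sub>n\<close> with \<open>a\<^sub>i \<in> \<mm>\<close>, then \<open>1\<close> lies
    in the closure of \<open>\<mm>\<close>, which is \<open>\<mm>\<close> (\<open>linearly_phantom_imp_proper\<close>).

  It therefore suffices to modify \<open>M\<close> transfinitely until every relation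
  \<open>x\<^sub>1 u\<^sub>1 + \<dots> + x\<^sub>k u\<^sub>k + x u = 0\<close> that occurs at some stage has been used at a later one. A modification
  puts \<open>u\<close> into the submodule generated by the multiples of \<open>x\<^sub>1, \<dots>, x\<^sub>k\<close>. So in the limit \<open>B\<close>
  multiplication by \<open>x\<close> is injective modulo \<open>(x\<^sub>1, \<dots>, x\<^sub>k) B\<close>, and \<open>B \<noteq> \<mm>B\<close> by the
  preceding points.

  The sequence is indexed by the cardinal of \<open>'u\<close>. If \<open>R\<close> is infinite, then so is \<open>'u\<close>, because
  \<open>\<alpha>\<close> is injective; then all terms and all powers \<open>R\<^sup>m\<close> have copies with carriers in \<open>'u\<close>,
  and there are at most as many relations as elements of \<open>'u\<close>, so each of them can be
  listed cofinally often. If \<open>R\<close> is finite, it is a field, the only partial system of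
  parameters is the empty one, and \<open>B = M\<close>.
\<close>

section \<open>Homomorphisms, submodules and quotients\<close>

lemma module_homsI:
  assumes "\<And>x. x \<in> carrier M \<Longrightarrow> f x \<in> carrier N"
    and "\<And>x y. x \<in> carrier M \<Longrightarrow> y \<in> carrier M \<Longrightarrow> f (x \<oplus>\<^bsub>M\<^esub> y) = f x \<oplus>\<^bsub>N\<^esub> f y"
    and "\<And>a x. a \<in> carrier R \<Longrightarrow> x \<in> carrier M \<Longrightarrow> f (a \<odot>\<^bsub>M\<^esub> x) = a \<odot>\<^bsub>N\<^esub> f x"
  shows "f \<in> module_homs R M N"
  using assms unfolding module_homs_def by blast

lemma module_homsD:
  assumes "f \<in> module_homs R M N"
  shows module_homs_closed: "x \<in> carrier M \<Longrightarrow> f x \<in> carrier N"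
    and module_homs_add: "x \<in> carrier M \<Longrightarrow> y \<in> carrier M \<Longrightarrow> f (x \<oplus>\<^bsub>M\<^esub> y) = f x \<oplus>\<^bsub>N\<^esub> f y"
    and module_homs_smult: "a \<in> carrier R \<Longrightarrow> x \<in> carrier M \<Longrightarrow> f (a \<odot>\<^bsub>M\<^esub> x) = a \<odot>\<^bsub>N\<^esub> f x"
  using assms unfolding module_homs_def by blast+

lemma module_homs_comp:
  assumes "f \<in> module_homs R M N" "g \<in> module_homs R N L"
  shows "(\<lambda>x. g (f x)) \<in> module_homs R M L"
  using assms unfolding module_homs_def by (auto simp: Pi_iff)

lemma module_homs_zero:
  assumes "module R M" "module R N" "f \<in> module_homs R M N"
  shows "f \<zero>\<^bsub>M\<^esub> = \<zero>\<^bsub>N\<^esub>"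
proof -
  interpret M: module R M by fact
  interpret N: module R N by fact
  have "f (\<zero>\<^bsub>R\<^esub> \<odot>\<^bsub>M\<^esub> \<zero>\<^bsub>M\<^esub>) = \<zero>\<^bsub>R\<^esub> \<odot>\<^bsub>N\<^esub> f \<zero>\<^bsub>M\<^esub>"
    using module_homs_smult[OF assms(3)] by blast
  then show ?thesis using module_homs_closed[OF assms(3)] by simp
qed

lemma smult_minus_one:
  assumes "module R M" "x \<in> carrier M"
  shows "(\<ominus>\<^bsub>R\<^esub> \<one>\<^bsub>R\<^esub>) \<odot>\<^bsub>M\<^esub> x = \<ominus>\<^bsub>M\<^esub> x"
proof -
  interpret M: module R M by fact
  show ?thesis using M.smult_l_minus[of "\<one>\<^bsub>R\<^esub>" x] assms(2) by simp
qed

lemma module_homs_neg: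
  assumes "module R M" "module R N" "f \<in> module_homs R M N" "x \<in> carrier M"
  shows "f (\<ominus>\<^bsub>M\<^esub> x) = \<ominus>\<^bsub>N\<^esub> f x"
proof -
  interpret M: module R M by fact
  show ?thesis
    using smult_minus_one[OF assms(1,4)] smult_minus_one[OF assms(2) module_homs_closed[OF assms(3,4)]]
      module_homs_smult[OF assms(3) _ assms(4), of "\<ominus>\<^bsub>R\<^esub> \<one>\<^bsub>R\<^esub>"] by simp
qed

lemma module_homs_minus:
  assumes "module R M" "module R N" "f \<in> module_homs R M N" "x \<in> carrier M" "y \<in> carrier M"
  shows "f (x \<ominus>\<^bsub>M\<^esub> y) = f x \<ominus>\<^bsub>N\<^esub> f y"
proof -
  interpret M: module R M by fact
  show ?thesis
    using assms by (simp add: a_minus_def module_homs_add[OF assms(3)] module_homs_neg[OF assms(1-3)])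
qed

lemma module_homs_eq_iff:
  assumes "module R M" "module R N" "f \<in> module_homs R M N" "x \<in> carrier M" "y \<in> carrier M"
  shows "f x = f y \<longleftrightarrow> f (x \<ominus>\<^bsub>M\<^esub> y) = \<zero>\<^bsub>N\<^esub>"
proof -
  interpret N: module R N by fact
  show ?thesis
    using assms module_homs_minus[OF assms] module_homs_closed[OF assms(3)]
      N.M.minus_equality[of "f x" "\<ominus>\<^bsub>N\<^esub> f y"]
    by (auto simp: a_minus_def N.M.r_neg)
qed

lemma module_homs_finsum:
  fixes g :: "nat \<Rightarrow> _"
  assumes M: "module R M" and N: "module R N" and f: "f \<in> module_homs R M N"
    and g: "\<And>i. i < k \<Longrightarrow> g i \<in> carrier M"
  shows "f (\<Oplus>\<^bsub>M\<^esub> i \<in> {..<k}. g i) = (\<Oplus>\<^bsub>N\<^esub> i \<in> {..<k}. f (g i))"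
  using g
proof (induction k)
  case 0
  interpret M: module R M by fact
  interpret N: module R N by fact
  show ?case using module_homs_zero[OF M N f] by simp
next
  case (Suc k)
  interpret M: module R M by fact
  interpret N: module R N by fact
  have "\<And>i. i < Suc k \<Longrightarrow> f (g i) \<in> carrier N"
    using Suc.prems module_homs_closed[OF f] by blast
  then show ?case
    using Suc by (simp add: lessThan_Suc Pi_iff module_homs_add[OF f])
qed

lemma submoduleI_smult:
  assumes "module R M" "H \<subseteq> carrier M" "\<zero>\<^bsub>M\<^esub> \<in> H"
    and "\<And>x y. x \<in> H \<Longrightarrow> y \<in> H \<Longrightarrow> x \<oplus>\<^bsub>M\<^esub> y \<in> H"
    and smult: "\<And>a x. a \<in> carrier R \<Longrightarrow> x \<in> H \<Longrightarrow> a \<odot>\<^bsub>M\<^esub> x \<in> H"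
  shows "submodule H R M"
proof -
  interpret M: module R M by fact
  show ?thesis
  proof (rule M.submoduleI)
    show "\<ominus>\<^bsub>M\<^esub> a \<in> H" if "a \<in> H" for a
      using smult[OF _ that, of "\<ominus>\<^bsub>R\<^esub> \<one>\<^bsub>R\<^esub>"] smult_minus_one[OF assms(1), of a] that assms(2) by auto
  qed (use assms in auto)
qed

lemma submoduleD:
  assumes "module R M" "submodule H R M"
  shows submodule_subset: "H \<subseteq> carrier M"
    and submodule_carrier: "x \<in> H \<Longrightarrow> x \<in> carrier M"
    and submodule_zero: "\<zero>\<^bsub>M\<^esub> \<in> H"
    and submodule_add: "x \<in> H \<Longrightarrow> y \<in> H \<Longrightarrow> x \<oplus>\<^bsub>M\<^esub> y \<in> H"
    and submodule_neg: "x \<in> H \<Longrightarrow> \<ominus>\<^bsub>M\<^esub> x \<in> H"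
    and submodule_smult: "a \<in> carrier R \<Longrightarrow> x \<in> H \<Longrightarrow> a \<odot>\<^bsub>M\<^esub> x \<in> H"
proof -
  interpret M: module R M by fact
  note E = M.submoduleE[OF assms(2)]
  show "H \<subseteq> carrier M" "x \<in> H \<Longrightarrow> x \<in> carrier M"
    "x \<in> H \<Longrightarrow> y \<in> H \<Longrightarrow> x \<oplus>\<^bsub>M\<^esub> y \<in> H" "x \<in> H \<Longrightarrow> \<ominus>\<^bsub>M\<^esub> x \<in> H"
    "a \<in> carrier R \<Longrightarrow> x \<in> H \<Longrightarrow> a \<odot>\<^bsub>M\<^esub> x \<in> H"
    using E by auto
  show "\<zero>\<^bsub>M\<^esub> \<in> H"
    using subgroup.one_closed[OF submodule.axioms(1)[OF assms(2)]] by simp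
qed

lemma zero_submodule: "module R M \<Longrightarrow> submodule {\<zero>\<^bsub>M\<^esub>} R M"
proof (rule submoduleI_smult)
  assume "module R M"
  then interpret M: module R M .
  show "{\<zero>\<^bsub>M\<^esub>} \<subseteq> carrier M" by simp
  show "\<And>x y. x \<in> {\<zero>\<^bsub>M\<^esub>} \<Longrightarrow> y \<in> {\<zero>\<^bsub>M\<^esub>} \<Longrightarrow> x \<oplus>\<^bsub>M\<^esub> y \<in> {\<zero>\<^bsub>M\<^esub>}" by simp
  show "\<And>a x. a \<in> carrier R \<Longrightarrow> x \<in> {\<zero>\<^bsub>M\<^esub>} \<Longrightarrow> a \<odot>\<^bsub>M\<^esub> x \<in> {\<zero>\<^bsub>M\<^esub>}" by simp
qed auto

lemma image_submodule:
  assumes M: "module R M" and N: "module R N" and f: "f \<in> module_homs R M N" and H: "submodule H R M"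
  shows "submodule (f ` H) R N"
proof (rule submoduleI_smult[OF N])
  note HM = submodule_carrier[OF M H]
  show "f ` H \<subseteq> carrier N" using HM module_homs_closed[OF f] by blast
  show "\<zero>\<^bsub>N\<^esub> \<in> f ` H"
    using module_homs_zero[OF M N f] submodule_zero[OF M H] by (metis imageI)
  show "x \<oplus>\<^bsub>N\<^esub> y \<in> f ` H" if "x \<in> f ` H" "y \<in> f ` H" for x y
  proof -
    obtain x' y' where "x = f x'" "y = f y'" "x' \<in> H" "y' \<in> H" using \<open>x \<in> f ` H\<close> \<open>y \<in> f ` H\<close> by blast
    then have "x \<oplus>\<^bsub>N\<^esub> y = f (x' \<oplus>\<^bsub>M\<^esub> y')" using HM module_homs_add[OF f] by simp
    then show ?thesis using submodule_add[OF M H \<open>x' \<in> H\<close> \<open>y' \<in> H\<close>] by simp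
  qed
  show "a \<odot>\<^bsub>N\<^esub> x \<in> f ` H" if "a \<in> carrier R" "x \<in> f ` H" for a x
  proof -
    obtain x' where "x = f x'" "x' \<in> H" using \<open>x \<in> f ` H\<close> by blast
    then have "a \<odot>\<^bsub>N\<^esub> x = f (a \<odot>\<^bsub>M\<^esub> x')" using HM module_homs_smult[OF f \<open>a \<in> carrier R\<close>] by simp
    then show ?thesis using submodule_smult[OF M H \<open>a \<in> carrier R\<close> \<open>x' \<in> H\<close>] by simp
  qed
qed

text \<open>Each structure below (a quotient, a copy on another carrier) is the image of a module under a
  map that respects the operations, and this makes it a module.\<close>

lemma module_surjective_image:
  assumes M: "module R M" and f: "f \<in> module_homs R M N" and surj: "f ` carrier M = carrier N"
    and zero: "f \<zero>\<^bsub>M\<^esub> = \<zero>\<^bsub>N\<^esub>"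
  shows "module R N"
proof -
  interpret M: module R M by fact
  note add = module_homs_add[OF f, symmetric] and smult = module_homs_smult[OF f, symmetric]
  have pick: "\<exists>x'\<in>carrier M. x = f x'" if "x \<in> carrier N" for x using surj that by blast
  have cl: "f x \<in> carrier N" if "x \<in> carrier M" for x using surj that by blast
  show ?thesis
  proof (rule moduleI)
    show "cring R" by (rule M.R.is_cring)
    show "abelian_group N"
    proof (rule abelian_groupI)
      show "x \<oplus>\<^bsub>N\<^esub> y \<in> carrier N" if "x \<in> carrier N" "y \<in> carrier N" for x y
        using pick[OF that(1)] pick[OF that(2)] by (auto simp: add cl)
      show "\<zero>\<^bsub>N\<^esub> \<in> carrier N" using zero cl[OF M.M.zero_closed] by simp
      show "x \<oplus>\<^bsub>N\<^esub> y \<oplus>\<^bsub>N\<^esub> z = x \<oplus>\<^bsub>N\<^esub> (y \<oplus>\<^bsub>N\<^esub> z)"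
        if "x \<in> carrier N" "y \<in> carrier N" "z \<in> carrier N" for x y z
        using pick[OF that(1)] pick[OF that(2)] pick[OF that(3)] by (auto simp: add M.a_assoc)
      show "x \<oplus>\<^bsub>N\<^esub> y = y \<oplus>\<^bsub>N\<^esub> x" if "x \<in> carrier N" "y \<in> carrier N" for x y
        using pick[OF that(1)] pick[OF that(2)] by (auto simp: add M.a_comm)
      show "\<zero>\<^bsub>N\<^esub> \<oplus>\<^bsub>N\<^esub> x = x" if "x \<in> carrier N" for x
        using pick[OF that] by (auto simp: add zero[symmetric])
      show "\<exists>y\<in>carrier N. y \<oplus>\<^bsub>N\<^esub> x = \<zero>\<^bsub>N\<^esub>" if x: "x \<in> carrier N" for x
      proof -
        obtain x' where x': "x' \<in> carrier M" "x = f x'" using pick[OF x] by blast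
        then have "f (\<ominus>\<^bsub>M\<^esub> x') \<oplus>\<^bsub>N\<^esub> x = \<zero>\<^bsub>N\<^esub>" by (simp add: add zero[symmetric] M.l_neg)
        then show ?thesis using cl x' by blast
      qed
    qed
    show "a \<odot>\<^bsub>N\<^esub> x \<in> carrier N" if "a \<in> carrier R" "x \<in> carrier N" for a x
      using pick[OF that(2)] that(1) by (auto simp: smult cl)
    show "(a \<oplus>\<^bsub>R\<^esub> b) \<odot>\<^bsub>N\<^esub> x = a \<odot>\<^bsub>N\<^esub> x \<oplus>\<^bsub>N\<^esub> b \<odot>\<^bsub>N\<^esub> x"
      if "a \<in> carrier R" "b \<in> carrier R" "x \<in> carrier N" for a b x
      using pick[OF that(3)] that(1,2) by (auto simp: smult add M.smult_l_distr)
    show "a \<odot>\<^bsub>N\<^esub> (x \<oplus>\<^bsub>N\<^esub> y) = a \<odot>\<^bsub>N\<^esub> x \<oplus>\<^bsub>N\<^esub> a \<odot>\<^bsub>N\<^esub> y"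
      if "a \<in> carrier R" "x \<in> carrier N" "y \<in> carrier N" for a x y
      using pick[OF that(2)] pick[OF that(3)] that(1) by (auto simp: smult add M.smult_r_distr)
    show "(a \<otimes>\<^bsub>R\<^esub> b) \<odot>\<^bsub>N\<^esub> x = a \<odot>\<^bsub>N\<^esub> (b \<odot>\<^bsub>N\<^esub> x)"
      if "a \<in> carrier R" "b \<in> carrier R" "x \<in> carrier N" for a b x
      using pick[OF that(3)] that(1,2) by (auto simp: smult M.smult_assoc1)
    show "\<one>\<^bsub>R\<^esub> \<odot>\<^bsub>N\<^esub> x = x" if "x \<in> carrier N" for x
      using pick[OF that] by (auto simp: smult)
  qed
qed

lemma factor_through_surjection:
  assumes X: "module R X" and Y: "module R Y" and Z: "module R Z"
    and \<pi>: "\<pi> \<in> module_homs R X Y" "\<pi> ` carrier X = carrier Y"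
    and f: "f \<in> module_homs R X Z"
    and ker: "\<And>x. x \<in> carrier X \<Longrightarrow> \<pi> x = \<zero>\<^bsub>Y\<^esub> \<Longrightarrow> f x = \<zero>\<^bsub>Z\<^esub>"
  obtains \<theta> where "\<theta> \<in> module_homs R Y Z" "\<And>x. x \<in> carrier X \<Longrightarrow> \<theta> (\<pi> x) = f x"
proof
  interpret X: module R X by fact
  define \<theta> where "\<theta> y = f (inv_into (carrier X) \<pi> y)" for y
  show eq: "\<theta> (\<pi> x) = f x" if x: "x \<in> carrier X" for x
  proof -
    let ?x = "inv_into (carrier X) \<pi> (\<pi> x)"
    have x': "?x \<in> carrier X" "\<pi> ?x = \<pi> x"
      using x by (auto intro: inv_into_into f_inv_into_f)
    then have "\<pi> (?x \<ominus>\<^bsub>X\<^esub> x) = \<zero>\<^bsub>Y\<^esub>" using module_homs_eq_iff[OF X Y \<pi>(1)] x by blast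
    then have "f (?x \<ominus>\<^bsub>X\<^esub> x) = \<zero>\<^bsub>Z\<^esub>" using ker x x'(1) by simp
    then show ?thesis unfolding \<theta>_def using module_homs_eq_iff[OF X Z f x'(1) x] by blast
  qed
  show "\<theta> \<in> module_homs R Y Z"
  proof (rule module_homsI)
    show "\<theta> y \<in> carrier Z" if y: "y \<in> carrier Y" for y
    proof -
      obtain x where "x \<in> carrier X" "y = \<pi> x" using y \<pi>(2) by blast
      then show ?thesis using eq module_homs_closed[OF f] by simp
    qed
    show "\<theta> (y \<oplus>\<^bsub>Y\<^esub> y') = \<theta> y \<oplus>\<^bsub>Z\<^esub> \<theta> y'" if yy': "y \<in> carrier Y" "y' \<in> carrier Y" for y y'
    proof -
      obtain x x' where "x \<in> carrier X" "y = \<pi> x" "x' \<in> carrier X" "y' = \<pi> x'" using yy' \<pi>(2) by blast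
      then show ?thesis
        using eq module_homs_add[OF f] module_homs_add[OF \<pi>(1), symmetric] by simp
    qed
    show "\<theta> (a \<odot>\<^bsub>Y\<^esub> y) = a \<odot>\<^bsub>Z\<^esub> \<theta> y" if a: "a \<in> carrier R" and y: "y \<in> carrier Y" for a y
    proof -
      obtain x where "x \<in> carrier X" "y = \<pi> x" using y \<pi>(2) by blast
      then show ?thesis
        using a eq module_homs_smult[OF f] module_homs_smult[OF \<pi>(1), symmetric] by simp
    qed
  qed
qed

lemma factor_through_surjection_iso:
  assumes X: "module R X" and Y: "module R Y" and Z: "module R Z"
    and \<pi>: "\<pi> \<in> module_homs R X Y" "\<pi> ` carrier X = carrier Y"
    and f: "f \<in> module_homs R X Z" "f ` carrier X = carrier Z"
    and ker: "\<And>x. x \<in> carrier X \<Longrightarrow> \<pi> x = \<zero>\<^bsub>Y\<^esub> \<longleftrightarrow> f x = \<zero>\<^bsub>Z\<^esub>"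
  obtains \<theta> where "\<theta> \<in> module_isos R Y Z" "\<And>x. x \<in> carrier X \<Longrightarrow> \<theta> (\<pi> x) = f x"
proof -
  interpret X: module R X by fact
  have ker': "f x = \<zero>\<^bsub>Z\<^esub>" if "x \<in> carrier X" "\<pi> x = \<zero>\<^bsub>Y\<^esub>" for x using ker that by blast
  obtain \<theta> where \<theta>: "\<theta> \<in> module_homs R Y Z" "\<And>x. x \<in> carrier X \<Longrightarrow> \<theta> (\<pi> x) = f x"
    using factor_through_surjection[OF X Y Z \<pi> f(1) ker'] by blast
  have "inj_on \<theta> (carrier Y)"
  proof (rule inj_onI)
    fix y y' assume "y \<in> carrier Y" "y' \<in> carrier Y" and e: "\<theta> y = \<theta> y'"
    then obtain x x' where x: "x \<in> carrier X" "y = \<pi> x" "x' \<in> carrier X" "y' = \<pi> x'" using \<pi>(2) by blast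
    then have "f x = f x'" using e \<theta>(2) by simp
    then have "f (x \<ominus>\<^bsub>X\<^esub> x') = \<zero>\<^bsub>Z\<^esub>" using module_homs_eq_iff[OF X Z f(1)] x by blast
    then have "\<pi> (x \<ominus>\<^bsub>X\<^esub> x') = \<zero>\<^bsub>Y\<^esub>" using ker x by simp
    then show "y = y'" using module_homs_eq_iff[OF X Y \<pi>(1)] x by blast
  qed
  moreover have "\<theta> ` carrier Y = carrier Z"
    using \<pi>(2) f(2) \<theta>(2) by (metis (mono_tags, lifting) image_cong image_image)
  ultimately have "\<theta> \<in> module_isos R Y Z"
    using \<theta>(1) by (simp add: module_isos_def bij_betw_def)
  then show thesis using \<theta>(2) by (rule that)
qed

lemma module_isosD:
  assumes "\<theta> \<in> module_isos R X Y"
  shows module_isos_hom: "\<theta> \<in> module_homs R X Y"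
    and module_isos_inj: "inj_on \<theta> (carrier X)"
    and module_isos_surj: "\<theta> ` carrier X = carrier Y"
  using assms by (auto simp: module_isos_def bij_betw_def)

lemma module_isos_inverse:
  assumes X: "module R X" and Y: "module R Y" and \<theta>: "\<theta> \<in> module_isos R X Y"
  obtains \<eta> where "\<eta> \<in> module_homs R Y X" "\<And>x. x \<in> carrier X \<Longrightarrow> \<eta> (\<theta> x) = x"
proof -
  note h = module_isos_hom[OF \<theta>] and i = module_isos_inj[OF \<theta>] and s = module_isos_surj[OF \<theta>]
  interpret X: module R X by fact
  have id: "(\<lambda>x. x) \<in> module_homs R X X" by (rule module_homsI) auto
  have ker: "x = \<zero>\<^bsub>X\<^esub>" if "x \<in> carrier X" "\<theta> x = \<zero>\<^bsub>Y\<^esub>" for x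
    using inj_onD[OF i, of x "\<zero>\<^bsub>X\<^esub>"] module_homs_zero[OF X Y h] that by simp
  show thesis
    using factor_through_surjection[OF X Y X h s id ker] that by blast
qed

lemma isomorphic_copy:
  fixes g :: "'x \<Rightarrow> 'u"
  assumes X: "module R X" and g: "inj_on g (carrier X)"
  obtains D :: "('a, 'u) module" where "module R D" "g \<in> module_isos R X D"
proof
  interpret X: module R X by fact
  let ?h = "inv_into (carrier X) g"
  define D :: "('a, 'u) module" where
    "D = \<lparr>carrier = g ` carrier X, monoid.mult = undefined, monoid.one = undefined,
      ring.zero = g \<zero>\<^bsub>X\<^esub>, ring.add = (\<lambda>x y. g (?h x \<oplus>\<^bsub>X\<^esub> ?h y)),
      smult = (\<lambda>a x. g (a \<odot>\<^bsub>X\<^esub> ?h x))\<rparr>"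
  have h: "?h (g x) = x" if "x \<in> carrier X" for x using inv_into_f_f[OF g that] .
  have hom: "g \<in> module_homs R X D" by (rule module_homsI) (auto simp: D_def h)
  moreover have surj: "g ` carrier X = carrier D" by (simp add: D_def)
  ultimately show "g \<in> module_isos R X D" using g by (simp add: module_isos_def bij_betw_def)
  show "module R D" by (rule module_surjective_image[OF X hom surj]) (simp add: D_def)
qed

context
  fixes R :: "'a ring" and M :: "('a, 'b) module" and N :: "'b set"
  assumes M: "module R M" and N: "submodule N R M"
begin

interpretation M: module R M by (fact M)

interpretation N: abelian_subgroup N M
  by (intro abelian_subgroupI3 M.abelian_group_axioms additive_subgroup.intro
      submodule.axioms(1)[OF N])

lemma quotient_coset_eq_iff:
  assumes "x \<in> carrier M" "y \<in> carrier M"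
  shows "N +>\<^bsub>M\<^esub> x = N +>\<^bsub>M\<^esub> y \<longleftrightarrow> x \<ominus>\<^bsub>M\<^esub> y \<in> N"
proof -
  have "x \<in> N +>\<^bsub>M\<^esub> y \<longleftrightarrow> x \<ominus>\<^bsub>M\<^esub> y \<in> N"
    using N.a_rcos_module[OF assms(2,1)] by (simp add: a_minus_def)
  moreover have "N +>\<^bsub>M\<^esub> x = N +>\<^bsub>M\<^esub> y \<longleftrightarrow> x \<in> N +>\<^bsub>M\<^esub> y"
    using N.a_repr_independence'[OF _ assms(2)] N.a_rcos_self[OF assms(1)] by blast
  ultimately show ?thesis by simp
qed

lemma quotient_hom: "(\<lambda>x. N +>\<^bsub>M\<^esub> x) \<in> module_homs R M (quotient_module M N)"
proof (rule module_homsI)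
  show "N +>\<^bsub>M\<^esub> x \<in> carrier (quotient_module M N)" if "x \<in> carrier M" for x
    using that by (simp add: quotient_module_def M.a_rcosetsI N.a_subset)
  show "N +>\<^bsub>M\<^esub> (x \<oplus>\<^bsub>M\<^esub> y) = (N +>\<^bsub>M\<^esub> x) \<oplus>\<^bsub>quotient_module M N\<^esub> (N +>\<^bsub>M\<^esub> y)"
    if "x \<in> carrier M" "y \<in> carrier M" for x y
    using that by (simp add: quotient_module_def N.a_rcos_sum)
  show "N +>\<^bsub>M\<^esub> (a \<odot>\<^bsub>M\<^esub> x) = a \<odot>\<^bsub>quotient_module M N\<^esub> (N +>\<^bsub>M\<^esub> x)"
    if a: "a \<in> carrier R" and x: "x \<in> carrier M" for a x
  proof -
    have "N +>\<^bsub>M\<^esub> (a \<odot>\<^bsub>M\<^esub> y) = N +>\<^bsub>M\<^esub> (a \<odot>\<^bsub>M\<^esub> x)" if y: "y \<in> N +>\<^bsub>M\<^esub> x" for y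
    proof -
      have yM: "y \<in> carrier M" using N.a_elemrcos_carrier[OF x y] .
      have "y \<ominus>\<^bsub>M\<^esub> x \<in> N" using N.a_rcos_module[OF x yM] y by (simp add: a_minus_def)
      then have "a \<odot>\<^bsub>M\<^esub> (y \<ominus>\<^bsub>M\<^esub> x) \<in> N" using submodule_smult[OF M N a] by blast
      moreover have "a \<odot>\<^bsub>M\<^esub> (y \<ominus>\<^bsub>M\<^esub> x) = a \<odot>\<^bsub>M\<^esub> y \<ominus>\<^bsub>M\<^esub> a \<odot>\<^bsub>M\<^esub> x"
        using a x yM by (simp add: a_minus_def M.smult_r_distr M.smult_r_minus)
      ultimately show ?thesis using quotient_coset_eq_iff a x yM by simp
    qed
    moreover have "x \<in> N +>\<^bsub>M\<^esub> x" by (rule N.a_rcos_self[OF x])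
    ultimately have "(\<Union>y\<in>N +>\<^bsub>M\<^esub> x. N +>\<^bsub>M\<^esub> (a \<odot>\<^bsub>M\<^esub> y)) = N +>\<^bsub>M\<^esub> (a \<odot>\<^bsub>M\<^esub> x)"
      by blast
    then show ?thesis by (simp add: quotient_module_def)
  qed
qed

lemma quotient_surj: "(\<lambda>x. N +>\<^bsub>M\<^esub> x) ` carrier M = carrier (quotient_module M N)"
  by (auto simp: quotient_module_def A_RCOSETS_def')

lemma quotient_zero_iff:
  assumes "x \<in> carrier M"
  shows "N +>\<^bsub>M\<^esub> x = \<zero>\<^bsub>quotient_module M N\<^esub> \<longleftrightarrow> x \<in> N"
  using assms N.a_rcos_const N.a_rcos_self by (auto simp: quotient_module_def)

lemma quotient_is_module: "module R (quotient_module M N)"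
  using module_surjective_image[OF M quotient_hom quotient_surj]
    quotient_zero_iff[OF M.M.zero_closed] submodule_zero[OF M N] by blast

end

text \<open>Choosing preimages embeds every image of a set into any type that the set embeds into.\<close>

lemma embedding_of_image:
  fixes g :: "'x \<Rightarrow> 'u"
  assumes "inj_on g A"
  obtains h :: "'y \<Rightarrow> 'u" where "inj_on h (f ` A)"
proof
  show "inj_on (g \<circ> inv_into A f) (f ` A)"
    using assms by (intro comp_inj_on inj_on_inv_into subset_refl)
      (auto intro: inj_on_subset inv_into_into)
qed

lemma quotient_copy:
  fixes g :: "'x \<Rightarrow> 'u"
  assumes X: "module R X" and K: "submodule K R X" and g: "inj_on g (carrier X)"
  obtains D :: "('a, 'u) module" and \<pi> where "module R D" "\<pi> \<in> module_homs R X D"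
    "\<pi> ` carrier X = carrier D" "\<And>x. x \<in> carrier X \<Longrightarrow> \<pi> x = \<zero>\<^bsub>D\<^esub> \<longleftrightarrow> x \<in> K"
proof -
  let ?Q = "quotient_module X K" and ?c = "\<lambda>x. K +>\<^bsub>X\<^esub> x"
  note Q = quotient_is_module[OF X K] and c = quotient_hom[OF X K] and s = quotient_surj[OF X K]
  obtain h :: "'x set \<Rightarrow> 'u" where "inj_on h (carrier ?Q)"
    using embedding_of_image[OF g, of ?c] unfolding s by blast
  then obtain D :: "('a, 'u) module" where D: "module R D" and h: "h \<in> module_isos R ?Q D"
    by (rule isomorphic_copy[OF Q])
  show thesis
  proof (rule that[OF D module_homs_comp[OF c module_isos_hom[OF h]]])
    show "(\<lambda>x. h (?c x)) ` carrier X = carrier D"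
      using s module_isos_surj[OF h] by (metis image_image)
    show "h (?c x) = \<zero>\<^bsub>D\<^esub> \<longleftrightarrow> x \<in> K" if x: "x \<in> carrier X" for x
    proof -
      have "h (?c x) = h \<zero>\<^bsub>?Q\<^esub> \<longleftrightarrow> ?c x = \<zero>\<^bsub>?Q\<^esub>"
        using inj_on_eq_iff[OF module_isos_inj[OF h]] module_homs_closed[OF c x]
          abelian_monoid.zero_closed[OF abelian_group.axioms(1)[OF module.axioms(2)[OF Q]]] by blast
      then show ?thesis
        using quotient_zero_iff[OF X K x] module_homs_zero[OF Q D module_isos_hom[OF h]] by simp
    qed
  qed
qed

section \<open>Concrete modules\<close>

lemma ring_module_is_module:
  assumes "cring R"
  shows "module R (ring_module R)"
proof -
  interpret cring R by fact
  show ?thesis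
    by (rule moduleI)
      (auto intro!: is_cring abelian_groupI bexI[where x = "\<ominus>\<^bsub>R\<^esub> _"]
        simp: ring_module_def a_ac l_neg r_neg l_distr r_distr m_assoc)
qed

lemma module_sum_simps:
  "carrier (module_sum M N) = carrier M \<times> carrier N"
  "\<zero>\<^bsub>module_sum M N\<^esub> = (\<zero>\<^bsub>M\<^esub>, \<zero>\<^bsub>N\<^esub>)"
  "(x, y) \<oplus>\<^bsub>module_sum M N\<^esub> (x', y') = (x \<oplus>\<^bsub>M\<^esub> x', y \<oplus>\<^bsub>N\<^esub> y')"
  "a \<odot>\<^bsub>module_sum M N\<^esub> (x, y) = (a \<odot>\<^bsub>M\<^esub> x, a \<odot>\<^bsub>N\<^esub> y)"
  by (simp_all add: module_sum_def)

lemma module_sum_is_module: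
  assumes "module R M" "module R N"
  shows "module R (module_sum M N)"
proof -
  interpret M: module R M by fact
  interpret N: module R N by fact
  show ?thesis
  proof (rule moduleI)
    show "abelian_group (module_sum M N)"
    proof (rule abelian_groupI)
      fix x assume "x \<in> carrier (module_sum M N)"
      then obtain m n where x: "x = (m, n)" "m \<in> carrier M" "n \<in> carrier N"
        by (auto simp: module_sum_simps)
      show "\<exists>y\<in>carrier (module_sum M N). y \<oplus>\<^bsub>module_sum M N\<^esub> x = \<zero>\<^bsub>module_sum M N\<^esub>"
        using x by (intro bexI[where x = "(\<ominus>\<^bsub>M\<^esub> m, \<ominus>\<^bsub>N\<^esub> n)"]) (auto simp: module_sum_simps M.M.l_neg N.M.l_neg)
    qed (auto simp: module_sum_simps M.M.a_assoc N.M.a_assoc M.M.a_comm N.M.a_comm M.M.a_lcomm N.M.a_lcomm)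
  qed (auto simp: module_sum_simps M.smult_l_distr N.smult_l_distr M.smult_r_distr N.smult_r_distr
      M.smult_assoc1 N.smult_assoc1 M.R.is_cring)
qed

lemma power_module_simps:
  "carrier (power_module R k) = {..<k} \<rightarrow>\<^sub>E carrier R"
  "\<zero>\<^bsub>power_module R k\<^esub> = (\<lambda>i\<in>{..<k}. \<zero>\<^bsub>R\<^esub>)"
  "x \<oplus>\<^bsub>power_module R k\<^esub> y = (\<lambda>i\<in>{..<k}. x i \<oplus>\<^bsub>R\<^esub> y i)"
  "a \<odot>\<^bsub>power_module R k\<^esub> x = (\<lambda>i\<in>{..<k}. a \<otimes>\<^bsub>R\<^esub> x i)"
  by (simp_all add: power_module_def)

lemma power_module_eqI:
  assumes "x \<in> carrier (power_module R k)" "y \<in> carrier (power_module R k)"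
    and "\<And>i. i < k \<Longrightarrow> x i = y i"
  shows "x = y"
  using assms unfolding power_module_simps(1) by (metis PiE_ext lessThan_iff)

lemma power_module_carrier_iff:
  "x \<in> carrier (power_module R k) \<longleftrightarrow> x \<in> extensional {..<k} \<and> (\<forall>i<k. x i \<in> carrier R)"
  by (auto simp: power_module_simps PiE_def)

lemma power_module_is_module:
  assumes "cring R"
  shows "module R (power_module R k)"
proof -
  interpret cring R by fact
  have ext: "(\<lambda>i\<in>{..<k}. f i) = x" if "x \<in> extensional {..<k}" "\<And>i. i < k \<Longrightarrow> f i = x i"
    for f :: "nat \<Rightarrow> 'a" and x
    by (rule extensionalityI[of _ "{..<k}"]) (use that in auto)
  note simps = power_module_carrier_iff power_module_simps(2-4)
  show ?thesis
  proof (rule moduleI)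
    show "abelian_group (power_module R k)"
    proof (rule abelian_groupI)
      fix x assume "x \<in> carrier (power_module R k)"
      then show "\<exists>y\<in>carrier (power_module R k). y \<oplus>\<^bsub>power_module R k\<^esub> x = \<zero>\<^bsub>power_module R k\<^esub>"
        by (intro bexI[where x = "\<lambda>i\<in>{..<k}. \<ominus>\<^bsub>R\<^esub> x i"]) (auto simp: simps l_neg intro!: restrict_ext)
    next
      show "\<zero>\<^bsub>power_module R k\<^esub> \<oplus>\<^bsub>power_module R k\<^esub> x = x" if "x \<in> carrier (power_module R k)" for x
        using that by (auto simp: simps intro!: ext)
    qed (auto simp: simps a_ac intro!: restrict_ext)
    show "\<one>\<^bsub>R\<^esub> \<odot>\<^bsub>power_module R k\<^esub> x = x" if "x \<in> carrier (power_module R k)" for x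
      using that by (auto simp: simps intro!: ext)
  qed (auto simp: simps is_cring l_distr r_distr m_assoc intro!: restrict_ext)
qed

lemma dual_module_simps:
  "carrier (dual_module R G) = module_homs R G (ring_module R) \<inter> extensional (carrier G)"
  "\<zero>\<^bsub>dual_module R G\<^esub> = (\<lambda>g\<in>carrier G. \<zero>\<^bsub>R\<^esub>)"
  "h \<oplus>\<^bsub>dual_module R G\<^esub> h' = (\<lambda>g\<in>carrier G. h g \<oplus>\<^bsub>R\<^esub> h' g)"
  "a \<odot>\<^bsub>dual_module R G\<^esub> h = (\<lambda>g\<in>carrier G. a \<otimes>\<^bsub>R\<^esub> h g)"
  by (simp_all add: dual_module_def)

lemma dual_module_carrier_iff:
  "h \<in> carrier (dual_module R G) \<longleftrightarrow> h \<in> extensional (carrier G) \<and>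
     (\<forall>x\<in>carrier G. h x \<in> carrier R) \<and>
     (\<forall>x\<in>carrier G. \<forall>y\<in>carrier G. h (x \<oplus>\<^bsub>G\<^esub> y) = h x \<oplus>\<^bsub>R\<^esub> h y) \<and>
     (\<forall>a\<in>carrier R. \<forall>x\<in>carrier G. h (a \<odot>\<^bsub>G\<^esub> x) = a \<otimes>\<^bsub>R\<^esub> h x)"
  by (auto simp: dual_module_simps module_homs_def ring_module_def)

lemma dual_module_is_module:
  assumes "module R G"
  shows "module R (dual_module R G)"
proof -
  interpret G: module R G by fact
  have ext: "(\<lambda>g\<in>carrier G. f g) = h" if "h \<in> extensional (carrier G)" "\<And>g. g \<in> carrier G \<Longrightarrow> f g = h g" for f h
    by (rule extensionalityI[of _ "carrier G"]) (use that in auto)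
  have m_lcomm: "a \<otimes>\<^bsub>R\<^esub> (b \<otimes>\<^bsub>R\<^esub> c) = b \<otimes>\<^bsub>R\<^esub> (a \<otimes>\<^bsub>R\<^esub> c)"
    if "a \<in> carrier R" "b \<in> carrier R" "c \<in> carrier R" for a b c
    using that by (rule G.R.m_lcomm)
  show ?thesis
  proof (rule moduleI)
    show "abelian_group (dual_module R G)"
    proof (rule abelian_groupI)
      fix x assume "x \<in> carrier (dual_module R G)"
      then show "\<exists>y\<in>carrier (dual_module R G). y \<oplus>\<^bsub>dual_module R G\<^esub> x = \<zero>\<^bsub>dual_module R G\<^esub>"
        by (intro bexI[where x = "\<lambda>g\<in>carrier G. \<ominus>\<^bsub>R\<^esub> x g"])
          (auto simp: dual_module_carrier_iff dual_module_simps(2-4) G.R.l_neg G.R.minus_add G.R.r_minus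
            intro!: restrict_ext)
    next
      show "\<zero>\<^bsub>dual_module R G\<^esub> \<oplus>\<^bsub>dual_module R G\<^esub> x = x" if "x \<in> carrier (dual_module R G)" for x
        using that by (auto simp: dual_module_carrier_iff dual_module_simps(2-4) intro!: ext)
    qed (auto simp: dual_module_carrier_iff dual_module_simps(2-4) G.R.a_ac G.R.r_distr intro!: restrict_ext)
    show "\<one>\<^bsub>R\<^esub> \<odot>\<^bsub>dual_module R G\<^esub> x = x" if "x \<in> carrier (dual_module R G)" for x
      using that by (auto simp: dual_module_carrier_iff dual_module_simps(2-4) intro!: ext)
  qed (auto simp: dual_module_carrier_iff dual_module_simps(2-4) G.R.is_cring G.R.l_distr G.R.r_distr
      G.R.m_assoc m_lcomm intro!: restrict_ext)
qed

text \<open>The free module on the basis \<open>S\<close>. Its operations do not depend on \<open>S\<close>, so a smaller basis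
  gives a submodule.\<close>

definition finsupp_module :: "'a ring \<Rightarrow> 'i set \<Rightarrow> ('a, 'i \<Rightarrow> 'a) module" where
  "finsupp_module R S =
     \<lparr>carrier = {f. (\<forall>i. f i \<in> carrier R) \<and> finite {i. f i \<noteq> \<zero>\<^bsub>R\<^esub>} \<and> (\<forall>i. i \<notin> S \<longrightarrow> f i = \<zero>\<^bsub>R\<^esub>)},
      monoid.mult = undefined, monoid.one = undefined,
      ring.zero = (\<lambda>i. \<zero>\<^bsub>R\<^esub>), ring.add = (\<lambda>f g i. f i \<oplus>\<^bsub>R\<^esub> g i), smult = (\<lambda>a f i. a \<otimes>\<^bsub>R\<^esub> f i)\<rparr>"

lemma finsupp_module_simps:
  "f \<in> carrier (finsupp_module R S) \<longleftrightarrow>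
     (\<forall>i. f i \<in> carrier R) \<and> finite {i. f i \<noteq> \<zero>\<^bsub>R\<^esub>} \<and> (\<forall>i. i \<notin> S \<longrightarrow> f i = \<zero>\<^bsub>R\<^esub>)"
  "\<zero>\<^bsub>finsupp_module R S\<^esub> = (\<lambda>i. \<zero>\<^bsub>R\<^esub>)"
  "f \<oplus>\<^bsub>finsupp_module R S\<^esub> g = (\<lambda>i. f i \<oplus>\<^bsub>R\<^esub> g i)"
  "a \<odot>\<^bsub>finsupp_module R S\<^esub> f = (\<lambda>i. a \<otimes>\<^bsub>R\<^esub> f i)"
  by (simp_all add: finsupp_module_def)

lemma finsupp_module_is_module:
  fixes S :: "'b set"
  assumes "cring R"
  shows "module R (finsupp_module R S)"
proof -
  interpret cring R by fact
  have fin: "finite {i. h i \<noteq> \<zero>\<^bsub>R\<^esub>}"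
    if "finite {i. f i \<noteq> \<zero>\<^bsub>R\<^esub>}" "finite {i. g i \<noteq> \<zero>\<^bsub>R\<^esub>}"
      "\<And>i. f i = \<zero>\<^bsub>R\<^esub> \<Longrightarrow> g i = \<zero>\<^bsub>R\<^esub> \<Longrightarrow> h i = \<zero>\<^bsub>R\<^esub>" for f g h :: "'b \<Rightarrow> 'a"
  proof (rule finite_subset)
    show "{i. h i \<noteq> \<zero>\<^bsub>R\<^esub>} \<subseteq> {i. f i \<noteq> \<zero>\<^bsub>R\<^esub>} \<union> {i. g i \<noteq> \<zero>\<^bsub>R\<^esub>}" using that(3) by blast
  qed (use that in simp)
  show ?thesis
  proof (rule moduleI)
    show "abelian_group (finsupp_module R S)"
    proof (rule abelian_groupI)
      fix x assume x: "x \<in> carrier (finsupp_module R S)"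
      then have xR: "x i \<in> carrier R" and fx: "finite {i. x i \<noteq> \<zero>\<^bsub>R\<^esub>}"
        and xS: "i \<notin> S \<Longrightarrow> x i = \<zero>\<^bsub>R\<^esub>" for i
        unfolding finsupp_module_simps by blast+
      have "finite {i. \<ominus>\<^bsub>R\<^esub> x i \<noteq> \<zero>\<^bsub>R\<^esub>}" by (rule fin[OF fx fx]) simp
      then have "(\<lambda>i. \<ominus>\<^bsub>R\<^esub> x i) \<in> carrier (finsupp_module R S)"
        using xR xS by (simp add: finsupp_module_simps)
      moreover have "(\<lambda>i. \<ominus>\<^bsub>R\<^esub> x i) \<oplus>\<^bsub>finsupp_module R S\<^esub> x = \<zero>\<^bsub>finsupp_module R S\<^esub>"
        using xR by (simp add: finsupp_module_simps l_neg)
      ultimately show "\<exists>y\<in>carrier (finsupp_module R S). y \<oplus>\<^bsub>finsupp_module R S\<^esub> x = \<zero>\<^bsub>finsupp_module R S\<^esub>"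
        by blast
    next
      show "x \<oplus>\<^bsub>finsupp_module R S\<^esub> y \<in> carrier (finsupp_module R S)"
        if "x \<in> carrier (finsupp_module R S)" "y \<in> carrier (finsupp_module R S)" for x y
        using that fin[of x y "\<lambda>i. x i \<oplus>\<^bsub>R\<^esub> y i"] by (auto simp: finsupp_module_simps)
    qed (auto simp: finsupp_module_simps a_ac)
    show "a \<odot>\<^bsub>finsupp_module R S\<^esub> x \<in> carrier (finsupp_module R S)"
      if "a \<in> carrier R" "x \<in> carrier (finsupp_module R S)" for a x
      using that fin[of x x "\<lambda>i. a \<otimes>\<^bsub>R\<^esub> x i"] by (auto simp: finsupp_module_simps)
  qed (auto simp: finsupp_module_simps is_cring l_distr r_distr m_assoc)
qed

lemma ideal_is_submodule:
  fixes R :: "'a ring"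
  assumes "cring R" "ideal J R"
  shows "submodule J R (ring_module R)"
proof -
  interpret cring R by fact
  interpret J: ideal J R by fact
  show ?thesis
    by (rule submoduleI_smult[OF ring_module_is_module[OF is_cring]])
      (auto simp: ring_module_def J.I_l_closed)
qed

lemma preimage_submodule:
  assumes M: "module R M" and N: "module R N" and f: "f \<in> module_homs R M N" and H: "submodule H R N"
  shows "submodule {x \<in> carrier M. f x \<in> H} R M"
proof -
  interpret M: module R M by fact
  show ?thesis
    by (rule submoduleI_smult[OF M])
      (auto simp: module_homs_zero[OF M N f] submodule_zero[OF N H] module_homs_add[OF f]
        module_homs_smult[OF f] submodule_add[OF N H] submodule_smult[OF N H])
qed

lemma submodule_is_ideal:
  fixes R :: "'a ring"
  assumes R: "cring R" and A: "submodule A R (ring_module R)"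
  shows "ideal A R"
proof -
  interpret R: cring R by (rule R)
  note RM = ring_module_is_module[OF R]
  have AR: "A \<subseteq> carrier R" using submodule_subset[OF RM A] by (simp add: ring_module_def)
  have smult: "r \<otimes>\<^bsub>R\<^esub> a \<in> A" if "r \<in> carrier R" "a \<in> A" for r a
    using submodule_smult[OF RM A that] by (simp add: ring_module_def)
  show ?thesis
  proof (rule idealI[OF R.ring_axioms])
    show "subgroup A (add_monoid R)"
    proof (rule R.add.subgroupI[OF AR])
      show "A \<noteq> {}" using submodule_zero[OF RM A] by blast
      show "\<ominus>\<^bsub>R\<^esub> a \<in> A" if "a \<in> A" for a
        using smult[OF _ that, of "\<ominus>\<^bsub>R\<^esub> \<one>\<^bsub>R\<^esub>"] subsetD[OF AR that] by (simp add: R.l_minus)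
      show "a \<oplus>\<^bsub>R\<^esub> b \<in> A" if "a \<in> A" "b \<in> A" for a b
        using submodule_add[OF RM A that] by (simp add: ring_module_def)
    qed
    show "r \<otimes>\<^bsub>R\<^esub> a \<in> A" if "a \<in> A" "r \<in> carrier R" for a r using smult that by blast
    show "a \<otimes>\<^bsub>R\<^esub> r \<in> A" if "a \<in> A" "r \<in> carrier R" for a r
      using smult[OF that(2,1)] R.m_comm[of a r] that AR by auto
  qed
qed

lemma multiples_submodule:
  fixes R :: "'a ring" and M :: "('a, 'b) module"
  assumes M: "module R M" and v: "v \<in> carrier M"
  shows "submodule {a \<odot>\<^bsub>M\<^esub> v | a. a \<in> carrier R} R M"
proof -
  interpret M: module R M by fact
  note RM = ring_module_is_module[OF M.R.is_cring]
  have "(\<lambda>a. a \<odot>\<^bsub>M\<^esub> v) \<in> module_homs R (ring_module R) M"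
    using v by (intro module_homsI) (auto simp: ring_module_def M.smult_l_distr M.smult_assoc1)
  from image_submodule[OF RM M this module.carrier_is_submodule[OF RM]] show ?thesis
    by (simp add: ring_module_def image_def Bex_def conj_commute)
qed

section \<open>Embeddings into an infinite type\<close>

lemma pairs_embed:
  assumes "infinite (UNIV :: 'u set)"
  obtains p :: "'u \<times> 'u \<Rightarrow> 'u" where "inj p"
proof -
  obtain p :: "'u \<times> 'u \<Rightarrow> 'u" where "bij_betw p (UNIV \<times> UNIV) UNIV"
    using card_of_Times_same_infinite[OF assms] unfolding card_of_ordIso[symmetric] by blast
  then have "inj p" by (simp add: bij_betw_def)
  then show thesis by (rule that)
qed

lemma lists_embed:
  assumes inf: "infinite (UNIV :: 'u set)"
  obtains f :: "'u list \<Rightarrow> 'u" where "inj f"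
proof -
  obtain p :: "'u \<times> 'u \<Rightarrow> 'u" where p: "inj p" using pairs_embed[OF inf] .
  obtain \<nu> :: "nat \<Rightarrow> 'u" where \<nu>: "inj \<nu>" using infinite_countable_subset[OF inf] by auto
  let ?e = "\<lambda>xs. foldr (\<lambda>x y. p (x, y)) xs (\<nu> 0)"
  have e: "xs = ys" if "length xs = length ys" "?e xs = ?e ys" for xs ys
    using that by (induction xs ys rule: list_induct2) (auto dest: injD[OF p])
  have "inj (\<lambda>xs. p (\<nu> (length xs), ?e xs))"
    by (rule injI) (auto dest!: injD[OF p] injD[OF \<nu>] intro: e)
  then show thesis by (rule that)
qed

lemma prod_embed:
  fixes g :: "'x \<Rightarrow> 'u" and h :: "'y \<Rightarrow> 'u"
  assumes "infinite (UNIV :: 'u set)" "inj_on g A" "inj_on h B"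
  obtains k :: "'x \<times> 'y \<Rightarrow> 'u" where "inj_on k (A \<times> B)"
proof -
  obtain p :: "'u \<times> 'u \<Rightarrow> 'u" where p: "inj p" using pairs_embed[OF assms(1)] .
  have "inj_on (\<lambda>(x, y). p (g x, h y)) (A \<times> B)"
    by (rule inj_onI) (auto dest!: injD[OF p] inj_onD[OF assms(2)] inj_onD[OF assms(3)])
  then show thesis by (rule that)
qed

lemma list_embed:
  fixes g :: "'x \<Rightarrow> 'u"
  assumes "infinite (UNIV :: 'u set)" "inj_on g A"
  obtains k :: "'x list \<Rightarrow> 'u" where "inj_on k (lists A)"
proof -
  obtain f :: "'u list \<Rightarrow> 'u" where f: "inj f" using lists_embed[OF assms(1)] .
  have "inj_on (f \<circ> map g) (lists A)"
    using inj_on_mapI[of g "lists A"] assms(2)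
    by (intro comp_inj_on inj_on_subset[OF f]) (auto simp: inj_on_map_lists)
  then show thesis by (rule that)
qed

lemma power_module_embeds:
  fixes g :: "'a \<Rightarrow> 'u"
  assumes "infinite (UNIV :: 'u set)" "inj_on g (carrier R)"
  obtains k :: "(nat \<Rightarrow> 'a) \<Rightarrow> 'u" where "inj_on k (carrier (power_module R m))"
proof -
  obtain l :: "'a list \<Rightarrow> 'u" where l: "inj_on l (lists (carrier R))" using list_embed[OF assms] .
  have "inj_on (\<lambda>x. l (map x [0..<m])) (carrier (power_module R m))"
  proof (rule inj_onI)
    fix x y assume xy: "x \<in> carrier (power_module R m)" "y \<in> carrier (power_module R m)"
      and e: "l (map x [0..<m]) = l (map y [0..<m])"
    have "map z [0..<m] \<in> lists (carrier R)" if "z \<in> carrier (power_module R m)" for z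
      using that by (simp add: power_module_carrier_iff in_lists_conv_set)
    then have "map x [0..<m] = map y [0..<m]" using inj_onD[OF l e] xy by simp
    then have "\<And>i. i < m \<Longrightarrow> x i = y i" by simp
    then show "x = y" by (rule power_module_eqI[OF xy])
  qed
  then show thesis by (rule that)
qed

lemma finsupp_module_embeds:
  fixes g :: "'a \<Rightarrow> 'u" and c :: "'i \<Rightarrow> 'u"
  assumes inf: "infinite (UNIV :: 'u set)" and g: "inj_on g (carrier R)" and c: "inj c"
  obtains k :: "('i \<Rightarrow> 'a) \<Rightarrow> 'u" where "inj_on k (carrier (finsupp_module R S))"
proof -
  obtain p :: "'i \<times> 'a \<Rightarrow> 'u" where p: "inj_on p (UNIV \<times> carrier R)" using prod_embed[OF inf c g] .
  obtain l :: "('i \<times> 'a) list \<Rightarrow> 'u" where l: "inj_on l (lists (UNIV \<times> carrier R))"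
    using list_embed[OF inf p] .
  define gr where "gr f = {(i, f i) | i. f i \<noteq> \<zero>\<^bsub>R\<^esub>}" for f :: "'i \<Rightarrow> 'a"
  define L where "L f = (SOME xs. set xs = gr f)" for f
  have L: "set (L f) = gr f" if "f \<in> carrier (finsupp_module R S)" for f
  proof -
    have "gr f = (\<lambda>i. (i, f i)) ` {i. f i \<noteq> \<zero>\<^bsub>R\<^esub>}" by (auto simp: gr_def)
    then have "finite (gr f)" using that by (simp add: finsupp_module_simps)
    then show ?thesis unfolding L_def by (rule someI_ex[OF finite_list])
  qed
  have "inj_on (l \<circ> L) (carrier (finsupp_module R S))"
  proof (rule inj_onI)
    fix x y assume xy: "x \<in> carrier (finsupp_module R S)" "y \<in> carrier (finsupp_module R S)"
      and e: "(l \<circ> L) x = (l \<circ> L) y"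
    have in_lists: "L f \<in> lists (UNIV \<times> carrier R)" if "f \<in> carrier (finsupp_module R S)" for f
      using that unfolding in_lists_conv_set L[OF that] by (auto simp: gr_def finsupp_module_simps)
    have "L x = L y" using inj_onD[OF l _ in_lists[OF xy(1)] in_lists[OF xy(2)]] e by simp
    then have "gr x = gr y" using L xy by metis
    then have "x i = y i" for i by (cases "x i = \<zero>\<^bsub>R\<^esub>"; cases "y i = \<zero>\<^bsub>R\<^esub>") (auto simp: gr_def set_eq_iff)
    then show "x = y" by blast
  qed
  then show thesis by (rule that)
qed

section \<open>Closures in modules of any type\<close>

locale big_closure =
  fixes R :: "'a ring" and \<mm> :: "'a set" and cl :: "('a, 'u) closure_op"
  assumes R_cring: "cring R" and big_axioms: "big_axioms R \<mm> cl"
begin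

lemma cl_submodule: "module R M \<Longrightarrow> submodule N R M \<Longrightarrow> submodule (cl M N) R M"
  and cl_extensive: "module R M \<Longrightarrow> submodule N R M \<Longrightarrow> N \<subseteq> cl M N"
  using big_axioms[unfolded big_axioms_def Let_def, THEN conjunct1] by blast+

lemma cl_idem: "module R M \<Longrightarrow> submodule N R M \<Longrightarrow> cl M (cl M N) = cl M N"
  using big_axioms[unfolded big_axioms_def Let_def, THEN conjunct2, THEN conjunct1] by blast

lemma cl_mono: "module R W \<Longrightarrow> submodule N R W \<Longrightarrow> submodule M R W \<Longrightarrow> N \<subseteq> M \<Longrightarrow> cl W N \<subseteq> cl W M"
  using big_axioms[unfolded big_axioms_def Let_def, THEN conjunct2, THEN conjunct2, THEN conjunct1]
  by blast

lemma cl_hom: "module R M \<Longrightarrow> module R W \<Longrightarrow> f \<in> module_homs R M W \<Longrightarrow> submodule N R M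
    \<Longrightarrow> f ` cl M N \<subseteq> cl W (f ` N)"
  using big_axioms[unfolded big_axioms_def Let_def, THEN conjunct2, THEN conjunct2, THEN conjunct2, THEN conjunct1]
  by blast

lemma closure_in_quotient_zero: "module R M \<Longrightarrow> submodule N R M \<Longrightarrow> cl M N = N
    \<Longrightarrow> closure_in R cl (quotient_module M N) {\<zero>\<^bsub>quotient_module M N\<^esub>} = {\<zero>\<^bsub>quotient_module M N\<^esub>}"
  using big_axioms[unfolded big_axioms_def Let_def, THEN conjunct2, THEN conjunct2, THEN conjunct2, THEN conjunct2, THEN conjunct1]
  by blast

lemma closure_in_maximal_ideal: "closure_in R cl (ring_module R) \<mm> = \<mm>"
  by (rule big_axioms[unfolded big_axioms_def Let_def, THEN conjunct2, THEN conjunct2, THEN conjunct2, THEN conjunct2, THEN conjunct2, THEN conjunct1])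

lemma cl_colon:
  assumes "partial_sop R \<mm> (xs @ [x])" "module R M"
    and "f \<in> module_homs R M (quotient_module (ring_module R) (Idl\<^bsub>R\<^esub> (set xs)))"
    and "f ` carrier M = carrier (quotient_module (ring_module R) (Idl\<^bsub>R\<^esub> (set xs)))"
    and "v \<in> carrier M" "f v = Idl\<^bsub>R\<^esub> (set xs) +>\<^bsub>ring_module R\<^esub> x"
  shows "cl M {a \<odot>\<^bsub>M\<^esub> v | a. a \<in> carrier R}
      \<inter> a_kernel M (quotient_module (ring_module R) (Idl\<^bsub>R\<^esub> (set xs))) f
    \<subseteq> cl M {a \<odot>\<^bsub>M\<^esub> v | a. a \<in> Idl\<^bsub>R\<^esub> (set xs)}"
  by (rule big_axioms[unfolded big_axioms_def Let_def, THEN conjunct2, THEN conjunct2, THEN conjunct2, THEN conjunct2, THEN conjunct2, THEN conjunct2, rule_format])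
    (intro conjI; rule assms)

text \<open>Composing a homomorphism with the isomorphisms onto the two copies gives a homomorphism
  between modules over \<open>'u\<close>, and functoriality applies to it. With the identity map
  this says that the closure can be computed in any copy.\<close>

lemma closure_in_hom_copy:
  assumes X: "module R X" and Y: "module R Y" and f: "f \<in> module_homs R X Y"
    and N: "submodule N R X" and x: "x \<in> closure_in R cl X N"
    and D': "module R D'" and \<theta>': "\<theta>' \<in> module_isos R Y D'"
  shows "\<theta>' (f x) \<in> cl D' (\<theta>' ` f ` N)"
proof -
  obtain D \<theta> where xX: "x \<in> carrier X" and D: "module R D" and \<theta>: "\<theta> \<in> module_isos R X D"
    and x: "\<theta> x \<in> cl D (\<theta> ` N)"
    using x unfolding closure_in_def by blast
  note h = module_isos_hom[OF \<theta>]
  obtain \<eta> where \<eta>: "\<eta> \<in> module_homs R D X" "\<And>x. x \<in> carrier X \<Longrightarrow> \<eta> (\<theta> x) = x"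
    using module_isos_inverse[OF X D \<theta>] by blast
  let ?g = "\<lambda>d. \<theta>' (f (\<eta> d))"
  have g: "?g \<in> module_homs R D D'"
    by (rule module_homs_comp[OF module_homs_comp[OF \<eta>(1) f] module_isos_hom[OF \<theta>']])
  have "?g ` cl D (\<theta> ` N) \<subseteq> cl D' (?g ` \<theta> ` N)"
    by (rule cl_hom[OF D D' g image_submodule[OF X D h N]])
  moreover have "?g ` \<theta> ` N = \<theta>' ` f ` N"
    using \<eta>(2) submodule_carrier[OF X N] by (simp add: image_image cong: image_cong)
  ultimately show ?thesis using x \<eta>(2)[OF xX] by force
qed

lemma closure_in_copy:
  assumes X: "module R X" and N: "submodule N R X" and x: "x \<in> closure_in R cl X N"
    and D: "module R D" and \<theta>: "\<theta> \<in> module_isos R X D"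
  shows "\<theta> x \<in> cl D (\<theta> ` N)"
proof -
  have "(\<lambda>x. x) \<in> module_homs R X X" by (rule module_homsI) auto
  from closure_in_hom_copy[OF X X this N x D \<theta>] show ?thesis by simp
qed

lemma closure_in_hom:
  fixes g :: "'y \<Rightarrow> 'u"
  assumes X: "module R X" and Y: "module R Y" and f: "f \<in> module_homs R X Y"
    and N: "submodule N R X" and x: "x \<in> closure_in R cl X N" and g: "inj_on g (carrier Y)"
  shows "f x \<in> closure_in R cl Y (f ` N)"
proof -
  obtain D :: "('a, 'u) module" where D: "module R D" and g: "g \<in> module_isos R Y D"
    using isomorphic_copy[OF Y g] by blast
  have "x \<in> carrier X" using x unfolding closure_in_def by blast
  then show ?thesis
    using closure_in_hom_copy[OF X Y f N x D g] D g module_homs_closed[OF f]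
    unfolding closure_in_def by blast
qed

lemma closure_in_mono:
  assumes X: "module R X" and N: "submodule N R X" and N': "submodule N' R X" and sub: "N \<subseteq> N'"
  shows "closure_in R cl X N \<subseteq> closure_in R cl X N'"
proof
  fix x assume "x \<in> closure_in R cl X N"
  then obtain D \<theta> where xX: "x \<in> carrier X" and D: "module R D" and \<theta>: "\<theta> \<in> module_isos R X D"
    and x: "\<theta> x \<in> cl D (\<theta> ` N)"
    unfolding closure_in_def by blast
  have "cl D (\<theta> ` N) \<subseteq> cl D (\<theta> ` N')"
    by (intro cl_mono[OF D] image_submodule[OF X D module_isos_hom[OF \<theta>]] N N' image_mono sub)
  then show "x \<in> closure_in R cl X N'" using xX D \<theta> x unfolding closure_in_def by blast
qed

text \<open>The quotient of \<open>X\<close> by the closure of \<open>N\<close>, formed in a copy of \<open>X\<close>: since the closure is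
  idempotent, zero is closed in this quotient.\<close>

lemma quotient_by_closure:
  fixes g :: "'x \<Rightarrow> 'u"
  assumes X: "module R X" and N: "submodule N R X" and g: "inj_on g (carrier X)"
  obtains C :: "('a, 'u set) module" and \<gamma> and h :: "'u set \<Rightarrow> 'u" where
    "module R C" "\<gamma> \<in> module_homs R X C" "\<And>x. x \<in> N \<Longrightarrow> \<gamma> x = \<zero>\<^bsub>C\<^esub>"
    "\<And>x. x \<in> carrier X \<Longrightarrow> \<gamma> x = \<zero>\<^bsub>C\<^esub> \<Longrightarrow> x \<in> closure_in R cl X N"
    "closure_in R cl C {\<zero>\<^bsub>C\<^esub>} = {\<zero>\<^bsub>C\<^esub>}" "inj_on h (carrier C)"
proof -
  obtain D :: "('a, 'u) module" where D: "module R D" and g: "g \<in> module_isos R X D"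
    using isomorphic_copy[OF X g] by blast
  note hom = module_isos_hom[OF g]
  have gN: "submodule (g ` N) R D" by (rule image_submodule[OF X D hom N])
  define K where "K = cl D (g ` N)"
  have K: "submodule K R D" and NK: "g ` N \<subseteq> K" and idem: "cl D K = K"
    using cl_submodule[OF D gN] cl_extensive[OF D gN] cl_idem[OF D gN] by (simp_all add: K_def)
  let ?C = "quotient_module D K"
  obtain h :: "'u set \<Rightarrow> 'u" where h: "inj_on h (carrier ?C)"
    using embedding_of_image[OF inj_on_id, of "\<lambda>x. K +>\<^bsub>D\<^esub> x" "carrier D"]
    unfolding quotient_surj[OF D K] by blast
  show thesis
  proof (rule that[OF quotient_is_module[OF D K] module_homs_comp[OF hom quotient_hom[OF D K]] _ _
        closure_in_quotient_zero[OF D K idem] h])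
    show "K +>\<^bsub>D\<^esub> g x = \<zero>\<^bsub>?C\<^esub>" if "x \<in> N" for x
      using that NK quotient_zero_iff[OF D K] module_homs_closed[OF hom] submodule_carrier[OF X N] by blast
    show "x \<in> closure_in R cl X N" if "x \<in> carrier X" "K +>\<^bsub>D\<^esub> g x = \<zero>\<^bsub>?C\<^esub>" for x
    proof -
      have "g x \<in> K" using that quotient_zero_iff[OF D K] module_homs_closed[OF hom] by blast
      then show ?thesis using that(1) D g unfolding K_def closure_in_def by blast
    qed
  qed
qed

text \<open>The colon-capturing axiom for a module of any type, transported from a copy over \<open>'u\<close>.\<close>

lemma closure_in_colon:
  fixes g :: "'x \<Rightarrow> 'u"
  assumes xs: "partial_sop R \<mm> (xs @ [x])" and X: "module R X" and g: "inj_on g (carrier X)"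
    and J: "J = Idl\<^bsub>R\<^esub> (set xs)" and RJ: "RJ = quotient_module (ring_module R) J"
    and f: "f \<in> module_homs R X RJ" "f ` carrier X = carrier RJ"
    and v: "v \<in> carrier X" "f v = J +>\<^bsub>ring_module R\<^esub> x"
    and J_sub: "J \<subseteq> carrier R"
    and w: "w \<in> closure_in R cl X {a \<odot>\<^bsub>X\<^esub> v | a. a \<in> carrier R}" "f w = \<zero>\<^bsub>RJ\<^esub>"
  shows "w \<in> closure_in R cl X {a \<odot>\<^bsub>X\<^esub> v | a. a \<in> J}"
proof -
  interpret X: module R X by fact
  obtain D :: "('a, 'u) module" where D: "module R D" and g: "g \<in> module_isos R X D"
    using isomorphic_copy[OF X g] by blast
  note hom = module_isos_hom[OF g]
  obtain \<eta> where \<eta>: "\<eta> \<in> module_homs R D X" "\<And>x. x \<in> carrier X \<Longrightarrow> \<eta> (g x) = x"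
    using module_isos_inverse[OF X D g] by blast
  have multiples: "g ` {a \<odot>\<^bsub>X\<^esub> v | a. a \<in> A} = {a \<odot>\<^bsub>D\<^esub> g v | a. a \<in> A}" if "A \<subseteq> carrier R" for A
  proof -
    have "g (a \<odot>\<^bsub>X\<^esub> v) = a \<odot>\<^bsub>D\<^esub> g v" if "a \<in> A" for a
      using that \<open>A \<subseteq> carrier R\<close> module_homs_smult[OF hom _ v(1)] by blast
    then show ?thesis by (force simp: image_iff)
  qed
  have wX: "w \<in> carrier X" using w(1) unfolding closure_in_def by blast
  from closure_in_copy[OF X multiples_submodule[OF X v(1)] w(1) D g]
  have gw: "g w \<in> cl D {a \<odot>\<^bsub>D\<^esub> g v | a. a \<in> carrier R}" by (simp only: multiples[OF subset_refl])
  let ?f = "\<lambda>d. f (\<eta> d)"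
  have "cl D {a \<odot>\<^bsub>D\<^esub> g v | a. a \<in> carrier R} \<inter> a_kernel D RJ ?f \<subseteq> cl D {a \<odot>\<^bsub>D\<^esub> g v | a. a \<in> J}"
    unfolding RJ J
  proof (rule cl_colon[OF xs D])
    show "?f \<in> module_homs R D (quotient_module (ring_module R) (Idl\<^bsub>R\<^esub> (set xs)))"
      using module_homs_comp[OF \<eta>(1) f(1)] by (simp add: RJ J)
    have "?f ` carrier D = f ` carrier X"
      unfolding module_isos_surj[OF g, symmetric] image_image using \<eta>(2) by (simp cong: image_cong)
    then show "?f ` carrier D = carrier (quotient_module (ring_module R) (Idl\<^bsub>R\<^esub> (set xs)))"
      using f(2) by (simp add: RJ J)
    show "g v \<in> carrier D" by (rule module_homs_closed[OF hom v(1)])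
    show "f (\<eta> (g v)) = Idl\<^bsub>R\<^esub> (set xs) +>\<^bsub>ring_module R\<^esub> x" using \<eta>(2) v by (simp add: J)
  qed
  moreover have "g w \<in> a_kernel D RJ ?f"
    using module_homs_closed[OF hom wX] \<eta>(2)[OF wX] w(2) by (simp add: a_kernel_def')
  ultimately have "g w \<in> cl D (g ` {a \<odot>\<^bsub>X\<^esub> v | a. a \<in> J})" using gw multiples[OF J_sub] by auto
  then show ?thesis using wX D g unfolding closure_in_def by blast
qed

end

section \<open>Direct limits\<close>

text \<open>Over a directed index set these properties characterise the direct limit up to
  isomorphism. They can be checked without the quotient of the disjoint union.\<close>

definition direct_limit_cocone ::
    "'a ring \<Rightarrow> 'i set \<Rightarrow> 'i rel \<Rightarrow> ('i \<Rightarrow> ('a, 'b) module) \<Rightarrow> ('i \<Rightarrow> 'i \<Rightarrow> 'b \<Rightarrow> 'b)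
       \<Rightarrow> ('a, 'c) module \<Rightarrow> ('i \<Rightarrow> 'b \<Rightarrow> 'c) \<Rightarrow> bool" where
  "direct_limit_cocone R I r N \<phi> L \<psi> \<longleftrightarrow>
     module R L \<and> (\<forall>i\<in>I. \<psi> i \<in> module_homs R (N i) L) \<and>
     (\<forall>i\<in>I. \<forall>j\<in>I. (i, j) \<in> r \<longrightarrow> (\<forall>x\<in>carrier (N i). \<psi> j (\<phi> i j x) = \<psi> i x)) \<and>
     (\<forall>y\<in>carrier L. \<exists>i\<in>I. \<exists>x\<in>carrier (N i). y = \<psi> i x) \<and>
     (\<forall>i\<in>I. \<forall>x\<in>carrier (N i). \<psi> i x = \<zero>\<^bsub>L\<^esub> \<longrightarrow> (\<exists>k\<in>I. (i, k) \<in> r \<and> \<phi> i k x = \<zero>\<^bsub>N k\<^esub>))"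

lemma direct_systemD:
  assumes "direct_system R I r N \<phi>"
  shows "i \<in> I \<Longrightarrow> module R (N i)"
    and "i \<in> I \<Longrightarrow> j \<in> I \<Longrightarrow> (i, j) \<in> r \<Longrightarrow> \<phi> i j \<in> module_homs R (N i) (N j)"
    and "i \<in> I \<Longrightarrow> j \<in> I \<Longrightarrow> k \<in> I \<Longrightarrow> (i, j) \<in> r \<Longrightarrow> (j, k) \<in> r \<Longrightarrow> x \<in> carrier (N i)
      \<Longrightarrow> \<phi> j k (\<phi> i j x) = \<phi> i k x"
  using assms unfolding direct_system_def by blast+

lemma direct_limit_coconeD:
  assumes "direct_limit_cocone R I r N \<phi> L \<psi>"
  shows "module R L" and "i \<in> I \<Longrightarrow> \<psi> i \<in> module_homs R (N i) L"
    and "i \<in> I \<Longrightarrow> j \<in> I \<Longrightarrow> (i, j) \<in> r \<Longrightarrow> x \<in> carrier (N i) \<Longrightarrow> \<psi> j (\<phi> i j x) = \<psi> i x"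
    and "y \<in> carrier L \<Longrightarrow> \<exists>i\<in>I. \<exists>x\<in>carrier (N i). y = \<psi> i x"
    and "i \<in> I \<Longrightarrow> x \<in> carrier (N i) \<Longrightarrow> \<psi> i x = \<zero>\<^bsub>L\<^esub>
      \<Longrightarrow> \<exists>k\<in>I. (i, k) \<in> r \<and> \<phi> i k x = \<zero>\<^bsub>N k\<^esub>"
  using assms unfolding direct_limit_cocone_def by blast+

text \<open>In a cocone of this kind the class of \<open>x\<close> is the fibre over \<open>\<psi> x\<close> of the map from the
  disjoint union of the \<open>N i\<close> to \<open>L\<close>. So taking fibres identifies \<open>L\<close> with the direct
  limit.\<close>

lemma is_direct_limit_of_cocone:
  fixes R :: "'a ring" and N :: "'i \<Rightarrow> ('a, 'b) module" and L :: "('a, 'c) module"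
  assumes sys: "direct_system R I r N \<phi>" and trans: "trans r" and ne: "I \<noteq> {}"
    and dir: "\<And>i j. i \<in> I \<Longrightarrow> j \<in> I \<Longrightarrow> \<exists>k\<in>I. (i, k) \<in> r \<and> (j, k) \<in> r"
    and lim: "direct_limit_cocone R I r N \<phi> L \<psi>"
  shows "is_direct_limit R I r N \<phi> L \<psi>"
proof -
  note mod = direct_systemD(1)[OF sys] and \<phi> = direct_systemD(2)[OF sys] and comp = direct_systemD(3)[OF sys]
    and L = direct_limit_coconeD(1)[OF lim] and \<psi> = direct_limit_coconeD(2)[OF lim]
    and comp\<psi> = direct_limit_coconeD(3)[OF lim] and surj = direct_limit_coconeD(4)[OF lim]
    and ker = direct_limit_coconeD(5)[OF lim]
  interpret L: module R L by (rule L)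
  define fib where "fib z = {(j, y). j \<in> I \<and> y \<in> carrier (N j) \<and> \<psi> j y = z}" for z
  have class_eq: "limit_class I r N \<phi> i x = fib (\<psi> i x)" if i: "i \<in> I" and x: "x \<in> carrier (N i)" for i x
  proof -
    have "(\<exists>k\<in>I. (i, k) \<in> r \<and> (j, k) \<in> r \<and> \<phi> i k x = \<phi> j k y) \<longleftrightarrow> \<psi> j y = \<psi> i x"
      if j: "j \<in> I" and y: "y \<in> carrier (N j)" for j y
    proof
      assume "\<exists>k\<in>I. (i, k) \<in> r \<and> (j, k) \<in> r \<and> \<phi> i k x = \<phi> j k y"
      then obtain k where k: "k \<in> I" "(i, k) \<in> r" "(j, k) \<in> r" "\<phi> i k x = \<phi> j k y" by blast
      show "\<psi> j y = \<psi> i x"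
        using comp\<psi>[OF i k(1,2) x] comp\<psi>[OF j k(1,3) y] k(4) by simp
    next
      assume eq: "\<psi> j y = \<psi> i x"
      obtain k where k: "k \<in> I" "(i, k) \<in> r" "(j, k) \<in> r" using dir[OF i j] by blast
      have xk: "\<phi> i k x \<in> carrier (N k)" and yk: "\<phi> j k y \<in> carrier (N k)"
        using module_homs_closed[OF \<phi>[OF i k(1,2)] x] module_homs_closed[OF \<phi>[OF j k(1,3)] y] .
      interpret Nk: module R "N k" by (rule mod[OF k(1)])
      have "\<psi> k (\<phi> i k x \<ominus>\<^bsub>N k\<^esub> \<phi> j k y) = \<zero>\<^bsub>L\<^esub>"
        using module_homs_eq_iff[OF mod[OF k(1)] L \<psi>[OF k(1)] xk yk] comp\<psi>[OF i k(1,2) x] comp\<psi>[OF j k(1,3) y] eq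
        by simp
      then obtain l where l: "l \<in> I" "(k, l) \<in> r" "\<phi> k l (\<phi> i k x \<ominus>\<^bsub>N k\<^esub> \<phi> j k y) = \<zero>\<^bsub>N l\<^esub>"
        using ker[OF k(1) Nk.M.minus_closed[OF xk yk]] by blast
      then have "\<phi> k l (\<phi> i k x) = \<phi> k l (\<phi> j k y)"
        using module_homs_eq_iff[OF mod[OF k(1)] mod[OF l(1)] \<phi>[OF k(1) l(1,2)] xk yk] by simp
      then have "\<phi> i l x = \<phi> j l y"
        using comp[OF i k(1) l(1) k(2) l(2) x] comp[OF j k(1) l(1) k(3) l(2) y] by simp
      then show "\<exists>k\<in>I. (i, k) \<in> r \<and> (j, k) \<in> r \<and> \<phi> i k x = \<phi> j k y"
        using l(1) transD[OF trans k(2) l(2)] transD[OF trans k(3) l(2)] by blast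
    qed
    then show ?thesis unfolding limit_class_def fib_def by blast
  qed
  have fib_ne: "\<exists>i\<in>I. \<exists>x\<in>carrier (N i). (i, x) \<in> fib z \<and> \<psi> i x = z" if "z \<in> carrier L" for z
    using surj[OF that] unfolding fib_def by blast
  have fib_inj: "inj_on fib (carrier L)"
  proof (rule inj_onI)
    fix z w assume "z \<in> carrier L" and eq: "fib z = fib w"
    then obtain i x where "(i, x) \<in> fib z" using fib_ne by blast
    then show "z = w" using eq unfolding fib_def by blast
  qed
  let ?DL = "direct_limit_module I r N \<phi>"
  have carrier_DL: "carrier ?DL = fib ` carrier L"
  proof -
    have "carrier ?DL = {limit_class I r N \<phi> i x | i x. i \<in> I \<and> x \<in> carrier (N i)}"
      by (simp add: direct_limit_module_def)
    also have "\<dots> = fib ` carrier L"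
    proof (intro equalityI subsetI)
      fix X assume "X \<in> {limit_class I r N \<phi> i x | i x. i \<in> I \<and> x \<in> carrier (N i)}"
      then obtain i x where i: "i \<in> I" "x \<in> carrier (N i)" "X = limit_class I r N \<phi> i x" by blast
      then show "X \<in> fib ` carrier L" using class_eq[OF i(1,2)] module_homs_closed[OF \<psi>[OF i(1)] i(2)] by blast
    next
      fix X assume "X \<in> fib ` carrier L"
      then obtain z where z: "z \<in> carrier L" "X = fib z" by blast
      obtain i x where i: "i \<in> I" "x \<in> carrier (N i)" "z = \<psi> i x" using surj[OF z(1)] by blast
      then have "X = limit_class I r N \<phi> i x" using class_eq[OF i(1,2)] z(2) by simp
      then show "X \<in> {limit_class I r N \<phi> i x | i x. i \<in> I \<and> x \<in> carrier (N i)}" using i by blast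
    qed
    finally show ?thesis .
  qed
  have add_DL: "fib z \<oplus>\<^bsub>?DL\<^esub> fib w = fib (z \<oplus>\<^bsub>L\<^esub> w)" if z: "z \<in> carrier L" and w: "w \<in> carrier L" for z w
  proof -
    let ?X = "{limit_class I r N \<phi> k (\<phi> i k x \<oplus>\<^bsub>N k\<^esub> \<phi> j k y) | i x j y k.
                       (i, x) \<in> fib z \<and> (j, y) \<in> fib w \<and> k \<in> I \<and> (i, k) \<in> r \<and> (j, k) \<in> r}"
    have each: "limit_class I r N \<phi> k (\<phi> i k x \<oplus>\<^bsub>N k\<^esub> \<phi> j k y) = fib (z \<oplus>\<^bsub>L\<^esub> w)"
      if "(i, x) \<in> fib z" "(j, y) \<in> fib w" "k \<in> I" "(i, k) \<in> r" "(j, k) \<in> r" for i x j y k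
    proof -
      have i: "i \<in> I" "x \<in> carrier (N i)" "\<psi> i x = z" and j: "j \<in> I" "y \<in> carrier (N j)" "\<psi> j y = w"
        using that(1,2) by (auto simp: fib_def)
      have xk: "\<phi> i k x \<in> carrier (N k)" and yk: "\<phi> j k y \<in> carrier (N k)"
        using module_homs_closed[OF \<phi>[OF i(1) that(3,4)] i(2)] module_homs_closed[OF \<phi>[OF j(1) that(3,5)] j(2)] .
      interpret Nk: module R "N k" by (rule mod[OF that(3)])
      have "\<psi> k (\<phi> i k x \<oplus>\<^bsub>N k\<^esub> \<phi> j k y) = z \<oplus>\<^bsub>L\<^esub> w"
        using module_homs_add[OF \<psi>[OF that(3)] xk yk] comp\<psi>[OF i(1) that(3,4) i(2)] comp\<psi>[OF j(1) that(3,5) j(2)]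
          i(3) j(3) by simp
      then show ?thesis using class_eq[OF that(3) Nk.M.a_closed[OF xk yk]] by simp
    qed
    obtain i x where "i \<in> I" "(i, x) \<in> fib z" using fib_ne[OF z] by blast
    moreover obtain j y where "j \<in> I" "(j, y) \<in> fib w" using fib_ne[OF w] by blast
    moreover obtain k where "k \<in> I" "(i, k) \<in> r" "(j, k) \<in> r" using dir[OF \<open>i \<in> I\<close> \<open>j \<in> I\<close>] by blast
    ultimately have "limit_class I r N \<phi> k (\<phi> i k x \<oplus>\<^bsub>N k\<^esub> \<phi> j k y) \<in> ?X" by blast
    then have "?X \<noteq> {}" by blast
    moreover have "?X \<subseteq> {fib (z \<oplus>\<^bsub>L\<^esub> w)}" using each by blast
    ultimately have "\<Union>?X = fib (z \<oplus>\<^bsub>L\<^esub> w)" by blast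
    then show ?thesis by (simp add: direct_limit_module_def)
  qed
  have smult_DL: "a \<odot>\<^bsub>?DL\<^esub> fib z = fib (a \<odot>\<^bsub>L\<^esub> z)" if a: "a \<in> carrier R" and z: "z \<in> carrier L" for a z
  proof -
    let ?X = "{limit_class I r N \<phi> i (a \<odot>\<^bsub>N i\<^esub> x) | i x. (i, x) \<in> fib z}"
    have each: "limit_class I r N \<phi> i (a \<odot>\<^bsub>N i\<^esub> x) = fib (a \<odot>\<^bsub>L\<^esub> z)" if "(i, x) \<in> fib z" for i x
    proof -
      have i: "i \<in> I" "x \<in> carrier (N i)" "\<psi> i x = z" using that by (auto simp: fib_def)
      interpret Ni: module R "N i" by (rule mod[OF i(1)])
      show ?thesis
        using class_eq[OF i(1) Ni.smult_closed[OF a i(2)]] module_homs_smult[OF \<psi>[OF i(1)] a i(2)] i(3) by simp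
    qed
    obtain i x where "(i, x) \<in> fib z" using fib_ne[OF z] by blast
    then have "?X \<noteq> {}" by blast
    moreover have "?X \<subseteq> {fib (a \<odot>\<^bsub>L\<^esub> z)}" using each by blast
    ultimately have "\<Union>?X = fib (a \<odot>\<^bsub>L\<^esub> z)" by blast
    then show ?thesis by (simp add: direct_limit_module_def)
  qed
  define \<theta> where "\<theta> = inv_into (carrier L) fib"
  have \<theta>_fib: "\<theta> (fib z) = z" if "z \<in> carrier L" for z
    unfolding \<theta>_def by (rule inv_into_f_f[OF fib_inj that])
  have "\<theta> \<in> module_homs R ?DL L"
  proof (rule module_homsI)
    fix X assume X: "X \<in> carrier ?DL"
    then obtain z where z: "z \<in> carrier L" "X = fib z" unfolding carrier_DL by blast
    then show "\<theta> X \<in> carrier L" using \<theta>_fib by simp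
    show "\<theta> (a \<odot>\<^bsub>?DL\<^esub> X) = a \<odot>\<^bsub>L\<^esub> \<theta> X" if "a \<in> carrier R" for a
      using z \<theta>_fib smult_DL that by simp
    fix Y assume "Y \<in> carrier ?DL"
    then obtain w where w: "w \<in> carrier L" "Y = fib w" unfolding carrier_DL by blast
    show "\<theta> (X \<oplus>\<^bsub>?DL\<^esub> Y) = \<theta> X \<oplus>\<^bsub>L\<^esub> \<theta> Y" using z w \<theta>_fib add_DL by simp
  qed
  moreover have "bij_betw \<theta> (carrier ?DL) (carrier L)"
    unfolding carrier_DL \<theta>_def by (rule bij_betw_inv_into) (simp add: bij_betw_def fib_inj)
  ultimately have "\<theta> \<in> module_isos R ?DL L" by (simp add: module_isos_def)
  moreover have "\<psi> i x = \<theta> (limit_class I r N \<phi> i x)" if "i \<in> I" "x \<in> carrier (N i)" for i x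
    using class_eq[OF that] \<theta>_fib module_homs_closed[OF \<psi>[OF that(1)] that(2)] by simp
  ultimately show ?thesis using L unfolding is_direct_limit_def by blast
qed

section \<open>Linear phantomness\<close>

text \<open>A list of pairs of a vector \<open>a \<in> R\<^sup>m\<close> and an element \<open>y \<in> M\<close> stands for the sum of the
  tensors \<open>a \<otimes> y\<close> in \<open>R\<^sup>m \<otimes> M = M\<^sup>m\<close>. This is its coordinate at \<open>j\<close>.\<close>

primrec tensor_coord :: "('a, 'b) module \<Rightarrow> nat \<Rightarrow> ((nat \<Rightarrow> 'a) \<times> 'b) list \<Rightarrow> 'b" where
  "tensor_coord M j [] = \<zero>\<^bsub>M\<^esub>"
| "tensor_coord M j (p # L) = (fst p j \<odot>\<^bsub>M\<^esub> snd p) \<oplus>\<^bsub>M\<^esub> tensor_coord M j L"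

lemma tensor_coord_closed:
  assumes "module R M" "set L \<subseteq> A \<times> carrier M" "\<And>a. a \<in> A \<Longrightarrow> a j \<in> carrier R"
  shows "tensor_coord M j L \<in> carrier M"
proof -
  interpret module R M by fact
  show ?thesis using assms(2,3) by (induction L) auto
qed

lemma tensor_coord_hom:
  assumes M: "module R M" and N: "module R N" and f: "f \<in> module_homs R M N"
    and L: "set L \<subseteq> A \<times> carrier M" and A: "\<And>a. a \<in> A \<Longrightarrow> a j \<in> carrier R"
  shows "f (tensor_coord M j L) = tensor_coord N j (map (apsnd f) L)"
proof -
  interpret M: module R M by fact
  show ?thesis using L
  proof (induction L)
    case Nil
    show ?case using module_homs_zero[OF M N f] by simp
  next
    case (Cons p L)
    have "tensor_coord M j L \<in> carrier M" using Cons.prems by (intro tensor_coord_closed[OF M _ A]) auto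
    then show ?case
      using Cons A by (auto simp: module_homs_add[OF f] module_homs_smult[OF f])
  qed
qed

lemma tensor_coord_append:
  assumes M: "module R M" and "set L \<subseteq> A \<times> carrier M" "set L' \<subseteq> A \<times> carrier M"
    and A: "\<And>a. a \<in> A \<Longrightarrow> a j \<in> carrier R"
  shows "tensor_coord M j (L @ L') = tensor_coord M j L \<oplus>\<^bsub>M\<^esub> tensor_coord M j L'"
proof -
  interpret M: module R M by fact
  have L': "tensor_coord M j L' \<in> carrier M" by (rule tensor_coord_closed[OF M assms(3) A])
  show ?thesis using assms(2)
  proof (induction L)
    case (Cons p L)
    have "tensor_coord M j L \<in> carrier M" using Cons.prems by (intro tensor_coord_closed[OF M _ A]) auto
    then show ?case using Cons A L' by (auto simp: M.a_assoc)
  qed (use L' in simp)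
qed

lemma tensor_coord_upt:
  assumes M: "module R M" and a: "\<And>l. l < k \<Longrightarrow> a l j \<in> carrier R" and y: "\<And>l. l < k \<Longrightarrow> y l \<in> carrier M"
  shows "tensor_coord M j (map (\<lambda>l. (a l, y l)) [0..<k]) = (\<Oplus>\<^bsub>M\<^esub> l \<in> {..<k}. a l j \<odot>\<^bsub>M\<^esub> y l)"
  using a y
proof (induction k)
  case 0
  interpret M: module R M by fact
  show ?case by simp
next
  case (Suc k)
  interpret M: module R M by fact
  let ?A = "a ` {..<Suc k}"
  have "tensor_coord M j (map (\<lambda>l. (a l, y l)) [0..<k] @ [(a k, y k)])
      = tensor_coord M j (map (\<lambda>l. (a l, y l)) [0..<k]) \<oplus>\<^bsub>M\<^esub> tensor_coord M j [(a k, y k)]"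
    by (rule tensor_coord_append[OF M, where A = ?A]) (use Suc.prems in auto)
  then show ?case using Suc by (simp add: lessThan_Suc Pi_iff M.a_comm)
qed

lemma tensor_coord_mem_submodule:
  fixes R :: "'a ring"
  assumes R: "cring R" and N: "submodule N R (power_module R m)" and L: "set L \<subseteq> N \<times> carrier R"
  shows "(\<lambda>j\<in>{..<m}. tensor_coord (ring_module R) j L) \<in> N"
  using L
proof (induction L)
  case Nil
  show ?case using submodule_zero[OF power_module_is_module[OF R] N]
    by (simp add: power_module_simps ring_module_def restrict_def)
next
  case (Cons p L)
  interpret cring R by fact
  note P = power_module_is_module[OF R, of m]
  obtain a y where p: "p = (a, y)" and a: "a \<in> N" and y: "y \<in> carrier R" using Cons.prems by auto
  have rec: "(\<lambda>j\<in>{..<m}. tensor_coord (ring_module R) j L) \<in> N"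
    by (rule Cons.IH) (use Cons.prems in auto)
  have "a \<in> carrier (power_module R m)" using submodule_carrier[OF P N a] .
  then have eq: "(\<lambda>j\<in>{..<m}. tensor_coord (ring_module R) j (p # L))
      = (y \<odot>\<^bsub>power_module R m\<^esub> a) \<oplus>\<^bsub>power_module R m\<^esub> (\<lambda>j\<in>{..<m}. tensor_coord (ring_module R) j L)"
    using y by (auto simp: p power_module_carrier_iff power_module_simps(2-4) ring_module_def m_comm intro!: restrict_ext)
  show ?case unfolding eq by (rule submodule_add[OF P N submodule_smult[OF P N y a] rec])
qed

text \<open>The elements of \<open>N \<otimes> M\<close> in \<open>M\<^sup>m\<close> are the values \<open>A y\<close> for \<open>A\<close> a matrix with columns
  in \<open>N\<close> and \<open>y\<close> a vector over \<open>M\<close>. So, for a monotone closure, \<open>e\<close> is linearly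
  phantom iff a linear system with right-hand side \<open>b e\<close> has a solution in \<open>M\<close> only when \<open>b\<close> lies in
  the closure of the column space. A phantom extension \<open>\<alpha>\<close> has this property for \<open>e = \<alpha> 1\<close>. Unlike
  phantomness, it speaks of finitely many elements of \<open>M\<close> at a time, and so it
  passes to direct limits.\<close>

definition linearly_phantom :: "'a ring \<Rightarrow> ('a, 'u) closure_op \<Rightarrow> ('a, 'b) module \<Rightarrow> 'b \<Rightarrow> bool" where
  "linearly_phantom R cl M e \<longleftrightarrow> e \<in> carrier M \<and>
     (\<forall>m N b L. submodule N R (power_module R m) \<and> b \<in> carrier (power_module R m) \<and>
        set L \<subseteq> N \<times> carrier M \<and> (\<forall>j<m. tensor_coord M j L = b j \<odot>\<^bsub>M\<^esub> e)
        \<longrightarrow> b \<in> closure_in R cl (power_module R m) N)"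

lemma linearly_phantomI:
  assumes "e \<in> carrier M"
    and "\<And>m N b L. submodule N R (power_module R m) \<Longrightarrow> b \<in> carrier (power_module R m) \<Longrightarrow>
        set L \<subseteq> N \<times> carrier M \<Longrightarrow> (\<And>j. j < m \<Longrightarrow> tensor_coord M j L = b j \<odot>\<^bsub>M\<^esub> e) \<Longrightarrow>
        b \<in> closure_in R cl (power_module R m) N"
  shows "linearly_phantom R cl M e"
  using assms unfolding linearly_phantom_def by blast

lemma linearly_phantomD:
  assumes "linearly_phantom R cl M e" "submodule N R (power_module R m)"
    "b \<in> carrier (power_module R m)" "set L \<subseteq> N \<times> carrier M"
    "\<And>j. j < m \<Longrightarrow> tensor_coord M j L = b j \<odot>\<^bsub>M\<^esub> e"
  shows "b \<in> closure_in R cl (power_module R m) N"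
  using assms unfolding linearly_phantom_def by blast

context
  fixes R :: "'a ring" and I :: "'i set" and r and N :: "'i \<Rightarrow> ('a, 'b) module" and \<phi>
  assumes sys: "direct_system R I r N \<phi>" and trans: "trans r"
    and dir: "\<And>i j. i \<in> I \<Longrightarrow> j \<in> I \<Longrightarrow> \<exists>k\<in>I. (i, k) \<in> r \<and> (j, k) \<in> r"
begin

text \<open>A solution in the limit consists of finitely many elements and satisfies finitely many
  equations, so it comes from a solution at some stage.\<close>

lemma linearly_phantom_direct_limit:
  assumes lim: "direct_limit_cocone R I r N \<phi> L \<psi>" and i0: "i0 \<in> I" and e: "e \<in> carrier (N i0)"
    and ph: "\<And>i. i \<in> I \<Longrightarrow> (i0, i) \<in> r \<Longrightarrow> linearly_phantom R cl (N i) (\<phi> i0 i e)"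
  shows "linearly_phantom R cl L (\<psi> i0 e)"
proof -
  note mod = direct_systemD(1)[OF sys] and \<phi> = direct_systemD(2)[OF sys] and comp = direct_systemD(3)[OF sys]
    and L = direct_limit_coconeD(1)[OF lim] and \<psi> = direct_limit_coconeD(2)[OF lim]
    and comp\<psi> = direct_limit_coconeD(3)[OF lim] and surj = direct_limit_coconeD(4)[OF lim]
    and ker = direct_limit_coconeD(5)[OF lim]
  note tr = transD[OF trans]
  have lift: "\<exists>i\<in>I. (i0, i) \<in> r \<and> (\<exists>xs'. set xs' \<subseteq> A \<times> carrier (N i) \<and> xs = map (apsnd (\<psi> i)) xs')"
    if "set xs \<subseteq> A \<times> carrier L" for A and xs :: "((nat \<Rightarrow> 'a) \<times> _) list"
    using that
  proof (induction xs)
    case Nil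
    then show ?case using dir[OF i0 i0] by auto
  next
    case (Cons p xs)
    then obtain i xs' where i: "i \<in> I" "(i0, i) \<in> r" "set xs' \<subseteq> A \<times> carrier (N i)"
      and xs: "xs = map (apsnd (\<psi> i)) xs'" by auto
    obtain a y where p: "p = (a, y)" "a \<in> A" "y \<in> carrier L" using Cons.prems by auto
    obtain i1 x where x: "i1 \<in> I" "x \<in> carrier (N i1)" "y = \<psi> i1 x" using surj[OF p(3)] by blast
    obtain k where k: "k \<in> I" "(i, k) \<in> r" "(i1, k) \<in> r" using dir[OF i(1) x(1)] by blast
    let ?xs = "(a, \<phi> i1 k x) # map (apsnd (\<phi> i k)) xs'"
    have 1: "set ?xs \<subseteq> A \<times> carrier (N k)"
      using p(2) i(3) module_homs_closed[OF \<phi>[OF x(1) k(1,3)] x(2)] module_homs_closed[OF \<phi>[OF i(1) k(1,2)]]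
      by auto
    have 2: "p # xs = map (apsnd (\<psi> k)) ?xs"
      using comp\<psi>[OF x(1) k(1,3) x(2)] comp\<psi>[OF i(1) k(1,2)] i(3) by (auto simp: p x xs)
    show ?case by (intro bexI[OF _ k(1)] conjI tr[OF i(2) k(2)] exI[of _ ?xs] 1 2)
  qed
  show ?thesis
  proof (rule linearly_phantomI)
    show "\<psi> i0 e \<in> carrier L" by (rule module_homs_closed[OF \<psi>[OF i0] e])
    fix m A b xs
    assume A: "submodule A R (power_module R m)" and b: "b \<in> carrier (power_module R m)"
      and xs: "set xs \<subseteq> A \<times> carrier L" and eq: "\<And>j. j < m \<Longrightarrow> tensor_coord L j xs = b j \<odot>\<^bsub>L\<^esub> \<psi> i0 e"
    obtain i xs' where i: "i \<in> I" "(i0, i) \<in> r" and xs': "set xs' \<subseteq> A \<times> carrier (N i)"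
      and xs_eq: "xs = map (apsnd (\<psi> i)) xs'" using lift[OF xs] by blast
    interpret Ni: module R "N i" by (rule mod[OF i(1)])
    have AR: "a j \<in> carrier R" if "a \<in> A" "j < m" for a j
      using submodule_carrier[OF power_module_is_module[OF Ni.R.is_cring] A that(1)] that(2)
      by (simp add: power_module_carrier_iff)
    have bR: "b j \<in> carrier R" if "j < m" for j using b that by (simp add: power_module_carrier_iff)
    have ei: "\<phi> i0 i e \<in> carrier (N i)" by (rule module_homs_closed[OF \<phi>[OF i0 i] e])
    define d where "d j = tensor_coord (N i) j xs' \<ominus>\<^bsub>N i\<^esub> b j \<odot>\<^bsub>N i\<^esub> \<phi> i0 i e" for j
    have tc: "tensor_coord (N i) j xs' \<in> carrier (N i)" if "j < m" for j
      by (rule tensor_coord_closed[OF mod[OF i(1)] xs']) (use AR that in blast)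
    have d: "d j \<in> carrier (N i)" if "j < m" for j
      using tc[OF that] bR[OF that] ei by (simp add: d_def)
    have d0: "\<psi> i (d j) = \<zero>\<^bsub>L\<^esub>" if j: "j < m" for j
    proof -
      have "\<psi> i (tensor_coord (N i) j xs') = tensor_coord L j xs"
        unfolding xs_eq by (rule tensor_coord_hom[OF mod[OF i(1)] L \<psi>[OF i(1)] xs']) (use AR j in blast)
      also have "\<dots> = \<psi> i (b j \<odot>\<^bsub>N i\<^esub> \<phi> i0 i e)"
        using eq j comp\<psi>[OF i0 i e] module_homs_smult[OF \<psi>[OF i(1)] bR[OF j] ei] by simp
      finally show ?thesis
        using module_homs_eq_iff[OF mod[OF i(1)] L \<psi>[OF i(1)] tc[OF j]] bR[OF j] ei by (simp add: d_def)
    qed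
    have "\<exists>k\<in>I. (i, k) \<in> r \<and> (\<forall>j<n. \<phi> i k (d j) = \<zero>\<^bsub>N k\<^esub>)" if "n \<le> m" for n
      using that
    proof (induction n)
      case 0
      then show ?case using dir[OF i(1) i(1)] by auto
    next
      case (Suc n)
      then obtain k where k: "k \<in> I" "(i, k) \<in> r" "\<And>j. j < n \<Longrightarrow> \<phi> i k (d j) = \<zero>\<^bsub>N k\<^esub>" by auto
      have n: "n < m" using Suc.prems by simp
      obtain k' where k': "k' \<in> I" "(i, k') \<in> r" "\<phi> i k' (d n) = \<zero>\<^bsub>N k'\<^esub>"
        using ker[OF i(1) d[OF n] d0[OF n]] by blast
      obtain l where l: "l \<in> I" "(k, l) \<in> r" "(k', l) \<in> r" using dir[OF k(1) k'(1)] by blast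
      have zero: "\<phi> i l x = \<zero>\<^bsub>N l\<^esub>"
        if "h \<in> I" "(i, h) \<in> r" "(h, l) \<in> r" "x \<in> carrier (N i)" "\<phi> i h x = \<zero>\<^bsub>N h\<^esub>" for h x
        using comp[OF i(1) that(1) l(1) that(2,3,4)] that(5)
          module_homs_zero[OF mod[OF that(1)] mod[OF l(1)] \<phi>[OF that(1) l(1) that(3)]] by simp
      have "\<phi> i l (d j) = \<zero>\<^bsub>N l\<^esub>" if "j < Suc n" for j
      proof (cases "j = n")
        case True
        then show ?thesis using zero[OF k'(1,2) l(3) d[OF n] k'(3)] by simp
      next
        case False
        then have "j < n" "j < m" using that n by auto
        then show ?thesis using zero[OF k(1,2) l(2) d k(3)] by simp
      qed
      then show ?case using l(1) tr[OF k(2) l(2)] by blast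
    qed
    from this[OF order_refl] obtain k where k: "k \<in> I" "(i, k) \<in> r"
      and dk: "\<And>j. j < m \<Longrightarrow> \<phi> i k (d j) = \<zero>\<^bsub>N k\<^esub>" by blast
    note \<phi>k = \<phi>[OF i(1) k]
    show "b \<in> closure_in R cl (power_module R m) A"
    proof (rule linearly_phantomD[OF ph[OF k(1) tr[OF i(2) k(2)]] A b])
      show "set (map (apsnd (\<phi> i k)) xs') \<subseteq> A \<times> carrier (N k)"
        using xs' module_homs_closed[OF \<phi>k] by auto
      show "tensor_coord (N k) j (map (apsnd (\<phi> i k)) xs') = b j \<odot>\<^bsub>N k\<^esub> \<phi> i0 k e" if j: "j < m" for j
      proof -
        have "tensor_coord (N k) j (map (apsnd (\<phi> i k)) xs') = \<phi> i k (tensor_coord (N i) j xs')"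
          by (rule tensor_coord_hom[OF mod[OF i(1)] mod[OF k(1)] \<phi>k xs', symmetric]) (use AR j in blast)
        also have "\<dots> = \<phi> i k (b j \<odot>\<^bsub>N i\<^esub> \<phi> i0 i e)"
          using dk[OF j] module_homs_eq_iff[OF mod[OF i(1)] mod[OF k(1)] \<phi>k tc[OF j]] bR[OF j] ei
          by (simp add: d_def)
        also have "\<dots> = b j \<odot>\<^bsub>N k\<^esub> \<phi> i0 k e"
          using module_homs_smult[OF \<phi>k bR[OF j] ei] comp[OF i0 i(1) k(1) i(2) k(2) e] by simp
        finally show ?thesis .
      qed
    qed
  qed
qed

end

lemma module_homs_restrict_eval:
  assumes "module R G" "\<And>j. j < m \<Longrightarrow> g j \<in> carrier G"
  shows "(\<lambda>h. \<lambda>j\<in>{..<m}. h (g j)) \<in> module_homs R (dual_module R G) (power_module R m)"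
  using assms(2)
  by (intro module_homsI)
    (auto simp: dual_module_carrier_iff dual_module_simps(2-4) power_module_carrier_iff
      power_module_simps(2-4) intro!: restrict_ext)

lemma dual_map_hom:
  assumes F: "module R F" and G: "module R G" and \<nu>: "\<nu> \<in> module_homs R G F"
  shows "(\<lambda>h. \<lambda>g\<in>carrier G. h (\<nu> g)) \<in> module_homs R (dual_module R F) (dual_module R G)"
proof -
  interpret G: module R G by fact
  show ?thesis
    using module_homs_closed[OF \<nu>]
    by (intro module_homsI)
      (auto simp: dual_module_carrier_iff dual_module_simps(2-4) module_homs_add[OF \<nu>]
        module_homs_smult[OF \<nu>] intro!: restrict_ext)
qed

context big_closure
begin

lemma closure_in_add:
  assumes X: "module R X" and N: "submodule N R X" and x: "x \<in> closure_in R cl X N" and y: "y \<in> N"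
  shows "x \<oplus>\<^bsub>X\<^esub> y \<in> closure_in R cl X N"
proof -
  interpret X: module R X by fact
  obtain D \<theta> where xX: "x \<in> carrier X" and D: "module R D" and \<theta>: "\<theta> \<in> module_isos R X D"
    and x: "\<theta> x \<in> cl D (\<theta> ` N)"
    using x unfolding closure_in_def by blast
  note h = module_isos_hom[OF \<theta>]
  have S: "submodule (\<theta> ` N) R D" by (rule image_submodule[OF X D h N])
  have yX: "y \<in> carrier X" by (rule submodule_carrier[OF X N y])
  have "\<theta> y \<in> cl D (\<theta> ` N)" using cl_extensive[OF D S] y by blast
  then have "\<theta> (x \<oplus>\<^bsub>X\<^esub> y) \<in> cl D (\<theta> ` N)"
    using submodule_add[OF D cl_submodule[OF D S] x] module_homs_add[OF h xX yX] by simp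
  then show ?thesis using X.M.a_closed[OF xX yX] D \<theta> unfolding closure_in_def by blast
qed

text \<open>Lift the solution \<open>y\<close> of \<open>A y = b \<alpha>(1)\<close> to \<open>F\<close>: \<open>y = \<mu>'(f) + c \<alpha>(1)\<close>.
  Then \<open>A f\<close> lies in the kernel of \<open>\<mu>\<close>, so \<open>A f = \<nu>(g)\<close> for a vector \<open>g\<close> over \<open>G\<close>.
  Evaluation at \<open>g\<close> is a map from the dual of \<open>G\<close> to \<open>R\<^sup>m\<close>; it sends the image of the dual
  of \<open>\<nu>\<close> into the column space and the cocycle of the extension to \<open>b - A c\<close>.\<close>

lemma linearly_phantom_of_phantom_extension:
  assumes inf: "infinite (UNIV :: 'u set)" and ph: "phantom_extension R cl M \<alpha>"
  shows "linearly_phantom R cl M (\<alpha> \<one>\<^bsub>R\<^esub>)"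
proof -
  interpret R: cring R by (rule R_cring)
  let ?RM = "ring_module R"
  have RM: "module R ?RM" by (rule ring_module_is_module[OF R_cring])
  have M: "module R M" and \<alpha>: "\<alpha> \<in> module_homs R ?RM M" and inj: "inj_on \<alpha> (carrier R)"
    using ph unfolding phantom_extension_def by blast+
  interpret M: module R M by (rule M)
  define K where "K = \<alpha> ` carrier R"
  define Q where "Q = quotient_module M K"
  obtain G \<nu> F \<mu> \<mu>' where pres: "free_presentation R (G :: ('a, 'u) module) \<nu> (F :: ('a, 'u) module) \<mu> Q"
    and \<mu>': "\<mu>' \<in> module_homs R F M" and lift: "\<And>x. x \<in> carrier F \<Longrightarrow> K +>\<^bsub>M\<^esub> \<mu>' x = \<mu> x"
    and cls: "(\<lambda>g\<in>carrier G. inv_into (carrier R) \<alpha> (\<mu>' (\<nu> g)))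
      \<in> closure_in R cl (dual_module R G) (image_dual_map R G \<nu> F)"
    using ph unfolding phantom_extension_def Let_def K_def Q_def by blast
  have G: "module R G" and F: "module R F" and \<nu>: "\<nu> \<in> module_homs R G F" and \<mu>: "\<mu> \<in> module_homs R F Q"
    and \<mu>_surj: "\<mu> ` carrier F = carrier Q" and exact: "\<nu> ` carrier G = a_kernel F Q \<mu>"
    using pres unfolding free_presentation_def free_module_def by blast+
  have "carrier ?RM = carrier R" by (simp add: ring_module_def)
  then have K: "submodule K R M"
    using image_submodule[OF RM M \<alpha> module.carrier_is_submodule[OF RM]] by (simp add: K_def)
  let ?e = "\<alpha> \<one>\<^bsub>R\<^esub>"
  have e: "?e \<in> carrier M" using module_homs_closed[OF \<alpha>] by (simp add: ring_module_def)
  have \<alpha>_eq: "\<alpha> a = a \<odot>\<^bsub>M\<^esub> ?e" if "a \<in> carrier R" for a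
    using module_homs_smult[OF \<alpha> that, of "\<one>\<^bsub>R\<^esub>"] that by (simp add: ring_module_def)
  interpret F: module R F by (rule F)
  show ?thesis
  proof (rule linearly_phantomI[OF e])
    fix m N b L
    assume N: "submodule N R (power_module R m)" and b: "b \<in> carrier (power_module R m)"
      and L: "set L \<subseteq> N \<times> carrier M" and eq: "\<And>j. j < m \<Longrightarrow> tensor_coord M j L = b j \<odot>\<^bsub>M\<^esub> ?e"
    let ?P = "power_module R m"
    have P: "module R ?P" by (rule power_module_is_module[OF R_cring])
    have NR: "a j \<in> carrier R" if "a \<in> N" "j < m" for a j
      using submodule_carrier[OF P N that(1)] that(2) by (simp add: power_module_carrier_iff)
    have bR: "b j \<in> carrier R" if "j < m" for j using b that by (simp add: power_module_carrier_iff)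
    have "\<exists>L' c. set L' \<subseteq> N \<times> carrier F \<and> c \<in> N \<and>
        (\<forall>j<m. tensor_coord M j L = \<mu>' (tensor_coord F j L') \<oplus>\<^bsub>M\<^esub> c j \<odot>\<^bsub>M\<^esub> ?e)"
      using L
    proof (induction L)
      case Nil
      have "tensor_coord M j [] = \<mu>' (tensor_coord F j []) \<oplus>\<^bsub>M\<^esub> \<zero>\<^bsub>?P\<^esub> j \<odot>\<^bsub>M\<^esub> ?e" if "j < m" for j
        using e that by (simp add: module_homs_zero[OF F M \<mu>'] power_module_simps(2))
      then show ?case using submodule_zero[OF P N]
        by (intro exI[of _ "[]"] exI[of _ "\<zero>\<^bsub>?P\<^esub>"]) simp
    next
      case (Cons p L)
      then obtain L' c where L': "set L' \<subseteq> N \<times> carrier F" and c: "c \<in> N"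
        and IH: "\<And>j. j < m \<Longrightarrow> tensor_coord M j L = \<mu>' (tensor_coord F j L') \<oplus>\<^bsub>M\<^esub> c j \<odot>\<^bsub>M\<^esub> ?e"
        by auto
      obtain a y where p: "p = (a, y)" and a: "a \<in> N" and y: "y \<in> carrier M" using Cons.prems by auto
      have "K +>\<^bsub>M\<^esub> y \<in> carrier Q"
        using module_homs_closed[OF quotient_hom[OF M K] y] by (simp add: Q_def)
      then have "K +>\<^bsub>M\<^esub> y \<in> \<mu> ` carrier F" by (simp only: \<mu>_surj)
      then obtain f where "K +>\<^bsub>M\<^esub> y = \<mu> f" "f \<in> carrier F" by (rule imageE)
      then have f: "f \<in> carrier F" "\<mu> f = K +>\<^bsub>M\<^esub> y" by simp_all
      have \<mu>f: "\<mu>' f \<in> carrier M" by (rule module_homs_closed[OF \<mu>' f(1)])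
      have "y \<ominus>\<^bsub>M\<^esub> \<mu>' f \<in> K" using quotient_coset_eq_iff[OF M K y \<mu>f] lift[OF f(1)] f(2) by simp
      then obtain s where "s \<in> carrier R" "y \<ominus>\<^bsub>M\<^esub> \<mu>' f = \<alpha> s" unfolding K_def by blast
      then have s: "s \<in> carrier R" "y \<ominus>\<^bsub>M\<^esub> \<mu>' f = s \<odot>\<^bsub>M\<^esub> ?e" by (simp_all only: \<alpha>_eq)
      have y_eq: "y = \<mu>' f \<oplus>\<^bsub>M\<^esub> s \<odot>\<^bsub>M\<^esub> ?e"
        using y \<mu>f unfolding s(2)[symmetric] a_minus_def by (simp add: M.M.a_lcomm M.M.r_neg)
      let ?c = "(s \<odot>\<^bsub>?P\<^esub> a) \<oplus>\<^bsub>?P\<^esub> c"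
      have "?c \<in> N" by (rule submodule_add[OF P N submodule_smult[OF P N s(1) a] c])
      moreover have "tensor_coord M j (p # L)
          = \<mu>' (tensor_coord F j ((a, f) # L')) \<oplus>\<^bsub>M\<^esub> ?c j \<odot>\<^bsub>M\<^esub> ?e" if j: "j < m" for j
      proof -
        have aj: "a j \<in> carrier R" and cj: "c j \<in> carrier R" using NR[OF a j] NR[OF c j] by auto
        have tc: "tensor_coord F j L' \<in> carrier F"
          by (rule tensor_coord_closed[OF F L']) (use NR j in blast)
        have t: "\<mu>' (tensor_coord F j L') \<in> carrier M" by (rule module_homs_closed[OF \<mu>' tc])
        have "\<mu>' (tensor_coord F j ((a, f) # L')) = a j \<odot>\<^bsub>M\<^esub> \<mu>' f \<oplus>\<^bsub>M\<^esub> \<mu>' (tensor_coord F j L')"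
          using aj f(1) tc by (simp add: module_homs_add[OF \<mu>'] module_homs_smult[OF \<mu>'])
        moreover have "?c j = s \<otimes>\<^bsub>R\<^esub> a j \<oplus>\<^bsub>R\<^esub> c j" using j by (simp add: power_module_simps)
        moreover have "tensor_coord M j (p # L) = a j \<odot>\<^bsub>M\<^esub> (\<mu>' f \<oplus>\<^bsub>M\<^esub> s \<odot>\<^bsub>M\<^esub> ?e)
            \<oplus>\<^bsub>M\<^esub> (\<mu>' (tensor_coord F j L') \<oplus>\<^bsub>M\<^esub> c j \<odot>\<^bsub>M\<^esub> ?e)"
          using IH[OF j] by (simp add: p y_eq[symmetric])
        ultimately show ?thesis
          using aj cj s(1) e \<mu>f t
          by (simp add: M.smult_l_distr M.smult_r_distr M.smult_assoc1[symmetric] R.m_comm[of s] M.M.a_ac)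
      qed
      ultimately show ?case using L' a f(1)
        by (intro exI[of _ "(a, f) # L'"] exI[of _ ?c]) (auto simp: p)
    qed
    then obtain L' c where L': "set L' \<subseteq> N \<times> carrier F" and c: "c \<in> N"
      and Leq: "\<And>j. j < m \<Longrightarrow> tensor_coord M j L = \<mu>' (tensor_coord F j L') \<oplus>\<^bsub>M\<^esub> c j \<odot>\<^bsub>M\<^esub> ?e"
      by blast
    have cR: "c j \<in> carrier R" if "j < m" for j using NR[OF c that] .
    let ?f = "\<lambda>j. tensor_coord F j L'"
    have f: "?f j \<in> carrier F" if "j < m" for j
      by (rule tensor_coord_closed[OF F L']) (use NR that in blast)
    have \<mu>f: "\<mu>' (?f j) = \<alpha> (b j \<ominus>\<^bsub>R\<^esub> c j)" if j: "j < m" for j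
    proof -
      have t: "\<mu>' (?f j) \<in> carrier M" by (rule module_homs_closed[OF \<mu>' f[OF j]])
      have "\<mu>' (?f j) \<oplus>\<^bsub>M\<^esub> c j \<odot>\<^bsub>M\<^esub> ?e = b j \<odot>\<^bsub>M\<^esub> ?e" using Leq[OF j] eq[OF j] by simp
      then have "\<mu>' (?f j) = b j \<odot>\<^bsub>M\<^esub> ?e \<ominus>\<^bsub>M\<^esub> c j \<odot>\<^bsub>M\<^esub> ?e"
        using t e cR[OF j] by (simp add: a_minus_def M.M.a_assoc M.M.r_neg flip: \<open>_ = b j \<odot>\<^bsub>M\<^esub> ?e\<close>)
      also have "\<dots> = (b j \<ominus>\<^bsub>R\<^esub> c j) \<odot>\<^bsub>M\<^esub> ?e"
        using e cR[OF j] bR[OF j] by (simp add: a_minus_def M.smult_l_distr M.smult_l_minus)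
      finally show ?thesis using \<alpha>_eq[of "b j \<ominus>\<^bsub>R\<^esub> c j"] cR[OF j] bR[OF j] by simp
    qed
    have "\<exists>g\<in>carrier G. \<nu> g = ?f j" if j: "j < m" for j
    proof -
      have "\<mu>' (?f j) \<in> K" using \<mu>f[OF j] cR[OF j] bR[OF j] by (simp add: K_def)
      then have "\<mu> (?f j) = \<zero>\<^bsub>Q\<^esub>"
        using lift[OF f[OF j]] quotient_zero_iff[OF M K module_homs_closed[OF \<mu>' f[OF j]]] by (simp add: Q_def)
      then have "?f j \<in> \<nu> ` carrier G" using f[OF j] unfolding exact by (simp add: a_kernel_def')
      then show ?thesis by auto
    qed
    then obtain g where g: "\<And>j. j < m \<Longrightarrow> g j \<in> carrier G" "\<And>j. j < m \<Longrightarrow> \<nu> (g j) = ?f j" by metis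
    let ?ev = "\<lambda>h. \<lambda>j\<in>{..<m}. h (g j)"
    let ?co = "\<lambda>g\<in>carrier G. inv_into (carrier R) \<alpha> (\<mu>' (\<nu> g))"
    note dG = dual_module_is_module[OF G]
    have im: "submodule (image_dual_map R G \<nu> F) R (dual_module R G)"
      unfolding image_dual_map_def
      by (rule image_submodule[OF dual_module_is_module[OF F] dG dual_map_hom[OF F G \<nu>]
            module.carrier_is_submodule[OF dual_module_is_module[OF F]]])
    note ev = module_homs_restrict_eval[OF G g(1)]
    obtain k :: "(nat \<Rightarrow> 'a) \<Rightarrow> 'u" where k: "inj_on k (carrier ?P)" using power_module_embeds[OF inf inj] .
    have in_image: "?ev ?co \<in> closure_in R cl ?P (?ev ` image_dual_map R G \<nu> F)"
      by (rule closure_in_hom[OF dG P ev im cls k])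
    have sub: "?ev ` image_dual_map R G \<nu> F \<subseteq> N"
    proof -
      have "?ev (\<lambda>g\<in>carrier G. h (\<nu> g)) \<in> N" if h: "h \<in> carrier (dual_module R F)" for h
      proof -
        have h: "h \<in> module_homs R F ?RM" using h by (simp add: dual_module_simps)
        have "?ev (\<lambda>g\<in>carrier G. h (\<nu> g)) = (\<lambda>j\<in>{..<m}. tensor_coord ?RM j (map (apsnd h) L'))"
        proof (rule restrict_ext)
          fix j assume "j \<in> {..<m}"
          then have j: "j < m" by simp
          have "h (?f j) = tensor_coord ?RM j (map (apsnd h) L')"
            by (rule tensor_coord_hom[OF F RM h L']) (use NR j in blast)
          then show "(\<lambda>g\<in>carrier G. h (\<nu> g)) (g j) = tensor_coord ?RM j (map (apsnd h) L')"
            using g[OF j] by simp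
        qed
        moreover have "set (map (apsnd h) L') \<subseteq> N \<times> carrier R"
          using L' module_homs_closed[OF h] by (auto simp: ring_module_def)
        ultimately show ?thesis using tensor_coord_mem_submodule[OF R_cring N] by metis
      qed
      then show ?thesis unfolding image_dual_map_def by blast
    qed
    have diff: "?ev ?co \<in> closure_in R cl ?P N"
      by (rule subsetD[OF closure_in_mono[OF P image_submodule[OF dG P ev im] N sub] in_image])
    have "?ev ?co \<oplus>\<^bsub>?P\<^esub> c = b"
    proof (rule power_module_eqI[OF _ b])
      have "?ev ?co \<in> carrier ?P" using diff unfolding closure_in_def by blast
      then show "?ev ?co \<oplus>\<^bsub>?P\<^esub> c \<in> carrier ?P"
        by (rule abelian_groupE(1)[OF module.axioms(2)[OF P] _ submodule_carrier[OF P N c]])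
      fix j assume j: "j < m"
      have "?co (g j) = b j \<ominus>\<^bsub>R\<^esub> c j"
        using g[OF j] \<mu>f[OF j] cR[OF j] bR[OF j] inv_into_f_f[OF inj] by simp
      then show "(?ev ?co \<oplus>\<^bsub>?P\<^esub> c) j = b j"
        using j cR[OF j] bR[OF j] by (simp add: power_module_simps a_minus_def R.a_assoc R.l_neg)
    qed
    then show "b \<in> closure_in R cl ?P N" using closure_in_add[OF P N diff c] by simp
  qed
qed

text \<open>If \<open>e \<in> \<mm>M\<close>, then \<open>A y = 1 e\<close> is solvable with a row \<open>A\<close> over \<open>\<mm>\<close>, so
  \<open>1\<close> lies in the closure of \<open>\<mm>\<close>, which is \<open>\<mm>\<close>.\<close>

lemma linearly_phantom_imp_proper:
  fixes M :: "('a, 'b) module" and gR :: "'a \<Rightarrow> 'u"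
  assumes M: "module R M" and ph: "linearly_phantom R cl M e"
    and gR: "inj_on gR (carrier R)" and ideal: "ideal \<mm> R" and proper: "\<one>\<^bsub>R\<^esub> \<notin> \<mm>"
  shows "ideal_smult R \<mm> M \<noteq> carrier M"
proof
  assume all: "ideal_smult R \<mm> M = carrier M"
  interpret R: cring R by (rule R_cring)
  interpret M: module R M by (rule M)
  let ?P = "power_module R 1" and ?RM = "ring_module R"
  have P: "module R ?P" by (rule power_module_is_module[OF R_cring])
  have RM: "module R ?RM" by (rule ring_module_is_module[OF R_cring])
  have e: "e \<in> carrier M" using ph by (simp add: linearly_phantom_def)
  have eval: "(\<lambda>v. v 0) \<in> module_homs R ?P ?RM"
    by (rule module_homsI) (auto simp: power_module_carrier_iff power_module_simps(2-4) ring_module_def)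
  have msub: "submodule \<mm> R ?RM" by (rule ideal_is_submodule[OF R_cring ideal])
  define N where "N = {v \<in> carrier ?P. v 0 \<in> \<mm>}"
  have N: "submodule N R ?P" unfolding N_def by (rule preimage_submodule[OF P RM eval msub])
  have NR: "a 0 \<in> carrier R" if "a \<in> N" for a using that by (simp add: N_def power_module_carrier_iff)
  define T where "T = {x. \<exists>L. set L \<subseteq> N \<times> carrier M \<and> x = tensor_coord M 0 L}"
  have T: "submodule T R M"
  proof (rule submoduleI_smult[OF M])
    show "T \<subseteq> carrier M" unfolding T_def using tensor_coord_closed[OF M] NR by blast
    show "\<zero>\<^bsub>M\<^esub> \<in> T" unfolding T_def by (rule CollectI, rule exI[of _ "[]"]) simp
    show "x \<oplus>\<^bsub>M\<^esub> y \<in> T" if xy: "x \<in> T" "y \<in> T" for x y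
    proof -
      obtain L L' where L: "set L \<subseteq> N \<times> carrier M" "x = tensor_coord M 0 L"
        "set L' \<subseteq> N \<times> carrier M" "y = tensor_coord M 0 L'" using xy unfolding T_def by blast
      have "tensor_coord M 0 (L @ L') = x \<oplus>\<^bsub>M\<^esub> y"
        unfolding L(2,4) by (rule tensor_coord_append[OF M L(1,3) NR])
      moreover have "set (L @ L') \<subseteq> N \<times> carrier M" using L(1,3) by simp
      ultimately show ?thesis unfolding T_def by (metis (mono_tags, lifting) mem_Collect_eq)
    qed
    show "a \<odot>\<^bsub>M\<^esub> x \<in> T" if a: "a \<in> carrier R" and x: "x \<in> T" for a x
    proof -
      obtain L where L: "set L \<subseteq> N \<times> carrier M" "x = tensor_coord M 0 L" using x unfolding T_def by blast
      have "(\<lambda>x. a \<odot>\<^bsub>M\<^esub> x) \<in> module_homs R M M"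
        using a by (intro module_homsI) (auto simp: M.smult_r_distr M.smult_assoc1[symmetric] R.m_comm)
      from tensor_coord_hom[OF M M this L(1) NR]
      have "a \<odot>\<^bsub>M\<^esub> x = tensor_coord M 0 (map (apsnd (\<lambda>x. a \<odot>\<^bsub>M\<^esub> x)) L)" by (simp add: L(2))
      moreover have "set (map (apsnd (\<lambda>x. a \<odot>\<^bsub>M\<^esub> x)) L) \<subseteq> N \<times> carrier M" using L(1) a by auto
      ultimately show ?thesis unfolding T_def by blast
    qed
  qed
  have "a \<odot>\<^bsub>M\<^esub> x \<in> T" if a: "a \<in> \<mm>" and x: "x \<in> carrier M" for a x
  proof -
    have aR: "a \<in> carrier R" using ideal.Icarr[OF ideal a] .
    then have "(\<lambda>i\<in>{..<1}. a) \<in> N" using a by (simp add: N_def power_module_carrier_iff)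
    then show ?thesis unfolding T_def using x aR
      by (intro CollectI exI[of _ "[(\<lambda>i\<in>{..<1}. a, x)]"]) simp
  qed
  then have "ideal_smult R \<mm> M \<subseteq> T"
    unfolding ideal_smult_def generated_submodule_def using T by blast
  then have "e \<in> T" using e all by blast
  then obtain L where L: "set L \<subseteq> N \<times> carrier M" "e = tensor_coord M 0 L" unfolding T_def by blast
  have one: "(\<lambda>i\<in>{..<1}. \<one>\<^bsub>R\<^esub>) \<in> closure_in R cl ?P N"
    by (rule linearly_phantomD[OF ph N _ L(1)]) (use L(2) e in \<open>simp_all add: power_module_carrier_iff\<close>)
  have "inj_on gR (carrier ?RM)" using gR by (simp add: ring_module_def)
  from closure_in_hom[OF P RM eval N one this]
  have "\<one>\<^bsub>R\<^esub> \<in> closure_in R cl ?RM ((\<lambda>v. v 0) ` N)" by simp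
  also have "\<dots> \<subseteq> closure_in R cl ?RM \<mm>"
    by (rule closure_in_mono[OF RM image_submodule[OF P RM eval N] msub]) (auto simp: N_def)
  finally show False using closure_in_maximal_ideal proper by simp
qed

end

section \<open>Module modifications\<close>

lemma constant_family:
  assumes "\<And>a. a \<in> A \<Longrightarrow> f a = c" "b \<in> A"
  shows "{f a | a. a \<in> A} = {c}"
  using assms by auto

text \<open>A modification \<open>M \<rightarrow> M'\<close> in terms of the surjection \<open>g : M \<oplus> R\<^sup>k \<rightarrow> M'\<close>, whose kernel
  is generated by \<open>(u, x\<^sub>1, \<dots>, x\<^sub>k)\<close>; the map itself is \<open>y \<mapsto> g (y, 0)\<close>.\<close>

definition presents_modification ::
    "'a ring \<Rightarrow> ('a, 'b) module \<Rightarrow> 'a list \<Rightarrow> 'b \<Rightarrow> ('a, 'c) module \<Rightarrow> ('b \<times> (nat \<Rightarrow> 'a) \<Rightarrow> 'c) \<Rightarrow> bool" where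
  "presents_modification R M xs u M' g \<longleftrightarrow>
     g \<in> module_homs R (module_sum M (power_module R (length xs))) M' \<and>
     g ` carrier (module_sum M (power_module R (length xs))) = carrier M' \<and>
     (\<forall>y\<in>carrier M. \<forall>z\<in>carrier (power_module R (length xs)). g (y, z) = \<zero>\<^bsub>M'\<^esub>
        \<longleftrightarrow> (\<exists>t\<in>carrier R. y = t \<odot>\<^bsub>M\<^esub> u \<and> (\<forall>l<length xs. z l = t \<otimes>\<^bsub>R\<^esub> xs ! l)))"

definition modification_relation_holds ::
    "'a ring \<Rightarrow> 'a set \<Rightarrow> ('a, 'b) module \<Rightarrow> 'a list \<Rightarrow> 'a \<Rightarrow> 'b list \<Rightarrow> 'b \<Rightarrow> bool" where
  "modification_relation_holds R \<mm> M xs x us u \<longleftrightarrow>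
     partial_sop R \<mm> (xs @ [x]) \<and> length us = length xs \<and> set us \<subseteq> carrier M \<and> u \<in> carrier M \<and>
     (\<Oplus>\<^bsub>M\<^esub> i \<in> {..<length xs}. (xs ! i) \<odot>\<^bsub>M\<^esub> (us ! i)) \<oplus>\<^bsub>M\<^esub> (x \<odot>\<^bsub>M\<^esub> u) = \<zero>\<^bsub>M\<^esub>"

lemma is_module_modification_of_presentation:
  fixes R :: "'a ring"
  assumes M: "module R M" and M': "module R M'" and xsR: "set xs \<subseteq> carrier R"
    and rel: "modification_relation_holds R \<mm> M xs x us u"
    and pres: "presents_modification R M xs u M' g"
    and f: "\<And>y. y \<in> carrier M \<Longrightarrow> f y = g (y, \<zero>\<^bsub>power_module R (length xs)\<^esub>)"
  shows "is_module_modification R \<mm> M M' f"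
proof -
  interpret M: module R M by (rule M)
  let ?P = "power_module R (length xs)"
  let ?S = "module_sum M ?P"
  have P: "module R ?P" by (rule power_module_is_module[OF M.R.is_cring])
  have S: "module R ?S" by (rule module_sum_is_module[OF M P])
  have u: "u \<in> carrier M" using rel by (simp add: modification_relation_holds_def)
  let ?x = "\<lambda>i\<in>{..<length xs}. xs ! i"
  have x: "?x \<in> carrier ?P" using xsR by (auto simp: power_module_carrier_iff)
  have w: "(u, ?x) \<in> carrier ?S" using u x by (simp add: module_sum_simps)
  let ?K = "modification_relation R M xs u"
  have K: "?K = {t \<odot>\<^bsub>?S\<^esub> (u, ?x) | t. t \<in> carrier R}"
  proof
    have "(u, ?x) = \<one>\<^bsub>R\<^esub> \<odot>\<^bsub>?S\<^esub> (u, ?x)" using module.smult_one[OF S w] by simp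
    then have "(u, ?x) \<in> {t \<odot>\<^bsub>?S\<^esub> (u, ?x) | t. t \<in> carrier R}" by blast
    then show "?K \<subseteq> {t \<odot>\<^bsub>?S\<^esub> (u, ?x) | t. t \<in> carrier R}"
      using multiples_submodule[OF S w] unfolding modification_relation_def generated_submodule_def by blast
    show "{t \<odot>\<^bsub>?S\<^esub> (u, ?x) | t. t \<in> carrier R} \<subseteq> ?K"
      unfolding modification_relation_def generated_submodule_def using submodule_smult[OF S] by blast
  qed
  have K_sub: "submodule ?K R ?S" unfolding K by (rule multiples_submodule[OF S w])
  have g: "g \<in> module_homs R ?S M'" "g ` carrier ?S = carrier M'"
    using pres unfolding presents_modification_def by blast+
  have ker: "?K +>\<^bsub>?S\<^esub> p = \<zero>\<^bsub>quotient_module ?S ?K\<^esub> \<longleftrightarrow> g p = \<zero>\<^bsub>M'\<^esub>" if p: "p \<in> carrier ?S" for p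
  proof -
    obtain y z where p: "p = (y, z)" and y: "y \<in> carrier M" and z: "z \<in> carrier ?P"
      using p by (auto simp: module_sum_simps)
    have "z = t \<odot>\<^bsub>?P\<^esub> ?x \<longleftrightarrow> (\<forall>l<length xs. z l = t \<otimes>\<^bsub>R\<^esub> xs ! l)" if t: "t \<in> carrier R" for t
    proof
      assume "z = t \<odot>\<^bsub>?P\<^esub> ?x"
      then show "\<forall>l<length xs. z l = t \<otimes>\<^bsub>R\<^esub> xs ! l" by (simp add: power_module_simps)
    next
      assume eq: "\<forall>l<length xs. z l = t \<otimes>\<^bsub>R\<^esub> xs ! l"
      show "z = t \<odot>\<^bsub>?P\<^esub> ?x"
        by (rule power_module_eqI[OF z module.smult_closed[OF P t x]])
          (use eq in \<open>simp add: power_module_simps\<close>)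
    qed
    then have "p \<in> ?K \<longleftrightarrow> g p = \<zero>\<^bsub>M'\<^esub>"
      using pres y z unfolding K p module_sum_simps presents_modification_def by auto
    then show ?thesis using quotient_zero_iff[OF S K_sub that] by simp
  qed
  obtain \<theta> where \<theta>: "\<theta> \<in> module_isos R (quotient_module ?S ?K) M'"
    and eq: "\<And>p. p \<in> carrier ?S \<Longrightarrow> \<theta> (?K +>\<^bsub>?S\<^esub> p) = g p"
    using factor_through_surjection_iso[OF S quotient_is_module[OF S K_sub] M' quotient_hom[OF S K_sub]
        quotient_surj[OF S K_sub] g ker] by blast
  have "f y = \<theta> (modification_map R M xs u y)" if "y \<in> carrier M" for y
    using f[OF that] eq[of "(y, \<zero>\<^bsub>?P\<^esub>)"] that submodule_zero[OF P module.carrier_is_submodule[OF P]]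
    by (simp add: modification_map_def module_sum_simps)
  then show ?thesis
    using M' rel \<theta> unfolding is_module_modification_def modification_relation_holds_def modification_def
    by (intro conjI exI[of _ xs] exI[of _ x] exI[of _ us] exI[of _ u] bexI[of _ \<theta>]) auto
qed

context big_closure
begin

text \<open>A solution in \<open>M'\<close> of a system with columns in \<open>N\<close> and right-hand side \<open>b e\<close> is one
  over \<open>M\<close> up to an error \<open>\<tau> u\<close> such that \<open>x\<^sub>l \<tau> \<in> N\<close> for all \<open>l\<close>. Adding the given
  relation as one more equation, with the columns \<open>(-\<tau>, x)\<close> and \<open>(0, x\<^sub>l)\<close>, gives a system over
  \<open>M\<close> with right-hand side \<open>(b, 0)\<close>. Map \<open>R\<^sup>m \<oplus> R\<close> to the sum of the quotient of \<open>R\<^sup>m\<close> by the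
  closure of \<open>N\<close> and \<open>R/J\<close>, where \<open>J = (x\<^sub>1, \<dots>, x\<^sub>k)\<close>. The columns go to multiples of the image
  \<open>v\<close> of \<open>(-\<tau>, x)\<close>, and \<open>J v = 0\<close>. So the colon-capturing axiom puts the image of
  \<open>(b, 0)\<close> into the closure of zero, which is zero in the first summand.\<close>

lemma linearly_phantom_modification:
  fixes M :: "('a, 'b) module" and M' :: "('a, 'c) module" and gR :: "'a \<Rightarrow> 'u"
  assumes inf: "infinite (UNIV :: 'u set)" and gR: "inj_on gR (carrier R)"
    and M: "module R M" and M': "module R M'"
    and xxR: "set (xs @ [x]) \<subseteq> carrier R"
    and rel: "modification_relation_holds R \<mm> M xs x us u"
    and pres: "presents_modification R M xs u M' g"
    and ph: "linearly_phantom R cl M e"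
  shows "linearly_phantom R cl M' (g (e, \<zero>\<^bsub>power_module R (length xs)\<^esub>))"
proof -
  interpret R: cring R by (rule R_cring)
  interpret M: module R M by (rule M)
  let ?k = "length xs"
  let ?Pk = "power_module R ?k"
  let ?S = "module_sum M ?Pk"
  let ?RM = "ring_module R"
  let ?J = "Idl\<^bsub>R\<^esub> (set xs)"
  have Pk: "module R ?Pk" by (rule power_module_is_module[OF R_cring])
  have S: "module R ?S" by (rule module_sum_is_module[OF M Pk])
  have RM: "module R ?RM" by (rule ring_module_is_module[OF R_cring])
  interpret M': module R M' by (rule M')
  have z0: "\<zero>\<^bsub>?Pk\<^esub> \<in> carrier ?Pk" by (simp add: power_module_carrier_iff power_module_simps(2))
  have e: "e \<in> carrier M" using ph by (simp add: linearly_phantom_def)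
  have xsR: "set xs \<subseteq> carrier R" and xR: "x \<in> carrier R" using xxR by auto
  have xlR: "xs ! l \<in> carrier R" if "l < ?k" for l using xsR that by auto
  have sop: "partial_sop R \<mm> (xs @ [x])" and len: "length us = ?k" and usM: "set us \<subseteq> carrier M"
    and u: "u \<in> carrier M"
    and rel_sum: "(\<Oplus>\<^bsub>M\<^esub> i \<in> {..<?k}. (xs ! i) \<odot>\<^bsub>M\<^esub> (us ! i)) \<oplus>\<^bsub>M\<^esub> (x \<odot>\<^bsub>M\<^esub> u) = \<zero>\<^bsub>M\<^esub>"
    using rel by (simp_all add: modification_relation_holds_def)
  have ulM: "us ! l \<in> carrier M" if "l < ?k" for l using usM len that by auto
  have g: "g \<in> module_homs R ?S M'" and g_surj: "g ` carrier ?S = carrier M'"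
    using pres unfolding presents_modification_def by blast+
  have g_ker: "\<exists>t\<in>carrier R. y = t \<odot>\<^bsub>M\<^esub> u \<and> (\<forall>l<?k. z l = t \<otimes>\<^bsub>R\<^esub> xs ! l)"
    if "y \<in> carrier M" "z \<in> carrier ?Pk" "g (y, z) = \<zero>\<^bsub>M'\<^esub>" for y z
    using pres that unfolding presents_modification_def by blast
  have J: "ideal ?J R" by (rule R.genideal_ideal[OF xsR])
  let ?e' = "g (e, \<zero>\<^bsub>?Pk\<^esub>)"
  have e': "?e' \<in> carrier M'" by (rule module_homs_closed[OF g]) (simp add: module_sum_simps e z0)
  show ?thesis
  proof (rule linearly_phantomI[OF e'])
    fix m N b L
    let ?P = "power_module R m"
    assume N: "submodule N R ?P" and b: "b \<in> carrier ?P" and L: "set L \<subseteq> N \<times> carrier M'"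
      and eq: "\<And>j. j < m \<Longrightarrow> tensor_coord M' j L = b j \<odot>\<^bsub>M'\<^esub> ?e'"
    have P: "module R ?P" by (rule power_module_is_module[OF R_cring])
    have NR: "a j \<in> carrier R" if "a \<in> N" "j < m" for a j
      using submodule_carrier[OF P N that(1)] that(2) by (simp add: power_module_carrier_iff)
    have bR: "b j \<in> carrier R" if "j < m" for j using b that by (simp add: power_module_carrier_iff)
    \<comment> \<open>Write each entry of the solution as \<open>g (y, s)\<close>. The coefficients \<open>s l\<close> multiply columns,
      so for each \<open>l\<close> they combine to a vector \<open>z l\<close> in \<open>N\<close>.\<close>
    have "\<exists>L' z. set L' \<subseteq> N \<times> carrier M \<and> (\<forall>l<?k. z l \<in> N) \<and>
        (\<forall>j<m. tensor_coord M' j L = g (tensor_coord M j L', \<lambda>l\<in>{..<?k}. z l j))"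
      using L
    proof (induction L)
      case Nil
      have "(\<zero>\<^bsub>M\<^esub>, \<lambda>l\<in>{..<?k}. \<zero>\<^bsub>?P\<^esub> j) = \<zero>\<^bsub>?S\<^esub>" if "j < m" for j
        using that by (simp add: module_sum_simps power_module_simps(2))
      then have "g (\<zero>\<^bsub>M\<^esub>, \<lambda>l\<in>{..<?k}. \<zero>\<^bsub>?P\<^esub> j) = \<zero>\<^bsub>M'\<^esub>" if "j < m" for j
        using module_homs_zero[OF S M' g] that by metis
      then show ?case using submodule_zero[OF P N]
        by (intro exI[of _ "[]"] exI[of _ "\<lambda>l. \<zero>\<^bsub>?P\<^esub>"]) (simp add: restrict_def)
    next
      case (Cons p L)
      have "set L \<subseteq> N \<times> carrier M'" using Cons.prems by simp
      from Cons.IH[OF this] obtain L' z where L': "set L' \<subseteq> N \<times> carrier M" and z: "\<And>l. l < ?k \<Longrightarrow> z l \<in> N"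
        and IH: "\<And>j. j < m \<Longrightarrow> tensor_coord M' j L = g (tensor_coord M j L', \<lambda>l\<in>{..<?k}. z l j)"
        by blast
      obtain a y' where p: "p = (a, y')" and a: "a \<in> N" and y': "y' \<in> carrier M'" using Cons.prems by auto
      have "y' \<in> g ` carrier ?S" using y' by (simp only: g_surj)
      then obtain q where q: "y' = g q" "q \<in> carrier ?S" by (rule imageE)
      obtain y s where qys: "q = (y, s)" by (cases q)
      have y: "y \<in> carrier M" and s: "s \<in> carrier ?Pk" using q(2) by (simp_all add: qys module_sum_simps)
      have sR: "s l \<in> carrier R" if "l < ?k" for l using s that by (simp add: power_module_carrier_iff)
      let ?z = "\<lambda>l. (s l \<odot>\<^bsub>?P\<^esub> a) \<oplus>\<^bsub>?P\<^esub> z l"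
      have "?z l \<in> N" if "l < ?k" for l
        by (rule submodule_add[OF P N submodule_smult[OF P N sR[OF that] a] z[OF that]])
      moreover have "tensor_coord M' j (p # L)
          = g (tensor_coord M j ((a, y) # L'), \<lambda>l\<in>{..<?k}. ?z l j)" if j: "j < m" for j
      proof -
        have aj: "a j \<in> carrier R" by (rule NR[OF a j])
        have tc: "tensor_coord M j L' \<in> carrier M"
          by (rule tensor_coord_closed[OF M L']) (use NR j in blast)
        have zj: "(\<lambda>l\<in>{..<?k}. z l j) \<in> carrier ?Pk"
          using NR[OF z j] by (simp add: power_module_carrier_iff)
        have "tensor_coord M' j (p # L)
            = g (a j \<odot>\<^bsub>?S\<^esub> (y, s)) \<oplus>\<^bsub>M'\<^esub> g (tensor_coord M j L', \<lambda>l\<in>{..<?k}. z l j)"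
          using IH[OF j] module_homs_smult[OF g aj q(2)] by (simp add: p q(1) qys)
        also have "\<dots> = g ((a j \<odot>\<^bsub>?S\<^esub> (y, s)) \<oplus>\<^bsub>?S\<^esub> (tensor_coord M j L', \<lambda>l\<in>{..<?k}. z l j))"
          by (rule module_homs_add[OF g, symmetric])
            (use aj y s tc zj module.smult_closed[OF Pk aj s] in \<open>simp_all add: module_sum_simps\<close>)
        also have "(a j \<odot>\<^bsub>?S\<^esub> (y, s)) \<oplus>\<^bsub>?S\<^esub> (tensor_coord M j L', \<lambda>l\<in>{..<?k}. z l j)
            = (tensor_coord M j ((a, y) # L'), \<lambda>l\<in>{..<?k}. ?z l j)"
          using j aj sR by (auto simp: module_sum_simps power_module_simps(3,4) R.m_comm intro!: restrict_ext)
        finally show ?thesis .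
      qed
      ultimately show ?case using L' a y
        by (intro exI[of _ "(a, y) # L'"] exI[of _ ?z]) (auto simp: restrict_def)
    qed
    then obtain L' z where L': "set L' \<subseteq> N \<times> carrier M" and z: "\<And>l. l < ?k \<Longrightarrow> z l \<in> N"
      and Leq: "\<And>j. j < m \<Longrightarrow> tensor_coord M' j L = g (tensor_coord M j L', \<lambda>l\<in>{..<?k}. z l j)"
      by blast
    have tcM: "tensor_coord M j L' \<in> carrier M" if "j < m" for j
      by (rule tensor_coord_closed[OF M L']) (use NR that in blast)
    have "\<exists>t\<in>carrier R. tensor_coord M j L' \<ominus>\<^bsub>M\<^esub> b j \<odot>\<^bsub>M\<^esub> e = t \<odot>\<^bsub>M\<^esub> u \<and>
        (\<forall>l<?k. z l j = t \<otimes>\<^bsub>R\<^esub> xs ! l)" if j: "j < m" for j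
    proof -
      have zj: "(\<lambda>l\<in>{..<?k}. z l j) \<in> carrier ?Pk" using NR[OF z j] by (simp add: power_module_carrier_iff)
      let ?d = "\<ominus>\<^bsub>M\<^esub> (b j \<odot>\<^bsub>M\<^esub> e)"
      have be: "b j \<odot>\<^bsub>M\<^esub> e \<in> carrier M" using bR[OF j] e by simp
      have bz: "b j \<odot>\<^bsub>?Pk\<^esub> \<zero>\<^bsub>?Pk\<^esub> = \<zero>\<^bsub>?Pk\<^esub>" by (rule module.smult_r_null[OF Pk bR[OF j]])
      have z_id: "x \<oplus>\<^bsub>?Pk\<^esub> \<zero>\<^bsub>?Pk\<^esub> = x" if "x \<in> carrier ?Pk" for x
        using abelian_monoid.r_zero[OF abelian_group.axioms(1)[OF module.axioms(2)[OF Pk]] that] .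
      have in_S: "(tensor_coord M j L', \<lambda>l\<in>{..<?k}. z l j) \<in> carrier ?S"
        "(?d, \<zero>\<^bsub>?Pk\<^esub>) \<in> carrier ?S" "(b j \<odot>\<^bsub>M\<^esub> e, \<zero>\<^bsub>?Pk\<^esub>) \<in> carrier ?S"
        using tcM[OF j] zj z0 be unfolding module_sum_simps(1) by blast+
      have "g (tensor_coord M j L' \<ominus>\<^bsub>M\<^esub> b j \<odot>\<^bsub>M\<^esub> e, \<lambda>l\<in>{..<?k}. z l j)
          = g ((tensor_coord M j L', \<lambda>l\<in>{..<?k}. z l j) \<oplus>\<^bsub>?S\<^esub> (?d, \<zero>\<^bsub>?Pk\<^esub>))"
        using z_id[OF zj] by (simp add: module_sum_simps a_minus_def)
      also have "\<dots> = b j \<odot>\<^bsub>M'\<^esub> ?e' \<oplus>\<^bsub>M'\<^esub> g (?d, \<zero>\<^bsub>?Pk\<^esub>)"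
        using Leq[OF j] eq[OF j] module_homs_add[OF g in_S(1,2)] by simp
      also have "\<dots> = g (b j \<odot>\<^bsub>M\<^esub> e, \<zero>\<^bsub>?Pk\<^esub>) \<oplus>\<^bsub>M'\<^esub> g (?d, \<zero>\<^bsub>?Pk\<^esub>)"
        using module_homs_smult[OF g bR[OF j], of "(e, \<zero>\<^bsub>?Pk\<^esub>)"] e z0 bz by (simp add: module_sum_simps)
      also have "\<dots> = g ((b j \<odot>\<^bsub>M\<^esub> e, \<zero>\<^bsub>?Pk\<^esub>) \<oplus>\<^bsub>?S\<^esub> (?d, \<zero>\<^bsub>?Pk\<^esub>))"
        by (rule module_homs_add[OF g in_S(3,2), symmetric])
      also have "\<dots> = g \<zero>\<^bsub>?S\<^esub>" using be z_id[OF z0] by (simp add: module_sum_simps M.M.r_neg)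
      also have "\<dots> = \<zero>\<^bsub>M'\<^esub>" by (rule module_homs_zero[OF S M' g])
      finally show ?thesis using g_ker[OF _ zj] tcM[OF j] be by simp
    qed
    then obtain \<tau> where \<tau>: "\<And>j. j < m \<Longrightarrow> \<tau> j \<in> carrier R"
      and \<tau>u: "\<And>j. j < m \<Longrightarrow> tensor_coord M j L' \<ominus>\<^bsub>M\<^esub> b j \<odot>\<^bsub>M\<^esub> e = \<tau> j \<odot>\<^bsub>M\<^esub> u"
      and \<tau>x: "\<And>j l. j < m \<Longrightarrow> l < ?k \<Longrightarrow> z l j = \<tau> j \<otimes>\<^bsub>R\<^esub> xs ! l"
      by metis
    let ?t = "\<lambda>j\<in>{..<m}. \<ominus>\<^bsub>R\<^esub> \<tau> j"
    have t: "?t \<in> carrier ?P" using \<tau> by (simp add: power_module_carrier_iff)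
    have Jt: "a \<odot>\<^bsub>?P\<^esub> ?t \<in> N" if "a \<in> ?J" for a
    proof -
      have hom: "(\<lambda>a. a \<odot>\<^bsub>?P\<^esub> ?t) \<in> module_homs R ?RM ?P"
        using t module.smult_closed[OF P _ t] module.smult_l_distr[OF P _ _ t] module.smult_assoc1[OF P _ _ t]
        by (intro module_homsI) (simp_all add: ring_module_def)
      let ?A = "{a \<in> carrier ?RM. a \<odot>\<^bsub>?P\<^esub> ?t \<in> N}"
      have A: "submodule ?A R ?RM" by (rule preimage_submodule[OF RM P hom N])
      have "xs ! l \<in> ?A" if l: "l < ?k" for l
      proof -
        have "xs ! l \<odot>\<^bsub>?P\<^esub> ?t = (\<ominus>\<^bsub>R\<^esub> \<one>\<^bsub>R\<^esub>) \<odot>\<^bsub>?P\<^esub> z l"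
        proof (rule power_module_eqI)
          show "xs ! l \<odot>\<^bsub>?P\<^esub> ?t \<in> carrier ?P" by (rule module.smult_closed[OF P xlR[OF l] t])
          show "(\<ominus>\<^bsub>R\<^esub> \<one>\<^bsub>R\<^esub>) \<odot>\<^bsub>?P\<^esub> z l \<in> carrier ?P"
            by (rule module.smult_closed[OF P _ submodule_carrier[OF P N z[OF l]]]) simp
          fix j assume j: "j < m"
          show "(xs ! l \<odot>\<^bsub>?P\<^esub> ?t) j = ((\<ominus>\<^bsub>R\<^esub> \<one>\<^bsub>R\<^esub>) \<odot>\<^bsub>?P\<^esub> z l) j"
            using j \<tau>[OF j] xlR[OF l] \<tau>x[OF j l]
            by (simp add: power_module_simps(4) R.r_minus R.l_minus R.m_comm)
        qed
        moreover have "(\<ominus>\<^bsub>R\<^esub> \<one>\<^bsub>R\<^esub>) \<odot>\<^bsub>?P\<^esub> z l \<in> N" by (rule submodule_smult[OF P N _ z[OF l]]) simp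
        ultimately show ?thesis using xlR[OF l] by (simp add: ring_module_def)
      qed
      then have "set xs \<subseteq> ?A" unfolding in_set_conv_nth subset_iff by blast
      moreover have "ideal ?A R" by (rule submodule_is_ideal[OF R_cring A])
      ultimately have "?J \<subseteq> ?A" using R.genideal_minimal by blast
      then show ?thesis using that by blast
    qed
    \<comment> \<open>The columns of the enlarged system lie in the preimage \<open>N'\<close> of the multiples of \<open>v\<close>.
      So its closure maps into the closure of \<open>R v\<close>, as the colon-capturing axiom requires.\<close>
    let ?P1 = "power_module R (Suc m)"
    have P1: "module R ?P1" by (rule power_module_is_module[OF R_cring])
    define ext where "ext a s = (\<lambda>j\<in>{..<Suc m}. if j < m then a j else s)" for a :: "nat \<Rightarrow> 'a" and s
    have ext: "ext a s \<in> carrier ?P1" if "a \<in> carrier ?P" "s \<in> carrier R" for a s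
      using that by (simp add: ext_def power_module_carrier_iff)
    have ext_simps: "ext a s j = a j" "ext a s m = s" if "j < m" for a s j using that by (simp_all add: ext_def)
    have ext_last: "ext a s m = s" for a s by (simp add: ext_def)
    obtain h0 :: "(nat \<Rightarrow> 'a) \<Rightarrow> 'u" where h0: "inj_on h0 (carrier ?P)" using power_module_embeds[OF inf gR] .
    obtain C :: "('a, 'u set) module" and \<gamma> and hC :: "'u set \<Rightarrow> 'u" where C: "module R C"
      and \<gamma>: "\<gamma> \<in> module_homs R ?P C" and \<gamma>N: "\<And>a. a \<in> N \<Longrightarrow> \<gamma> a = \<zero>\<^bsub>C\<^esub>"
      and \<gamma>_ker: "\<And>a. a \<in> carrier ?P \<Longrightarrow> \<gamma> a = \<zero>\<^bsub>C\<^esub> \<Longrightarrow> a \<in> closure_in R cl ?P N"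
      and C0: "closure_in R cl C {\<zero>\<^bsub>C\<^esub>} = {\<zero>\<^bsub>C\<^esub>}" and hC: "inj_on hC (carrier C)"
      using quotient_by_closure[OF P N h0] by blast
    let ?RJ = "quotient_module ?RM ?J"
    have Jsub: "submodule ?J R ?RM" by (rule ideal_is_submodule[OF R_cring J])
    note RJ = quotient_is_module[OF RM Jsub] and RJ_hom = quotient_hom[OF RM Jsub]
    let ?q = "\<lambda>a. ?J +>\<^bsub>?RM\<^esub> a"
    have q0: "?q a = \<zero>\<^bsub>?RJ\<^esub>" if "a \<in> ?J" for a
      using quotient_zero_iff[OF RM Jsub, of a] that submodule_carrier[OF RM Jsub that] by simp
    let ?E = "module_sum C ?RJ"
    have E: "module R ?E" by (rule module_sum_is_module[OF C RJ])
    interpret E: module R ?E by (rule E)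
    let ?h = "\<lambda>v. (\<gamma> (\<lambda>j\<in>{..<m}. v j), ?q (v m))"
    have restrict_hom: "(\<lambda>v. \<lambda>j\<in>{..<m}. v j) \<in> module_homs R ?P1 ?P"
      by (rule module_homsI) (auto simp: power_module_carrier_iff power_module_simps(2-4) intro!: restrict_ext)
    have last_hom: "(\<lambda>v. v m) \<in> module_homs R ?P1 ?RM"
      by (rule module_homsI) (auto simp: power_module_carrier_iff power_module_simps(2-4) ring_module_def)
    note h1 = module_homs_comp[OF restrict_hom \<gamma>] and h2 = module_homs_comp[OF last_hom RJ_hom]
    have h: "?h \<in> module_homs R ?P1 ?E"
      by (rule module_homsI)
        (simp_all add: module_sum_simps module_homs_closed[OF h1] module_homs_closed[OF h2]
          module_homs_add[OF h1] module_homs_add[OF h2] module_homs_smult[OF h1] module_homs_smult[OF h2])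
    let ?v = "(\<gamma> ?t, ?q x)"
    have xRM: "x \<in> carrier ?RM" using xR by (simp add: ring_module_def)
    have v: "?v \<in> carrier ?E"
      using module_homs_closed[OF \<gamma> t] module_homs_closed[OF RJ_hom xRM] by (simp add: module_sum_simps)
    let ?V = "{a \<odot>\<^bsub>?E\<^esub> ?v | a. a \<in> carrier R}"
    have V: "submodule ?V R ?E" by (rule multiples_submodule[OF E v])
    define N' where "N' = {w \<in> carrier ?P1. ?h w \<in> ?V}"
    have N': "submodule N' R ?P1" unfolding N'_def by (rule preimage_submodule[OF P1 E h V])
    have zero_V: "(\<zero>\<^bsub>C\<^esub>, \<zero>\<^bsub>?RJ\<^esub>) \<in> ?V" using submodule_zero[OF E V] by (simp add: module_sum_simps)
    have h_ext: "?h (ext a s) = (\<gamma> a, ?q s)" if "a \<in> carrier ?P" for a s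
    proof -
      have "(\<lambda>j\<in>{..<m}. ext a s j) = a"
        by (rule power_module_eqI[OF _ that]) (use that in \<open>auto simp: power_module_carrier_iff ext_simps\<close>)
      then show ?thesis by (simp only: ext_last)
    qed
    have J0: "\<zero>\<^bsub>R\<^esub> \<in> ?J" using additive_subgroup.zero_closed[OF ideal.axioms(1)[OF J]] .
    have ext_N': "ext a s \<in> N'" if "a \<in> carrier ?P" "s \<in> carrier R" "(\<gamma> a, ?q s) \<in> ?V" for a s
      unfolding N'_def by (rule CollectI, rule conjI[OF ext[OF that(1,2)]], subst h_ext[OF that(1)], rule that(3))
    have ext_N: "ext a \<zero>\<^bsub>R\<^esub> \<in> N'" if "a \<in> N" for a
      by (rule ext_N'[OF submodule_carrier[OF P N that]]) (use \<gamma>N[OF that] q0[OF J0] zero_V in simp_all)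
    have "?v = \<one>\<^bsub>R\<^esub> \<odot>\<^bsub>?E\<^esub> ?v" using E.smult_one[OF v] by simp
    then have v_V: "?v \<in> ?V" by blast
    have ext_t: "ext ?t x \<in> N'" by (rule ext_N'[OF t xR v_V])
    have ext_x: "ext \<zero>\<^bsub>?P\<^esub> (xs ! l) \<in> N'" if l: "l < ?k" for l
    proof -
      have "xs ! l \<in> ?J" using R.genideal_self[OF xsR] l by auto
      then show ?thesis
        by (intro ext_N'[OF submodule_carrier[OF P N submodule_zero[OF P N]] xlR[OF l]])
          (use \<gamma>N[OF submodule_zero[OF P N]] q0 zero_V in simp)
    qed
    let ?L1 = "map (\<lambda>(a, y). (ext a \<zero>\<^bsub>R\<^esub>, y)) L'"
    let ?L3 = "map (\<lambda>l. (ext \<zero>\<^bsub>?P\<^esub> (xs ! l), us ! l)) [0..<?k]"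
    let ?L = "?L1 @ (ext ?t x, u) # ?L3"
    have L1: "set ?L1 \<subseteq> N' \<times> carrier M" using L' ext_N by auto
    have L3: "set ?L3 \<subseteq> N' \<times> carrier M" using ext_x ulM by auto
    have L2: "set ((ext ?t x, u) # ?L3) \<subseteq> N' \<times> carrier M" using L3 ext_t u by simp
    have N'R: "a j \<in> carrier R" if "a \<in> N'" "j < Suc m" for a j
      using submodule_carrier[OF P1 N' that(1)] that(2) by (simp add: power_module_carrier_iff)
    have L1_coord: "tensor_coord M j ?L1 = (if j < m then tensor_coord M j L' else \<zero>\<^bsub>M\<^esub>)" if "j < Suc m" for j
      using L' that by (induction L') (auto simp: ext_def)
    have L3_coord: "tensor_coord M j ?L3 = (\<Oplus>\<^bsub>M\<^esub> l \<in> {..<?k}. ext \<zero>\<^bsub>?P\<^esub> (xs ! l) j \<odot>\<^bsub>M\<^esub> us ! l)" if "j < Suc m" for j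
      by (rule tensor_coord_upt[OF M]) (use N'R[OF ext_x that] ulM in auto)
    have "ext b \<zero>\<^bsub>R\<^esub> \<in> closure_in R cl ?P1 N'"
    proof (rule linearly_phantomD[OF ph N'])
      show "ext b \<zero>\<^bsub>R\<^esub> \<in> carrier ?P1" by (rule ext[OF b]) simp
      show "set ?L \<subseteq> N' \<times> carrier M" using L1 L2 by simp
      fix j assume j: "j < Suc m"
      have split: "tensor_coord M j ?L = tensor_coord M j ?L1 \<oplus>\<^bsub>M\<^esub> (ext ?t x j \<odot>\<^bsub>M\<^esub> u \<oplus>\<^bsub>M\<^esub> tensor_coord M j ?L3)"
        using tensor_coord_append[OF M L1 L2, of j] N'R j by simp
      show "tensor_coord M j ?L = ext b \<zero>\<^bsub>R\<^esub> j \<odot>\<^bsub>M\<^esub> e"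
      proof (cases "j < m")
        case True
        have "tensor_coord M j ?L3 = (\<Oplus>\<^bsub>M\<^esub> l \<in> {..<?k}. \<zero>\<^bsub>M\<^esub>)"
          unfolding L3_coord[OF j] using True ulM
          by (intro M.M.finsum_cong') (auto simp: ext_simps power_module_simps(2))
        then have "tensor_coord M j ?L3 = \<zero>\<^bsub>M\<^esub>" by simp
        then have "tensor_coord M j ?L = tensor_coord M j L' \<ominus>\<^bsub>M\<^esub> \<tau> j \<odot>\<^bsub>M\<^esub> u"
          using split L1_coord[OF j] True \<tau>[OF True] u by (simp add: ext_simps M.smult_l_minus a_minus_def)
        also have "\<dots> = b j \<odot>\<^bsub>M\<^esub> e"
          using tcM[OF True] bR[OF True] e
          unfolding \<tau>u[OF True, symmetric] a_minus_def
          by (simp add: M.M.minus_add M.M.a_assoc[symmetric] M.M.r_neg)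
        finally show ?thesis using True by (simp add: ext_simps)
      next
        case False
        then have jm: "j = m" using j by simp
        have "tensor_coord M j ?L3 = (\<Oplus>\<^bsub>M\<^esub> i \<in> {..<?k}. (xs ! i) \<odot>\<^bsub>M\<^esub> (us ! i))"
          using L3_coord[OF j] by (simp only: jm ext_last)
        moreover have "(\<Oplus>\<^bsub>M\<^esub> i \<in> {..<?k}. (xs ! i) \<odot>\<^bsub>M\<^esub> (us ! i)) \<in> carrier M"
          using xlR ulM by (intro M.M.finsum_closed) auto
        ultimately have "tensor_coord M j ?L = \<zero>\<^bsub>M\<^esub>"
          using split L1_coord[OF j] False rel_sum xR u by (simp add: jm ext_last M.M.a_comm)
        then show ?thesis using e by (simp add: jm ext_last)
      qed
    qed
    obtain hE :: "'u set \<times> 'a set \<Rightarrow> 'u" where hE: "inj_on hE (carrier ?E)"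
    proof -
      have "inj_on gR (carrier ?RM)" using gR by (simp add: ring_module_def)
      then obtain hRJ :: "'a set \<Rightarrow> 'u" where "inj_on hRJ (carrier ?RJ)"
        using embedding_of_image[of gR "carrier ?RM" ?q] unfolding quotient_surj[OF RM Jsub] by blast
      then show thesis using prod_embed[OF inf hC] that unfolding module_sum_simps(1) by metis
    qed
    have "?h (ext b \<zero>\<^bsub>R\<^esub>) \<in> closure_in R cl ?E (?h ` N')"
      by (rule closure_in_hom[OF P1 E h N' _ hE]) fact
    moreover have "?h ` N' \<subseteq> ?V" by (auto simp: N'_def)
    ultimately have "?h (ext b \<zero>\<^bsub>R\<^esub>) \<in> closure_in R cl ?E ?V"
      using subsetD[OF closure_in_mono[OF E image_submodule[OF P1 E h N'] V]] by blast
    then have in_V: "(\<gamma> b, \<zero>\<^bsub>?RJ\<^esub>) \<in> closure_in R cl ?E ?V" by (simp only: h_ext[OF b] q0[OF J0])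
    have C_zero: "\<zero>\<^bsub>C\<^esub> \<in> carrier C" and RJ_zero: "\<zero>\<^bsub>?RJ\<^esub> \<in> carrier ?RJ"
      using submodule_zero[OF C module.carrier_is_submodule[OF C]]
        submodule_zero[OF RJ module.carrier_is_submodule[OF RJ]] .
    have snd_hom: "snd \<in> module_homs R ?E ?RJ" and fst_hom: "fst \<in> module_homs R ?E C"
      by (rule module_homsI; auto simp: module_sum_simps)+
    have "(\<gamma> b, \<zero>\<^bsub>?RJ\<^esub>) \<in> closure_in R cl ?E {a \<odot>\<^bsub>?E\<^esub> ?v | a. a \<in> ?J}"
    proof (rule closure_in_colon[OF sop E hE refl refl snd_hom _ v _ _ in_V])
      show "snd ` carrier ?E = carrier ?RJ" using C_zero by (force simp: module_sum_simps)
      show "?J \<subseteq> carrier R" using ideal.Icarr[OF J] by blast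
    qed simp_all
    moreover have "a \<odot>\<^bsub>?E\<^esub> ?v = \<zero>\<^bsub>?E\<^esub>" if a: "a \<in> ?J" for a
    proof -
      have aR: "a \<in> carrier R" using ideal.Icarr[OF J a] .
      have "a \<odot>\<^bsub>C\<^esub> \<gamma> ?t = \<zero>\<^bsub>C\<^esub>" using module_homs_smult[OF \<gamma> aR t] \<gamma>N[OF Jt[OF a]] by simp
      moreover have "a \<odot>\<^bsub>?RJ\<^esub> ?q x = \<zero>\<^bsub>?RJ\<^esub>"
        using module_homs_smult[OF RJ_hom aR xRM] q0[OF ideal.I_r_closed[OF J a xR]] by (simp add: ring_module_def)
      ultimately show ?thesis by (simp add: module_sum_simps)
    qed
    then have "{a \<odot>\<^bsub>?E\<^esub> ?v | a. a \<in> ?J} = {\<zero>\<^bsub>?E\<^esub>}" by (rule constant_family[OF _ J0])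
    ultimately have "(\<gamma> b, \<zero>\<^bsub>?RJ\<^esub>) \<in> closure_in R cl ?E {\<zero>\<^bsub>?E\<^esub>}" by simp
    from closure_in_hom[OF E C fst_hom zero_submodule[OF E] this hC]
    have "\<gamma> b = \<zero>\<^bsub>C\<^esub>" using C0 by (simp add: module_sum_simps)
    then show "b \<in> closure_in R cl ?P N" by (rule \<gamma>_ker[OF b])
  qed
qed

end

section \<open>Spans\<close>

text \<open>An inductive form of the generated submodule: induction over it is induction over
  finite linear combinations.\<close>

inductive_set lspan :: "'a ring \<Rightarrow> ('a, 'b) module \<Rightarrow> 'b set \<Rightarrow> 'b set" for R M X where
  zero: "\<zero>\<^bsub>M\<^esub> \<in> lspan R M X"
| step: "y \<in> lspan R M X \<Longrightarrow> a \<in> carrier R \<Longrightarrow> x \<in> X \<Longrightarrow> y \<oplus>\<^bsub>M\<^esub> a \<odot>\<^bsub>M\<^esub> x \<in> lspan R M X"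

lemma lspan_mono:
  assumes "X \<subseteq> Y"
  shows "lspan R M X \<subseteq> lspan R M Y"
proof
  fix y assume "y \<in> lspan R M X"
  then show "y \<in> lspan R M Y" by induction (use assms in \<open>auto intro: lspan.intros\<close>)
qed

lemma lspan_least:
  assumes "module R M" "submodule H R M" "X \<subseteq> H"
  shows "lspan R M X \<subseteq> H"
proof
  fix y assume "y \<in> lspan R M X"
  then show "y \<in> H"
    by induction (use assms submodule_zero[OF assms(1,2)] submodule_add[OF assms(1,2)]
        submodule_smult[OF assms(1,2)] in auto)
qed

lemma lspan_submodule:
  assumes M: "module R M" and X: "X \<subseteq> carrier M"
  shows "submodule (lspan R M X) R M"
proof (rule submoduleI_smult[OF M])
  interpret M: module R M by (rule M)
  show sub: "lspan R M X \<subseteq> carrier M"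
    by (rule lspan_least[OF M M.carrier_is_submodule X])
  show "\<zero>\<^bsub>M\<^esub> \<in> lspan R M X" by (rule lspan.zero)
  show "x \<oplus>\<^bsub>M\<^esub> y \<in> lspan R M X" if x: "x \<in> lspan R M X" and y: "y \<in> lspan R M X" for x y
    using y
  proof induction
    case zero
    then show ?case using x subsetD[OF sub x] by simp
  next
    case (step y a z)
    have "x \<oplus>\<^bsub>M\<^esub> (y \<oplus>\<^bsub>M\<^esub> a \<odot>\<^bsub>M\<^esub> z) = (x \<oplus>\<^bsub>M\<^esub> y) \<oplus>\<^bsub>M\<^esub> a \<odot>\<^bsub>M\<^esub> z"
      using subsetD[OF sub x] subsetD[OF sub step(1)] subsetD[OF X step(3)] step(2) by (simp add: M.M.a_assoc)
    then show ?case using lspan.step[OF step.IH step(2,3)] by simp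
  qed
  show "a \<odot>\<^bsub>M\<^esub> x \<in> lspan R M X" if a: "a \<in> carrier R" and x: "x \<in> lspan R M X" for a x
    using x
  proof induction
    case zero
    then show ?case using a by (simp add: lspan.zero)
  next
    case (step y b z)
    have "a \<odot>\<^bsub>M\<^esub> (y \<oplus>\<^bsub>M\<^esub> b \<odot>\<^bsub>M\<^esub> z) = a \<odot>\<^bsub>M\<^esub> y \<oplus>\<^bsub>M\<^esub> (a \<otimes>\<^bsub>R\<^esub> b) \<odot>\<^bsub>M\<^esub> z"
      using a subsetD[OF sub step(1)] subsetD[OF X step(3)] step(2) by (simp add: M.smult_r_distr M.smult_assoc1)
    then show ?case using lspan.step[OF step.IH _ step(3)] a step(2) by simp
  qed
qed

lemma lspan_superset:
  assumes "module R M" "X \<subseteq> carrier M"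
  shows "X \<subseteq> lspan R M X"
proof
  interpret M: module R M by fact
  fix x assume x: "x \<in> X"
  have "\<zero>\<^bsub>M\<^esub> \<oplus>\<^bsub>M\<^esub> \<one>\<^bsub>R\<^esub> \<odot>\<^bsub>M\<^esub> x \<in> lspan R M X" by (rule lspan.step[OF lspan.zero _ x]) simp
  then show "x \<in> lspan R M X" using x assms(2) by auto
qed

lemma lspan_insert:
  assumes M: "module R M" and X: "insert x X \<subseteq> carrier M" and y: "y \<in> lspan R M (insert x X)"
  shows "\<exists>z\<in>lspan R M X. \<exists>a\<in>carrier R. y = z \<oplus>\<^bsub>M\<^esub> a \<odot>\<^bsub>M\<^esub> x"
  using y
proof induction
  interpret M: module R M by (rule M)
  case zero
  show ?case using X by (intro bexI[OF _ lspan.zero] bexI[of _ "\<zero>\<^bsub>R\<^esub>"]) simp_all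
next
  interpret M: module R M by (rule M)
  case (step y b w)
  have sub: "lspan R M X \<subseteq> carrier M" by (rule submodule_subset[OF M lspan_submodule[OF M]]) (use X in blast)
  have xM: "x \<in> carrier M" using X by blast
  obtain z a where z: "z \<in> lspan R M X" "a \<in> carrier R" "y = z \<oplus>\<^bsub>M\<^esub> a \<odot>\<^bsub>M\<^esub> x" using step.IH by blast
  have zM: "z \<in> carrier M" using sub z(1) by blast
  show ?case
  proof (cases "w = x")
    case True
    have "y \<oplus>\<^bsub>M\<^esub> b \<odot>\<^bsub>M\<^esub> w = z \<oplus>\<^bsub>M\<^esub> (a \<oplus>\<^bsub>R\<^esub> b) \<odot>\<^bsub>M\<^esub> x"
      using z(2) zM step(2) xM by (simp add: True z(3) M.smult_l_distr M.M.a_assoc)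
    then show ?thesis using z step(2) by blast
  next
    case False
    then have w: "w \<in> X" "w \<in> carrier M" using step(3) X by auto
    have "y \<oplus>\<^bsub>M\<^esub> b \<odot>\<^bsub>M\<^esub> w = (z \<oplus>\<^bsub>M\<^esub> b \<odot>\<^bsub>M\<^esub> w) \<oplus>\<^bsub>M\<^esub> a \<odot>\<^bsub>M\<^esub> x"
      using z(2) zM step(2) xM w by (simp add: z(3) M.M.a_ac)
    moreover have "z \<oplus>\<^bsub>M\<^esub> b \<odot>\<^bsub>M\<^esub> w \<in> lspan R M X" by (rule lspan.step[OF z(1) step(2) w(1)])
    ultimately show ?thesis using z(2) by blast
  qed
qed

section \<open>Towers of modifications\<close>

text \<open>All terms of the sequence are presented inside one module: \<open>M\<close> plus the free module on
  symbols \<open>(i, l)\<close>, where the symbols with first component \<open>i\<close> are the free generators added by the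
  modification at stage \<open>i\<close>. The data of that modification are \<open>(xs, x, us, u)\<close>, with \<open>us\<close> and \<open>u\<close>
  given by representatives. For a set \<open>S\<close> of stages, \<open>stage_rels S\<close> is the module of the
  relations imposed at the stages in \<open>S\<close>; these relations lie in \<open>stage S\<close>, where only the generators
  added by \<open>S\<close> occur. The term at stage \<open>j\<close> is the quotient
  for \<open>S = underS r j\<close>. In this form limits are unions, and the only recursion
  left is the choice of the data.\<close>

type_synonym ('a, 'b, 'i) ambient = "'b \<times> ('i \<times> nat \<Rightarrow> 'a)"
type_synonym ('a, 'b, 'i) mod_data =
  "'a list \<times> 'a \<times> ('a, 'b, 'i) ambient list \<times> ('a, 'b, 'i) ambient"

definition ambient_module :: "'a ring \<Rightarrow> ('a, 'b) module \<Rightarrow> ('a, ('a, 'b, 'i) ambient) module" where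
  "ambient_module R M = module_sum M (finsupp_module R UNIV)"

definition stage_gens :: "('i \<Rightarrow> ('a, 'b, 'i) mod_data) \<Rightarrow> 'i set \<Rightarrow> ('i \<times> nat) set" where
  "stage_gens D S = {(i, l). i \<in> S \<and> l < length (fst (D i))}"

definition stage :: "'a ring \<Rightarrow> ('a, 'b) module \<Rightarrow> ('i \<Rightarrow> ('a, 'b, 'i) mod_data) \<Rightarrow> 'i set
    \<Rightarrow> ('a, ('a, 'b, 'i) ambient) module" where
  "stage R M D S = module_sum M (finsupp_module R (stage_gens D S))"

text \<open>If \<open>p\<close> has zero coefficients at the symbols \<open>(i, l)\<close>, this is
  \<open>p + z\<^sub>0 (i, 0) + \<dots> + z\<^sub>k\<^sub>-\<^sub>1 (i, k - 1)\<close>.\<close>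

definition adjoin :: "'i \<Rightarrow> nat \<Rightarrow> ('a, 'b, 'i) ambient \<Rightarrow> (nat \<Rightarrow> 'a) \<Rightarrow> ('a, 'b, 'i) ambient" where
  "adjoin i k p z = (fst p, \<lambda>(j, l). if j = i \<and> l < k then z l else snd p (j, l))"

definition stage_vector :: "('i \<Rightarrow> ('a, 'b, 'i) mod_data) \<Rightarrow> 'i \<Rightarrow> ('a, 'b, 'i) ambient" where
  "stage_vector D i = (case D i of (xs, x, us, u) \<Rightarrow> adjoin i (length xs) u (\<lambda>l. xs ! l))"

definition stage_rels :: "'a ring \<Rightarrow> ('a, 'b) module \<Rightarrow> ('i \<Rightarrow> ('a, 'b, 'i) mod_data) \<Rightarrow> 'i set
    \<Rightarrow> ('a, 'b, 'i) ambient set" where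
  "stage_rels R M D S = lspan R (ambient_module R M) (stage_vector D ` S)"

definition valid_data :: "'a ring \<Rightarrow> 'a set \<Rightarrow> ('a, 'b) module \<Rightarrow> 'i rel \<Rightarrow> ('i \<Rightarrow> ('a, 'b, 'i) mod_data)
    \<Rightarrow> 'i \<Rightarrow> ('a, 'b, 'i) mod_data \<Rightarrow> bool" where
  "valid_data R \<mm> M r D i t = (case t of (xs, x, us, u) \<Rightarrow>
     partial_sop R \<mm> (xs @ [x]) \<and> length us = length xs \<and>
     set us \<subseteq> carrier (stage R M D (underS r i)) \<and> u \<in> carrier (stage R M D (underS r i)) \<and>
     (\<Oplus>\<^bsub>ambient_module R M\<^esub> l \<in> {..<length xs}. (xs ! l) \<odot>\<^bsub>ambient_module R M\<^esub> (us ! l))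
       \<oplus>\<^bsub>ambient_module R M\<^esub> (x \<odot>\<^bsub>ambient_module R M\<^esub> u) \<in> stage_rels R M D (underS r i))"

text \<open>Whether data can be used at stage \<open>i\<close> depends only on the data used before. This makes
  the choice of the data a well-founded recursion.\<close>

lemma valid_data_cong:
  assumes "\<And>j. j \<in> underS r i \<Longrightarrow> D j = D' j"
  shows "valid_data R \<mm> M r D i t = valid_data R \<mm> M r D' i t"
proof -
  have "stage_gens D (underS r i) = stage_gens D' (underS r i)"
    using assms by (auto simp: stage_gens_def)
  then have 1: "stage R M D (underS r i) = stage R M D' (underS r i)" by (simp add: stage_def)
  have "stage_vector D ` underS r i = stage_vector D' ` underS r i"
    using assms by (intro image_cong) (simp_all add: stage_vector_def)
  then have 2: "stage_rels R M D (underS r i) = stage_rels R M D' (underS r i)"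
    by (simp add: stage_rels_def)
  show ?thesis unfolding valid_data_def 1 2 ..
qed

lemma partial_sop_subset: "partial_sop R \<mm> xs \<Longrightarrow> set xs \<subseteq> \<mm>"
  unfolding partial_sop_def system_of_parameters_def by auto

lemma partial_sop_appendD: "partial_sop R \<mm> (xs @ ys) \<Longrightarrow> partial_sop R \<mm> xs"
  unfolding partial_sop_def by auto

locale modification_tower =
  fixes R :: "'a ring" and \<mm> :: "'a set" and M :: "('a, 'b) module" and r :: "'i rel"
    and D :: "'i \<Rightarrow> ('a, 'b, 'i) mod_data"
  assumes M: "module R M" and well: "Well_order r" and field: "Field r = UNIV"
    and mm: "\<mm> \<subseteq> carrier R" and valid: "\<And>i. valid_data R \<mm> M r D i (D i)"
begin

sublocale M: module R M by (rule M)

abbreviation "A \<equiv> ambient_module R M :: ('a, ('a, 'b, 'i) ambient) module"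
abbreviation "stg \<equiv> stage R M D"
abbreviation "rels \<equiv> stage_rels R M D"
abbreviation "below \<equiv> underS r"

lemma R_cring: "cring R" ..

lemma A_module: "module R A"
  unfolding ambient_module_def by (intro module_sum_is_module M finsupp_module_is_module R_cring)

lemma stage_module: "module R (stg S)"
  unfolding stage_def by (intro module_sum_is_module M finsupp_module_is_module R_cring)

lemma stage_ops:
  "\<zero>\<^bsub>stg S\<^esub> = \<zero>\<^bsub>A\<^esub>" "p \<oplus>\<^bsub>stg S\<^esub> q = p \<oplus>\<^bsub>A\<^esub> q" "a \<odot>\<^bsub>stg S\<^esub> p = a \<odot>\<^bsub>A\<^esub> p"
  by (simp_all add: stage_def ambient_module_def module_sum_def finsupp_module_def)

lemma A_ops:
  "\<zero>\<^bsub>A\<^esub> = (\<zero>\<^bsub>M\<^esub>, \<lambda>_. \<zero>\<^bsub>R\<^esub>)"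
  "p \<oplus>\<^bsub>A\<^esub> q = (fst p \<oplus>\<^bsub>M\<^esub> fst q, \<lambda>i. snd p i \<oplus>\<^bsub>R\<^esub> snd q i)"
  "a \<odot>\<^bsub>A\<^esub> p = (a \<odot>\<^bsub>M\<^esub> fst p, \<lambda>i. a \<otimes>\<^bsub>R\<^esub> snd p i)"
  by (simp_all add: ambient_module_def module_sum_def finsupp_module_def split: prod.split)

lemma stage_carrier_iff:
  "p \<in> carrier (stg S) \<longleftrightarrow> fst p \<in> carrier M \<and> (\<forall>i. snd p i \<in> carrier R) \<and>
     finite {i. snd p i \<noteq> \<zero>\<^bsub>R\<^esub>} \<and> (\<forall>i. i \<notin> stage_gens D S \<longrightarrow> snd p i = \<zero>\<^bsub>R\<^esub>)"
  by (cases p) (simp add: stage_def module_sum_simps(1) finsupp_module_simps(1))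

lemma A_carrier_iff:
  "p \<in> carrier A \<longleftrightarrow> fst p \<in> carrier M \<and> (\<forall>i. snd p i \<in> carrier R) \<and> finite {i. snd p i \<noteq> \<zero>\<^bsub>R\<^esub>}"
  by (cases p) (simp add: ambient_module_def module_sum_simps(1) finsupp_module_simps(1))

lemma stage_carrier_A: "p \<in> carrier (stg S) \<Longrightarrow> p \<in> carrier A"
  by (simp add: stage_carrier_iff A_carrier_iff)

lemma stage_gens_mono: "S \<subseteq> T \<Longrightarrow> stage_gens D S \<subseteq> stage_gens D T"
  by (auto simp: stage_gens_def)

lemma stage_mono: "S \<subseteq> T \<Longrightarrow> p \<in> carrier (stg S) \<Longrightarrow> p \<in> carrier (stg T)"
  using stage_gens_mono unfolding stage_carrier_iff by blast

lemma stage_submodule: "submodule (carrier (stg S)) R A"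
proof (rule submoduleI_smult[OF A_module])
  interpret S: module R "stg S" by (rule stage_module)
  show "carrier (stg S) \<subseteq> carrier A" using stage_carrier_A by blast
  show "\<zero>\<^bsub>A\<^esub> \<in> carrier (stg S)" using S.M.zero_closed by (simp only: stage_ops)
  show "x \<oplus>\<^bsub>A\<^esub> y \<in> carrier (stg S)" if "x \<in> carrier (stg S)" "y \<in> carrier (stg S)" for x y
    using S.M.a_closed[OF that] by (simp only: stage_ops)
  show "a \<odot>\<^bsub>A\<^esub> x \<in> carrier (stg S)" if "a \<in> carrier R" "x \<in> carrier (stg S)" for a x
    using S.smult_closed[OF that] by (simp only: stage_ops)
qed

lemma stage_incl_hom: "(\<lambda>p. p) \<in> module_homs R (stg S) A"
  by (rule module_homsI) (simp_all add: stage_carrier_A stage_ops)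

definition dxs :: "'i \<Rightarrow> 'a list" where "dxs i = fst (D i)"
definition du :: "'i \<Rightarrow> ('a, 'b, 'i) ambient" where "du i = snd (snd (snd (D i)))"

lemma data:
  obtains x us where "D i = (dxs i, x, us, du i)" "partial_sop R \<mm> (dxs i @ [x])"
    "length us = length (dxs i)" "set us \<subseteq> carrier (stg (below i))" "du i \<in> carrier (stg (below i))"
    "(\<Oplus>\<^bsub>A\<^esub> l \<in> {..<length (dxs i)}. (dxs i ! l) \<odot>\<^bsub>A\<^esub> (us ! l)) \<oplus>\<^bsub>A\<^esub> (x \<odot>\<^bsub>A\<^esub> du i) \<in> rels (below i)"
proof -
  obtain xs x us u where D: "D i = (xs, x, us, u)" by (cases "D i")
  then have "xs = dxs i" "u = du i" by (simp_all add: dxs_def du_def)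
  then show thesis using valid[of i] that D unfolding valid_data_def by simp
qed

lemma dxs_R: "set (dxs i) \<subseteq> carrier R"
proof -
  obtain x us where "partial_sop R \<mm> (dxs i @ [x])" using data[of i] by metis
  then show ?thesis using partial_sop_subset mm by fastforce
qed

lemma du_stage: "du i \<in> carrier (stg (below i))" using data[of i] by metis

lemma stage_gens_eq: "stage_gens D S = {(i, l). i \<in> S \<and> l < length (dxs i)}"
  by (simp add: stage_gens_def dxs_def)

lemma stage_vector_eq: "stage_vector D i = adjoin i (length (dxs i)) (du i) (\<lambda>l. dxs i ! l)"
  by (simp add: stage_vector_def dxs_def du_def split: prod.split)

lemma below_irrefl: "i \<notin> below i" by (simp add: underS_def)

lemma below_mono: "(i, j) \<in> r \<Longrightarrow> below i \<subseteq> below j"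
  using underS_incr[of r i j] well unfolding well_order_on_def linear_order_on_def partial_order_on_def preorder_on_def
  by blast

lemma total: "(i, j) \<in> r \<or> (j, i) \<in> r"
  using well field unfolding well_order_on_def linear_order_on_def total_on_def partial_order_on_def
    preorder_on_def refl_on_def by (cases "i = j") auto

lemma r_trans: "trans r" and r_refl: "(i, i) \<in> r" and r_antisym: "antisym r"
  using well field unfolding well_order_on_def linear_order_on_def partial_order_on_def
    preorder_on_def refl_on_def by auto

lemma below_iff: "i \<in> below j \<longleftrightarrow> (j, i) \<notin> r"
  using total r_refl antisymD[OF r_antisym] by (auto simp: underS_def)

text \<open>Initial segments give the terms of the tower, and the set of all stages gives its limit.\<close>

definition closed :: "'i set \<Rightarrow> bool" where "closed S \<longleftrightarrow> (\<forall>i\<in>S. below i \<subseteq> S)"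

lemma closed_below: "closed (below j)"
  unfolding closed_def using below_mono by (auto simp: underS_def)

lemma closed_UNIV: "closed UNIV" by (simp add: closed_def)

lemma adjoin_stage:
  assumes p: "p \<in> carrier (stg (below i))" and z: "\<And>l. l < length (dxs i) \<Longrightarrow> z l \<in> carrier R"
    and iS: "i \<in> S" and sub: "below i \<subseteq> S"
  shows "adjoin i (length (dxs i)) p z \<in> carrier (stg S)"
proof -
  let ?f = "\<lambda>(j, l). if j = i \<and> l < length (dxs i) then z l else snd p (j, l)"
  have "{q. ?f q \<noteq> \<zero>\<^bsub>R\<^esub>} \<subseteq> {q. snd p q \<noteq> \<zero>\<^bsub>R\<^esub>} \<union> {i} \<times> {..<length (dxs i)}"
    by (auto split: if_splits)
  moreover have "finite {q. snd p q \<noteq> \<zero>\<^bsub>R\<^esub>}" using p by (simp add: stage_carrier_iff)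
  ultimately have "finite {q. ?f q \<noteq> \<zero>\<^bsub>R\<^esub>}" by (meson finite_SigmaI finite_Un finite_lessThan finite_subset finite.emptyI finite.insertI)
  moreover have "?f q = \<zero>\<^bsub>R\<^esub>" if q: "q \<notin> stage_gens D S" for q
  proof -
    have "q \<notin> stage_gens D (below i)" using q stage_gens_mono[OF sub] by blast
    then have "snd p q = \<zero>\<^bsub>R\<^esub>" using p unfolding stage_carrier_iff by blast
    then show ?thesis using q iS by (cases q) (auto simp: stage_gens_eq)
  qed
  moreover have "?f q \<in> carrier R" for q using p z by (cases q) (simp add: stage_carrier_iff)
  ultimately show ?thesis using p by (simp add: stage_carrier_iff adjoin_def)
qed

lemma stage_vector_stage: "i \<in> S \<Longrightarrow> below i \<subseteq> S \<Longrightarrow> stage_vector D i \<in> carrier (stg S)"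
  unfolding stage_vector_eq by (rule adjoin_stage[OF du_stage subsetD[OF dxs_R nth_mem]])

lemma vectors_A: "stage_vector D ` S \<subseteq> carrier A"
  using stage_carrier_A stage_vector_stage[of _ UNIV] by blast

lemma rels_submodule: "submodule (rels S) R A"
  unfolding stage_rels_def by (rule lspan_submodule[OF A_module vectors_A])

lemma rels_mono: "S \<subseteq> T \<Longrightarrow> rels S \<subseteq> rels T"
  unfolding stage_rels_def by (intro lspan_mono image_mono)

lemma rels_stage: "closed S \<Longrightarrow> rels S \<subseteq> carrier (stg S)"
  unfolding stage_rels_def using stage_vector_stage
  by (intro lspan_least[OF A_module stage_submodule]) (auto simp: closed_def)

lemma rels_stage_submodule:
  assumes "closed S"
  shows "submodule (rels S) R (stg S)"
  using submoduleI_smult[OF stage_module rels_stage[OF assms]]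
    submodule_zero[OF A_module rels_submodule] submodule_add[OF A_module rels_submodule]
    submodule_smult[OF A_module rels_submodule] by (simp only: stage_ops)

lemma adjoin_add: "adjoin i k p z \<oplus>\<^bsub>A\<^esub> adjoin i k q w = adjoin i k (p \<oplus>\<^bsub>A\<^esub> q) (\<lambda>l. z l \<oplus>\<^bsub>R\<^esub> w l)"
  by (auto simp: adjoin_def A_ops)

lemma adjoin_smult: "a \<odot>\<^bsub>A\<^esub> adjoin i k p z = adjoin i k (a \<odot>\<^bsub>A\<^esub> p) (\<lambda>l. a \<otimes>\<^bsub>R\<^esub> z l)"
  by (auto simp: adjoin_def A_ops)

lemma adjoin_cong: "(\<And>l. l < k \<Longrightarrow> z l = w l) \<Longrightarrow> adjoin i k p z = adjoin i k p w"
  by (auto simp: adjoin_def)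

lemma stage_new_zero: "p \<in> carrier (stg (below i)) \<Longrightarrow> snd p (i, l) = \<zero>\<^bsub>R\<^esub>"
  using below_irrefl by (simp add: stage_carrier_iff stage_gens_eq)

lemma adjoin_zero: "p \<in> carrier (stg (below i)) \<Longrightarrow> adjoin i k p (\<lambda>_. \<zero>\<^bsub>R\<^esub>) = p"
  using stage_new_zero[of p i] by (cases p) (auto simp: adjoin_def fun_eq_iff)

lemma adjoin_eqD:
  assumes "adjoin i k p z = adjoin i k q w" "p \<in> carrier (stg (below i))" "q \<in> carrier (stg (below i))"
  shows "p = q" and "l < k \<Longrightarrow> z l = w l"
proof -
  have f: "fst p = fst q" and s: "(\<lambda>(j, l). if j = i \<and> l < k then z l else snd p (j, l))
      = (\<lambda>(j, l). if j = i \<and> l < k then w l else snd q (j, l))"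
    using assms(1) by (simp_all add: adjoin_def)
  have s: "(if j = i \<and> l < k then z l else snd p (j, l)) = (if j = i \<and> l < k then w l else snd q (j, l))" for j l
    using fun_cong[OF s, of "(j, l)"] by simp
  have "snd p (j, l) = snd q (j, l)" for j l
    using s[of j l] stage_new_zero[OF assms(2), of l] stage_new_zero[OF assms(3), of l] by (cases "j = i") auto
  then show "p = q" using f by (metis ext prod.exhaust_sel surj_pair)
  show "z l = w l" if "l < k" using s[of i l] that by simp
qed

lemma finite_subset_below:
  assumes lim: "\<And>i. i \<in> S \<Longrightarrow> \<exists>k\<in>S. i \<in> below k" and "S \<noteq> {}" and fin: "finite T" and "T \<subseteq> S"
  shows "\<exists>k\<in>S. T \<subseteq> below k"
  using fin \<open>T \<subseteq> S\<close>
proof induction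
  case empty
  then show ?case using \<open>S \<noteq> {}\<close> by blast
next
  case (insert t T)
  then obtain k k' where k: "k \<in> S" "T \<subseteq> below k" "k' \<in> S" "t \<in> below k'" using lim by blast
  then show ?case using total[of k k'] below_mono by blast
qed

text \<open>An element of a limit stage has finite support, and a relation at a limit stage is a
  finite combination. So both occur at an earlier stage.\<close>

lemma stage_limit:
  assumes lim: "\<And>i. i \<in> S \<Longrightarrow> \<exists>k\<in>S. i \<in> below k" and ne: "S \<noteq> {}" and p: "p \<in> carrier (stg S)"
  shows "\<exists>k\<in>S. p \<in> carrier (stg (below k))"
proof -
  let ?T = "fst ` {q. snd p q \<noteq> \<zero>\<^bsub>R\<^esub>}"
  have supp: "q \<in> stage_gens D S" if "snd p q \<noteq> \<zero>\<^bsub>R\<^esub>" for q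
    using p that unfolding stage_carrier_iff by blast
  have "finite ?T" using p by (simp add: stage_carrier_iff)
  moreover have "?T \<subseteq> S" using supp by (auto simp: stage_gens_eq)
  ultimately obtain k where k: "k \<in> S" "?T \<subseteq> below k" using finite_subset_below[OF lim ne] by blast
  have "snd p q = \<zero>\<^bsub>R\<^esub>" if "q \<notin> stage_gens D (below k)" for q
  proof (rule ccontr)
    assume nz: "snd p q \<noteq> \<zero>\<^bsub>R\<^esub>"
    then have "fst q \<in> below k" using k(2) by blast
    moreover have "q \<in> stage_gens D S" by (rule supp[OF nz])
    ultimately show False using that by (cases q) (auto simp: stage_gens_eq)
  qed
  then have "p \<in> carrier (stg (below k))" using p unfolding stage_carrier_iff by blast
  then show ?thesis using k(1) by blast
qed

lemma rels_limit:
  assumes lim: "\<And>i. i \<in> S \<Longrightarrow> \<exists>k\<in>S. i \<in> below k" and ne: "S \<noteq> {}" and p: "p \<in> rels S"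
  shows "\<exists>k\<in>S. p \<in> rels (below k)"
  using p unfolding stage_rels_def
proof induction
  case zero
  then show ?case using ne lspan.zero by blast
next
  case (step y a x)
  then obtain k where k: "k \<in> S" "y \<in> rels (below k)" unfolding stage_rels_def by blast
  obtain i where i: "i \<in> S" "x = stage_vector D i" using step(3) by blast
  then obtain k' where k': "k' \<in> S" "i \<in> below k'" using lim by blast
  obtain m where m: "m \<in> S" "below k \<subseteq> below m" "below k' \<subseteq> below m"
    using total[of k k'] below_mono k(1) k'(1) by blast
  have "y \<in> rels (below m)" using rels_mono[OF m(2)] k(2) by blast
  then have "y \<oplus>\<^bsub>A\<^esub> a \<odot>\<^bsub>A\<^esub> x \<in> rels (below m)"
    unfolding stage_rels_def by (rule lspan.step[OF _ step(2)]) (use i(2) m(3) k'(2) in blast)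
  then show ?case using m(1) unfolding stage_rels_def by blast
qed

end

locale realised_tower = modification_tower R \<mm> M r D
  for R :: "'a ring" and \<mm> :: "'a set" and M :: "('a, 'b) module" and r :: "'i rel"
    and D :: "'i \<Rightarrow> ('a, 'b, 'i) mod_data" +
  fixes emb :: "('a, 'b, 'i) ambient \<Rightarrow> 'b"
  assumes emb: "inj_on emb (carrier (ambient_module R M))"
begin

text \<open>\<open>(N, \<pi>)\<close> presents \<open>N\<close> as the quotient of \<open>stage S\<close> by the relations. The first term
  of a modification sequence has to be \<open>M\<close> itself and not a copy of it.\<close>

definition realises :: "'i set \<Rightarrow> ('a, 'b) module \<Rightarrow> (('a, 'b, 'i) ambient \<Rightarrow> 'b) \<Rightarrow> bool" where
  "realises S N \<pi> \<longleftrightarrow> module R N \<and> \<pi> \<in> module_homs R (stg S) N \<and> \<pi> ` carrier (stg S) = carrier N \<and>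
     (\<forall>p\<in>carrier (stg S). \<pi> p = \<zero>\<^bsub>N\<^esub> \<longleftrightarrow> p \<in> rels S) \<and>
     (S = {} \<longrightarrow> N = M \<and> (\<forall>p. \<pi> p = fst p))"

lemma ex_realises:
  assumes S: "closed S"
  shows "\<exists>N\<pi>. realises S (fst N\<pi>) (snd N\<pi>)"
proof (cases "S = {}")
  case True
  have "rels {} = {\<zero>\<^bsub>A\<^esub>}"
  proof
    show "rels {} \<subseteq> {\<zero>\<^bsub>A\<^esub>}"
      unfolding stage_rels_def by (rule lspan_least[OF A_module zero_submodule[OF A_module]]) simp
  qed (simp add: stage_rels_def lspan.zero)
  moreover have carrier: "\<And>p. p \<in> carrier (stg {}) \<longleftrightarrow> fst p \<in> carrier M \<and> snd p = (\<lambda>_. \<zero>\<^bsub>R\<^esub>)"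
  proof
    fix p assume p: "p \<in> carrier (stg {})"
    have "q \<notin> stage_gens D {}" for q by (auto simp: stage_gens_def)
    then have "snd p q = \<zero>\<^bsub>R\<^esub>" for q using p unfolding stage_carrier_iff by blast
    then show "fst p \<in> carrier M \<and> snd p = (\<lambda>_. \<zero>\<^bsub>R\<^esub>)" using p unfolding stage_carrier_iff by blast
  qed (simp add: stage_carrier_iff)
  moreover have "\<exists>p\<in>carrier (stg {}). x = fst p" if "x \<in> carrier M" for x
    using that carrier[of "(x, \<lambda>_. \<zero>\<^bsub>R\<^esub>)"] by force
  ultimately have "realises {} M fst"
    unfolding realises_def
    by (intro conjI impI ballI M module_homsI) (auto simp: stage_ops A_ops prod_eq_iff image_iff)
  then show ?thesis using True by (intro exI[of _ "(M, fst)"]) simp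
next
  case False
  have "inj_on emb (carrier (stg S))"
    by (rule inj_on_subset[OF emb]) (use stage_carrier_A in blast)
  then obtain N :: "('a, 'b) module" and \<pi> where "module R N" "\<pi> \<in> module_homs R (stg S) N"
    "\<pi> ` carrier (stg S) = carrier N" "\<And>p. p \<in> carrier (stg S) \<Longrightarrow> \<pi> p = \<zero>\<^bsub>N\<^esub> \<longleftrightarrow> p \<in> rels S"
    using quotient_copy[OF stage_module rels_stage_submodule[OF S]] by blast
  then have "realises S N \<pi>" using False unfolding realises_def by blast
  then show ?thesis by (intro exI[of _ "(N, \<pi>)"]) simp
qed

definition realisation where "realisation S = (SOME N\<pi>. realises S (fst N\<pi>) (snd N\<pi>))"
definition tower where "tower S = fst (realisation S)"
definition proj where "proj S = snd (realisation S)"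
definition trans_map where "trans_map S T n = proj T (inv_into (carrier (stg S)) (proj S) n)"

lemma realises: "closed S \<Longrightarrow> realises S (tower S) (proj S)"
  unfolding tower_def proj_def realisation_def by (rule someI_ex[OF ex_realises])

lemma tower_module: "closed S \<Longrightarrow> module R (tower S)"
  and proj_hom: "closed S \<Longrightarrow> proj S \<in> module_homs R (stg S) (tower S)"
  and proj_surj: "closed S \<Longrightarrow> proj S ` carrier (stg S) = carrier (tower S)"
  and proj_zero_iff: "closed S \<Longrightarrow> p \<in> carrier (stg S) \<Longrightarrow> proj S p = \<zero>\<^bsub>tower S\<^esub> \<longleftrightarrow> p \<in> rels S"
  using realises[of S] unfolding realises_def by blast+

lemma tower_empty: "tower {} = M" and proj_empty: "proj {} p = fst p"
  using realises[of "{}"] unfolding realises_def closed_def by blast+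

lemma tower_cases:
  assumes "closed S" "n \<in> carrier (tower S)"
  obtains p where "p \<in> carrier (stg S)" "n = proj S p"
  using assms(2) unfolding proj_surj[OF assms(1), symmetric] by blast

lemma stage_incl_hom_mono: "S \<subseteq> T \<Longrightarrow> (\<lambda>p. p) \<in> module_homs R (stg S) (stg T)"
  by (rule module_homsI) (simp_all add: stage_mono stage_ops)

text \<open>The choice of a preimage in the definition does not matter, because the relations
  of \<open>S\<close> are relations of \<open>T\<close>.\<close>

lemma trans_map_proj:
  assumes S: "closed S" and T: "closed T" and sub: "S \<subseteq> T" and p: "p \<in> carrier (stg S)"
  shows "trans_map S T (proj S p) = proj T p"
proof -
  interpret stS: module R "stg S" by (rule stage_module)
  let ?p = "inv_into (carrier (stg S)) (proj S) (proj S p)"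
  have p': "?p \<in> carrier (stg S)" "proj S ?p = proj S p"
    using p by (auto intro: inv_into_into f_inv_into_f)
  let ?d = "?p \<ominus>\<^bsub>stg S\<^esub> p"
  have d: "?d \<in> carrier (stg S)" using p p' by simp
  have "proj S ?d = \<zero>\<^bsub>tower S\<^esub>"
    using module_homs_eq_iff[OF stage_module tower_module[OF S] proj_hom[OF S] p'(1) p] p'(2) by simp
  then have "?d \<in> rels T" using proj_zero_iff[OF S d] rels_mono[OF sub] by blast
  then have "proj T ?d = \<zero>\<^bsub>tower T\<^esub>" using proj_zero_iff[OF T stage_mono[OF sub d]] by simp
  moreover have "(\<lambda>p. proj T p) \<in> module_homs R (stg S) (tower T)"
    using module_homs_comp[OF stage_incl_hom_mono[OF sub] proj_hom[OF T]] .
  ultimately show ?thesis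
    using module_homs_eq_iff[OF stage_module tower_module[OF T] _ p'(1) p, of "proj T"]
    unfolding trans_map_def by simp
qed

lemma trans_map_hom:
  assumes S: "closed S" and T: "closed T" and sub: "S \<subseteq> T"
  shows "trans_map S T \<in> module_homs R (tower S) (tower T)"
proof -
  interpret stS: module R "stg S" by (rule stage_module)
  note eq = trans_map_proj[OF assms]
  have T': "proj T \<in> module_homs R (stg S) (tower T)"
    using module_homs_comp[OF stage_incl_hom_mono[OF sub] proj_hom[OF T]] .
  note S' = proj_hom[OF S]
  show ?thesis
  proof (rule module_homsI)
    fix n assume "n \<in> carrier (tower S)"
    then obtain p where p: "p \<in> carrier (stg S)" "n = proj S p" by (rule tower_cases[OF S])
    show "trans_map S T n \<in> carrier (tower T)" using p eq module_homs_closed[OF T'] by simp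
    show "trans_map S T (a \<odot>\<^bsub>tower S\<^esub> n) = a \<odot>\<^bsub>tower T\<^esub> trans_map S T n" if "a \<in> carrier R" for a
      using p eq module_homs_smult[OF T' that] module_homs_smult[OF S' that, symmetric] that by simp
    fix n' assume "n' \<in> carrier (tower S)"
    then obtain p' where "p' \<in> carrier (stg S)" "n' = proj S p'" by (rule tower_cases[OF S])
    then show "trans_map S T (n \<oplus>\<^bsub>tower S\<^esub> n') = trans_map S T n \<oplus>\<^bsub>tower T\<^esub> trans_map S T n'"
      using p eq module_homs_add[OF T'] module_homs_add[OF S', symmetric] by simp
  qed
qed

abbreviation "term_at j \<equiv> tower (below j)"
abbreviation "step_map i j \<equiv> trans_map (below i) (below j)"

lemma tower_direct_system: "direct_system R I r term_at step_map"
  unfolding direct_system_def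
proof (intro conjI ballI impI)
  fix i
  show "module R (term_at i)" by (rule tower_module[OF closed_below])
  fix x assume x: "x \<in> carrier (term_at i)"
  obtain p where p: "p \<in> carrier (stg (below i))" "x = proj (below i) p" by (rule tower_cases[OF closed_below x])
  show "step_map i i x = x" using trans_map_proj[OF closed_below closed_below subset_refl p(1)] p(2) by simp
next
  fix i j assume "(i, j) \<in> r"
  then show "step_map i j \<in> module_homs R (term_at i) (term_at j)"
    by (rule trans_map_hom[OF closed_below closed_below below_mono])
next
  fix i j k x assume ij: "(i, j) \<in> r \<and> (j, k) \<in> r" and x: "x \<in> carrier (term_at i)"
  obtain p where p: "p \<in> carrier (stg (below i))" "x = proj (below i) p" by (rule tower_cases[OF closed_below x])
  have sub: "below i \<subseteq> below j" "below j \<subseteq> below k" using ij below_mono by auto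
  show "step_map j k (step_map i j x) = step_map i k x"
    using trans_map_proj[OF closed_below closed_below sub(1) p(1)]
      trans_map_proj[OF closed_below closed_below sub(2) stage_mono[OF sub(1) p(1)]]
      trans_map_proj[OF closed_below closed_below order_trans[OF sub] p(1)] p(2) by simp
qed

lemma tower_directed: "i \<in> I \<Longrightarrow> j \<in> I \<Longrightarrow> \<exists>k\<in>I. (i, k) \<in> r \<and> (j, k) \<in> r"
  using total[of i j] r_refl by blast

lemma tower_limit_cocone:
  assumes S: "closed S" and lim: "\<And>i. i \<in> S \<Longrightarrow> \<exists>k\<in>S. i \<in> below k" and ne: "S \<noteq> {}"
  shows "direct_limit_cocone R S r term_at step_map (tower S) (\<lambda>i. trans_map (below i) S)"
proof -
  have sub: "below i \<subseteq> S" if "i \<in> S" for i using S that unfolding closed_def by blast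
  note eq = trans_map_proj[OF closed_below S sub]
  have surj: "\<exists>i\<in>S. \<exists>x\<in>carrier (term_at i). y = trans_map (below i) S x" if y: "y \<in> carrier (tower S)" for y
  proof -
    obtain p where p: "p \<in> carrier (stg S)" "y = proj S p" by (rule tower_cases[OF S y])
    obtain k where k: "k \<in> S" "p \<in> carrier (stg (below k))" using stage_limit[OF lim ne p(1)] by blast
    have "proj (below k) p \<in> carrier (term_at k)" by (rule module_homs_closed[OF proj_hom[OF closed_below] k(2)])
    then show ?thesis using eq[OF k] p(2) k(1) by metis
  qed
  have comp: "trans_map (below j) S (step_map i j x) = trans_map (below i) S x"
    if "i \<in> S" "j \<in> S" "(i, j) \<in> r" and x: "x \<in> carrier (term_at i)" for i j x
  proof -
    obtain p where p: "p \<in> carrier (stg (below i))" "x = proj (below i) p" by (rule tower_cases[OF closed_below x])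
    note ij = below_mono[OF that(3)]
    show ?thesis
      using eq[OF that(1) p(1)] eq[OF that(2) stage_mono[OF ij p(1)]]
        trans_map_proj[OF closed_below closed_below ij p(1)] p(2) by simp
  qed
  have ker: "\<exists>k\<in>S. (i, k) \<in> r \<and> step_map i k x = \<zero>\<^bsub>term_at k\<^esub>"
    if i: "i \<in> S" and x: "x \<in> carrier (term_at i)" and zero: "trans_map (below i) S x = \<zero>\<^bsub>tower S\<^esub>" for i x
  proof -
    obtain p where p: "p \<in> carrier (stg (below i))" "x = proj (below i) p" by (rule tower_cases[OF closed_below x])
    have "p \<in> rels S"
      using eq[OF i p(1)] zero p(2) proj_zero_iff[OF S stage_mono[OF sub[OF i] p(1)]] by simp
    then obtain k where k: "k \<in> S" "p \<in> rels (below k)" using rels_limit[OF lim ne] by blast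
    obtain l where l: "l \<in> S" "(i, l) \<in> r" "(k, l) \<in> r" using tower_directed[OF i k(1)] by blast
    have "p \<in> rels (below l)" using k(2) rels_mono[OF below_mono[OF l(3)]] by blast
    then have "proj (below l) p = \<zero>\<^bsub>term_at l\<^esub>"
      using proj_zero_iff[OF closed_below stage_mono[OF below_mono[OF l(2)] p(1)]] by simp
    then show ?thesis using trans_map_proj[OF closed_below closed_below below_mono[OF l(2)] p(1)] p(2) l(1,2) by auto
  qed
  show ?thesis
    unfolding direct_limit_cocone_def
    using tower_module[OF S] trans_map_hom[OF closed_below S sub] comp surj ker by blast
qed

text \<open>One step of the tower. An element of \<open>stage (below j)\<close> is a \<open>p\<close> in \<open>stage (below i)\<close> with
  coefficients \<open>z\<close> on the new generators adjoined. It is a relation iff it is the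
  sum of an old relation and a multiple of the new one, that is, iff \<open>(p, z)\<close> is
  a multiple of \<open>(u, xs)\<close> modulo the old relations.\<close>

lemma tower_step:
  assumes bj: "below j = insert i (below i)"
  obtains g x us where
    "modification_relation_holds R \<mm> (term_at i) (dxs i) x us (proj (below i) (du i))"
    "presents_modification R (term_at i) (dxs i) (proj (below i) (du i)) (term_at j) g"
    "\<forall>p\<in>carrier (stg (below i)). g (proj (below i) p, \<zero>\<^bsub>power_module R (length (dxs i))\<^esub>) = proj (below j) p"
proof -
  let ?k = "length (dxs i)"
  let ?P = "power_module R ?k"
  let ?S = "stg (below i)"
  let ?N = "term_at i" and ?N' = "term_at j"
  let ?\<pi> = "proj (below i)" and ?\<pi>' = "proj (below j)"
  let ?X = "module_sum ?S ?P" and ?Y = "module_sum ?N ?P"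
  have P: "module R ?P" by (rule power_module_is_module[OF R_cring])
  note S = stage_module[of "below i"]
  interpret S: module R ?S by (rule S)
  have N: "module R ?N" and N': "module R ?N'" by (rule tower_module[OF closed_below])+
  interpret N: module R ?N by (rule N)
  have X: "module R ?X" and Y: "module R ?Y" by (rule module_sum_is_module; fact)+
  have ij: "below i \<subseteq> below j" and i_in: "i \<in> below j" using bj by auto
  note \<pi> = proj_hom[OF closed_below[of i]] and \<pi>' = proj_hom[OF closed_below[of j]]
  have zR: "z l \<in> carrier R" if "z \<in> carrier ?P" "l < ?k" for z l using that by (simp add: power_module_carrier_iff)
  let ?ad = "\<lambda>(p, z). adjoin i ?k p z"
  have ad_mem: "adjoin i ?k p z \<in> carrier (stg (below j))" if "p \<in> carrier ?S" "z \<in> carrier ?P" for p z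
    by (rule adjoin_stage[OF that(1) zR[OF that(2)] i_in ij])
  have ad_hom: "?ad \<in> module_homs R ?X (stg (below j))"
  proof (rule module_homsI)
    show "?ad q \<in> carrier (stg (below j))" if "q \<in> carrier ?X" for q
      using that ad_mem by (auto simp: module_sum_simps)
    show "?ad (q \<oplus>\<^bsub>?X\<^esub> q') = ?ad q \<oplus>\<^bsub>stg (below j)\<^esub> ?ad q'" for q q'
      by (cases q; cases q') (auto simp: module_sum_simps stage_ops adjoin_add power_module_simps intro!: adjoin_cong)
    show "?ad (a \<odot>\<^bsub>?X\<^esub> q) = a \<odot>\<^bsub>stg (below j)\<^esub> ?ad q" for a q
      by (cases q) (auto simp: module_sum_simps stage_ops adjoin_smult power_module_simps intro!: adjoin_cong)
  qed
  let ?G = "\<lambda>q. ?\<pi>' (?ad q)"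
  have G: "?G \<in> module_homs R ?X ?N'" by (rule module_homs_comp[OF ad_hom \<pi>'])
  let ?Q = "\<lambda>(p, z). (?\<pi> p, z)"
  have Q: "?Q \<in> module_homs R ?X ?Y"
    by (rule module_homsI) (auto simp: module_sum_simps module_homs_closed[OF \<pi>] module_homs_add[OF \<pi>] module_homs_smult[OF \<pi>])
  have Q_surj: "?Q ` carrier ?X = carrier ?Y"
  proof (intro equalityI subsetI)
    fix y assume "y \<in> ?Q ` carrier ?X"
    then show "y \<in> carrier ?Y" using module_homs_closed[OF Q] by blast
  next
    fix y assume "y \<in> carrier ?Y"
    then obtain n z where y: "y = (n, z)" "n \<in> carrier ?N" "z \<in> carrier ?P" by (auto simp: module_sum_simps)
    obtain p where p: "p \<in> carrier ?S" "n = ?\<pi> p" by (rule tower_cases[OF closed_below y(2)])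
    then have "y = ?Q (p, z)" "(p, z) \<in> carrier ?X" using y by (simp_all add: module_sum_simps)
    then show "y \<in> ?Q ` carrier ?X" by blast
  qed
  have ker: "?G q = \<zero>\<^bsub>?N'\<^esub>" if q: "q \<in> carrier ?X" and zero: "?Q q = \<zero>\<^bsub>?Y\<^esub>" for q
  proof -
    obtain p z where pz: "q = (p, z)" by (cases q)
    have p: "p \<in> carrier ?S" "?\<pi> p = \<zero>\<^bsub>?N\<^esub>" and z: "z = \<zero>\<^bsub>?P\<^esub>"
      using q zero by (simp_all add: pz module_sum_simps)
    have "adjoin i ?k p z = adjoin i ?k p (\<lambda>_. \<zero>\<^bsub>R\<^esub>)" by (rule adjoin_cong) (simp add: z power_module_simps(2))
    then have "adjoin i ?k p z = p" using adjoin_zero[OF p(1)] by simp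
    moreover have "p \<in> rels (below j)" using p proj_zero_iff[OF closed_below p(1)] rels_mono[OF ij] by blast
    ultimately show ?thesis using proj_zero_iff[OF closed_below stage_mono[OF ij p(1)]] by (simp add: pz)
  qed
  obtain g where g: "g \<in> module_homs R ?Y ?N'" and g_eq0: "\<And>q. q \<in> carrier ?X \<Longrightarrow> g (?Q q) = ?G q"
    using factor_through_surjection[OF X Y N' Q Q_surj G ker] by blast
  have g_eq: "g (?\<pi> p, z) = ?\<pi>' (adjoin i ?k p z)" if "p \<in> carrier ?S" "z \<in> carrier ?P" for p z
    using g_eq0[of "(p, z)"] that by (simp add: module_sum_simps)
  let ?u = "?\<pi> (du i)"
  have u: "du i \<in> carrier ?S" by (rule du_stage)
  have g_surj: "g ` carrier ?Y = carrier ?N'"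
  proof (intro equalityI subsetI)
    fix y assume "y \<in> g ` carrier ?Y"
    then show "y \<in> carrier ?N'" using module_homs_closed[OF g] by blast
  next
    fix y assume "y \<in> carrier ?N'"
    then obtain q where q: "q \<in> carrier (stg (below j))" "y = ?\<pi>' q" by (rule tower_cases[OF closed_below])
    let ?p = "(fst q, \<lambda>(a, l). if a = i then \<zero>\<^bsub>R\<^esub> else snd q (a, l))"
    let ?z = "\<lambda>l\<in>{..<?k}. snd q (i, l)"
    have qR: "snd q a \<in> carrier R" and qfin: "finite {a. snd q a \<noteq> \<zero>\<^bsub>R\<^esub>}"
      and q0: "a \<notin> stage_gens D (below j) \<Longrightarrow> snd q a = \<zero>\<^bsub>R\<^esub>" for a
      using q(1) unfolding stage_carrier_iff by blast+
    have "?p \<in> carrier ?S" unfolding stage_carrier_iff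
    proof (intro conjI allI impI)
      show "fst ?p \<in> carrier M" using q(1) by (simp add: stage_carrier_iff)
      show "snd ?p a \<in> carrier R" for a using qR by (cases a) simp
      show "finite {a. snd ?p a \<noteq> \<zero>\<^bsub>R\<^esub>}"
        by (rule finite_subset[OF _ qfin]) (auto split: if_splits)
      show "snd ?p a = \<zero>\<^bsub>R\<^esub>" if a: "a \<notin> stage_gens D (below i)" for a
      proof (cases "fst a = i")
        case False
        then have "a \<notin> stage_gens D (below j)" using a bj by (cases a) (auto simp: stage_gens_eq)
        then show ?thesis using q0 by (cases a) auto
      qed (cases a, simp)
    qed
    moreover have "?z \<in> carrier ?P" using qR by (simp add: power_module_carrier_iff)
    moreover have "adjoin i ?k ?p ?z = q"
    proof -
      have "snd q (i, l) = \<zero>\<^bsub>R\<^esub>" if "\<not> l < ?k" for l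
        by (rule q0) (use that in \<open>simp add: stage_gens_eq\<close>)
      then show ?thesis by (auto simp: adjoin_def prod_eq_iff fun_eq_iff)
    qed
    ultimately have "y = g (?\<pi> ?p, ?z)" "(?\<pi> ?p, ?z) \<in> carrier ?Y"
      using g_eq q(2) module_homs_closed[OF \<pi>] by (simp_all add: module_sum_simps)
    then show "y \<in> g ` carrier ?Y" by blast
  qed
  have g_ker: "g (y, z) = \<zero>\<^bsub>?N'\<^esub> \<longleftrightarrow> (\<exists>t\<in>carrier R. y = t \<odot>\<^bsub>?N\<^esub> ?u \<and> (\<forall>l<?k. z l = t \<otimes>\<^bsub>R\<^esub> dxs i ! l))"
    if y: "y \<in> carrier ?N" and z: "z \<in> carrier ?P" for y z
  proof -
    obtain p where p: "p \<in> carrier ?S" "y = ?\<pi> p" by (rule tower_cases[OF closed_below y])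
    have 1: "g (y, z) = \<zero>\<^bsub>?N'\<^esub> \<longleftrightarrow> adjoin i ?k p z \<in> rels (below j)"
      using g_eq[OF p(1) z] proj_zero_iff[OF closed_below ad_mem[OF p(1) z]] p(2) by simp
    have tu: "t \<odot>\<^bsub>A\<^esub> du i \<in> carrier ?S" if "t \<in> carrier R" for t
      using S.smult_closed[OF that u] by (simp only: stage_ops)
    show ?thesis unfolding 1
    proof
      assume "adjoin i ?k p z \<in> rels (below j)"
      then have "adjoin i ?k p z \<in> lspan R A (insert (stage_vector D i) (stage_vector D ` below i))"
        by (simp add: stage_rels_def bj)
      moreover have "insert (stage_vector D i) (stage_vector D ` below i) \<subseteq> carrier A"
        using vectors_A[of "insert i (below i)"] by simp
      ultimately obtain q t where q: "q \<in> rels (below i)" and t: "t \<in> carrier R"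
        and eq: "adjoin i ?k p z = q \<oplus>\<^bsub>A\<^esub> t \<odot>\<^bsub>A\<^esub> stage_vector D i"
        using lspan_insert[OF A_module] unfolding stage_rels_def by blast
      have qS: "q \<in> carrier ?S" using q rels_stage[OF closed_below] by blast
      have "q \<oplus>\<^bsub>A\<^esub> t \<odot>\<^bsub>A\<^esub> stage_vector D i
          = adjoin i ?k q (\<lambda>_. \<zero>\<^bsub>R\<^esub>) \<oplus>\<^bsub>A\<^esub> t \<odot>\<^bsub>A\<^esub> adjoin i ?k (du i) (\<lambda>l. dxs i ! l)"
        by (simp add: stage_vector_eq adjoin_zero[OF qS])
      also have "\<dots> = adjoin i ?k (q \<oplus>\<^bsub>A\<^esub> t \<odot>\<^bsub>A\<^esub> du i) (\<lambda>l. t \<otimes>\<^bsub>R\<^esub> dxs i ! l)"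
        unfolding adjoin_smult adjoin_add
        by (rule adjoin_cong) (use t subsetD[OF dxs_R nth_mem] in simp)
      finally have eq': "adjoin i ?k p z = adjoin i ?k (q \<oplus>\<^bsub>A\<^esub> t \<odot>\<^bsub>A\<^esub> du i) (\<lambda>l. t \<otimes>\<^bsub>R\<^esub> dxs i ! l)"
        using eq by simp
      have sumS: "q \<oplus>\<^bsub>A\<^esub> t \<odot>\<^bsub>A\<^esub> du i \<in> carrier ?S"
        using S.M.a_closed[OF qS tu[OF t]] by (simp only: stage_ops)
      note parts = adjoin_eqD[OF eq' p(1) sumS]
      have "?\<pi> p = ?\<pi> q \<oplus>\<^bsub>?N\<^esub> t \<odot>\<^bsub>?N\<^esub> ?u"
        unfolding parts(1) using module_homs_add[OF \<pi> qS tu[OF t]] module_homs_smult[OF \<pi> t u]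
        by (simp only: stage_ops)
      moreover have "?\<pi> q = \<zero>\<^bsub>?N\<^esub>" using proj_zero_iff[OF closed_below qS] q by simp
      moreover have "t \<odot>\<^bsub>?N\<^esub> ?u \<in> carrier ?N" using t module_homs_closed[OF \<pi> u] by simp
      ultimately have "y = t \<odot>\<^bsub>?N\<^esub> ?u" using p(2) by simp
      then show "\<exists>t\<in>carrier R. y = t \<odot>\<^bsub>?N\<^esub> ?u \<and> (\<forall>l<?k. z l = t \<otimes>\<^bsub>R\<^esub> dxs i ! l)"
        using t parts(2) by blast
    next
      assume "\<exists>t\<in>carrier R. y = t \<odot>\<^bsub>?N\<^esub> ?u \<and> (\<forall>l<?k. z l = t \<otimes>\<^bsub>R\<^esub> dxs i ! l)"
      then obtain t where t: "t \<in> carrier R" "y = t \<odot>\<^bsub>?N\<^esub> ?u" and zt: "\<And>l. l < ?k \<Longrightarrow> z l = t \<otimes>\<^bsub>R\<^esub> dxs i ! l"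
        by blast
      let ?q = "p \<ominus>\<^bsub>?S\<^esub> t \<odot>\<^bsub>?S\<^esub> du i"
      have tuS: "t \<odot>\<^bsub>?S\<^esub> du i \<in> carrier ?S" by (rule S.smult_closed[OF t(1) u])
      have qS: "?q \<in> carrier ?S" using p(1) tuS by simp
      have "?\<pi> p = ?\<pi> (t \<odot>\<^bsub>?S\<^esub> du i)" using p(2) t module_homs_smult[OF \<pi> t(1) u] by simp
      then have q: "?q \<in> rels (below i)"
        using module_homs_eq_iff[OF S N \<pi> p(1) tuS] proj_zero_iff[OF closed_below qS] by simp
      have "p = ?q \<oplus>\<^bsub>?S\<^esub> t \<odot>\<^bsub>?S\<^esub> du i" using p(1) tuS by (simp add: a_minus_def S.M.a_assoc S.M.l_neg)
      then have "adjoin i ?k p z = adjoin i ?k (?q \<oplus>\<^bsub>A\<^esub> t \<odot>\<^bsub>A\<^esub> du i) z" by (simp only: stage_ops)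
      also have "\<dots> = adjoin i ?k (?q \<oplus>\<^bsub>A\<^esub> t \<odot>\<^bsub>A\<^esub> du i) (\<lambda>l. \<zero>\<^bsub>R\<^esub> \<oplus>\<^bsub>R\<^esub> t \<otimes>\<^bsub>R\<^esub> dxs i ! l)"
        by (rule adjoin_cong) (use t zt subsetD[OF dxs_R nth_mem] in simp)
      also have "\<dots> = adjoin i ?k ?q (\<lambda>_. \<zero>\<^bsub>R\<^esub>) \<oplus>\<^bsub>A\<^esub> t \<odot>\<^bsub>A\<^esub> stage_vector D i"
        by (simp add: stage_vector_eq adjoin_smult adjoin_add)
      also have "\<dots> = ?q \<oplus>\<^bsub>A\<^esub> t \<odot>\<^bsub>A\<^esub> stage_vector D i" by (simp only: adjoin_zero[OF qS])
      also have "\<dots> \<in> rels (below j)"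
        unfolding stage_rels_def
        by (rule lspan.step[OF _ t(1)]) (use q rels_mono[OF ij] i_in in \<open>auto simp: stage_rels_def\<close>)
      finally show "adjoin i ?k p z \<in> rels (below j)" .
    qed
  qed
  obtain x us where sop: "partial_sop R \<mm> (dxs i @ [x])"
    and us: "length us = ?k" "set us \<subseteq> carrier ?S"
    and rel: "(\<Oplus>\<^bsub>A\<^esub> l \<in> {..<?k}. (dxs i ! l) \<odot>\<^bsub>A\<^esub> (us ! l)) \<oplus>\<^bsub>A\<^esub> (x \<odot>\<^bsub>A\<^esub> du i) \<in> rels (below i)"
    by (rule data[of i])
  have xR: "x \<in> carrier R" using partial_sop_subset[OF sop] mm by auto
  have usl: "us ! l \<in> carrier ?S" if "l < ?k" for l using us that by auto
  have dl: "dxs i ! l \<in> carrier R" if "l < ?k" for l using subsetD[OF dxs_R nth_mem[OF that]] .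
  let ?sum = "\<Oplus>\<^bsub>?S\<^esub> l \<in> {..<?k}. (dxs i ! l) \<odot>\<^bsub>?S\<^esub> (us ! l)"
  have sumS: "?sum \<in> carrier ?S" using usl dl by (intro S.M.finsum_closed) auto
  have "?sum = (\<Oplus>\<^bsub>A\<^esub> l \<in> {..<?k}. (dxs i ! l) \<odot>\<^bsub>?S\<^esub> (us ! l))"
    by (rule module_homs_finsum[OF S A_module stage_incl_hom]) (use usl dl in auto)
  then have "?sum = (\<Oplus>\<^bsub>A\<^esub> l \<in> {..<?k}. (dxs i ! l) \<odot>\<^bsub>A\<^esub> (us ! l))" by (simp only: stage_ops(3))
  then have relS: "?sum \<oplus>\<^bsub>?S\<^esub> x \<odot>\<^bsub>?S\<^esub> du i \<in> rels (below i)" using rel by (simp only: stage_ops)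
  have "?\<pi> ?sum = (\<Oplus>\<^bsub>?N\<^esub> l \<in> {..<?k}. ?\<pi> ((dxs i ! l) \<odot>\<^bsub>?S\<^esub> (us ! l)))"
    by (rule module_homs_finsum[OF S N \<pi>]) (use usl dl in auto)
  also have "\<dots> = (\<Oplus>\<^bsub>?N\<^esub> l \<in> {..<?k}. (dxs i ! l) \<odot>\<^bsub>?N\<^esub> (map ?\<pi> us ! l))"
    using usl dl us(1) module_homs_closed[OF \<pi>]
    by (intro N.M.finsum_cong') (auto simp: module_homs_smult[OF \<pi>])
  finally have sum\<pi>: "?\<pi> ?sum = \<dots>" .
  have "?\<pi> (?sum \<oplus>\<^bsub>?S\<^esub> x \<odot>\<^bsub>?S\<^esub> du i) = \<zero>\<^bsub>?N\<^esub>"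
    using proj_zero_iff[OF closed_below] relS sumS xR u by simp
  then have "modification_relation_holds R \<mm> ?N (dxs i) x (map ?\<pi> us) ?u"
    unfolding modification_relation_holds_def
    using sop us module_homs_closed[OF \<pi>] u sumS xR sum\<pi>
    by (auto simp: module_homs_add[OF \<pi>] module_homs_smult[OF \<pi>])
  moreover have "presents_modification R ?N (dxs i) ?u ?N' g"
    unfolding presents_modification_def using g g_surj g_ker by blast
  moreover have "\<forall>p\<in>carrier ?S. g (?\<pi> p, \<zero>\<^bsub>?P\<^esub>) = ?\<pi>' p"
  proof
    fix p assume p: "p \<in> carrier ?S"
    have "\<zero>\<^bsub>?P\<^esub> \<in> carrier ?P" by (simp add: power_module_carrier_iff power_module_simps(2))
    moreover have "adjoin i ?k p \<zero>\<^bsub>?P\<^esub> = adjoin i ?k p (\<lambda>_. \<zero>\<^bsub>R\<^esub>)"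
      by (rule adjoin_cong) (simp add: power_module_simps(2))
    ultimately show "g (?\<pi> p, \<zero>\<^bsub>?P\<^esub>) = ?\<pi>' p" using g_eq[OF p] adjoin_zero[OF p] by simp
  qed
  ultimately show thesis by (rule that)
qed

end

section \<open>Regular sequences\<close>

lemma generated_submodule_is_submodule:
  assumes M: "module R M" and S: "S \<subseteq> carrier M"
  shows "submodule (generated_submodule R M S) R M"
proof -
  interpret M: module R M by (rule M)
  note top = M.carrier_is_submodule
  show ?thesis unfolding generated_submodule_def
  proof (rule submoduleI_smult[OF M])
    show "\<Inter>{H. submodule H R M \<and> S \<subseteq> H} \<subseteq> carrier M" using top S by blast
    show "\<zero>\<^bsub>M\<^esub> \<in> \<Inter>{H. submodule H R M \<and> S \<subseteq> H}" using submodule_zero[OF M] by blast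
    show "x \<oplus>\<^bsub>M\<^esub> y \<in> \<Inter>{H. submodule H R M \<and> S \<subseteq> H}"
      if "x \<in> \<Inter>{H. submodule H R M \<and> S \<subseteq> H}" "y \<in> \<Inter>{H. submodule H R M \<and> S \<subseteq> H}" for x y
      using that submodule_add[OF M] by blast
    show "a \<odot>\<^bsub>M\<^esub> x \<in> \<Inter>{H. submodule H R M \<and> S \<subseteq> H}"
      if "a \<in> carrier R" "x \<in> \<Inter>{H. submodule H R M \<and> S \<subseteq> H}" for a x
      using that submodule_smult[OF M] by blast
  qed
qed

lemma ideal_smult_submodule:
  assumes M: "module R M" and I: "I \<subseteq> carrier R"
  shows "submodule (ideal_smult R I M) R M"
proof -
  interpret M: module R M by (rule M)
  show ?thesis unfolding ideal_smult_def
    by (rule generated_submodule_is_submodule[OF M]) (use I in auto)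
qed

lemma ideal_smult_mem: "a \<in> I \<Longrightarrow> x \<in> carrier M \<Longrightarrow> a \<odot>\<^bsub>M\<^esub> x \<in> ideal_smult R I M"
  unfolding ideal_smult_def generated_submodule_def by blast

lemma ideal_smult_least:
  assumes "submodule H R M" "\<And>a x. a \<in> I \<Longrightarrow> x \<in> carrier M \<Longrightarrow> a \<odot>\<^bsub>M\<^esub> x \<in> H"
  shows "ideal_smult R I M \<subseteq> H"
  using assms unfolding ideal_smult_def generated_submodule_def by blast

lemma ideal_smult_mono:
  assumes "module R M" "J \<subseteq> carrier R" "I \<subseteq> J"
  shows "ideal_smult R I M \<subseteq> ideal_smult R J M"
  by (rule ideal_smult_least[OF ideal_smult_submodule[OF assms(1,2)] ideal_smult_mem[OF subsetD[OF assms(3)]]])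

lemma ideal_smult_combination:
  fixes R :: "'a ring" and M :: "('a, 'b) module"
  assumes M: "module R M" and xs: "set xs \<subseteq> carrier R" and y: "y \<in> ideal_smult R (Idl\<^bsub>R\<^esub> (set xs)) M"
  shows "\<exists>c. (\<forall>l<length xs. c l \<in> carrier M) \<and> y = (\<Oplus>\<^bsub>M\<^esub> l \<in> {..<length xs}. (xs ! l) \<odot>\<^bsub>M\<^esub> c l)"
proof -
  interpret M: module R M by (rule M)
  let ?k = "length xs"
  have xR: "xs ! l \<in> carrier R" if "l < ?k" for l using xs that by auto
  define T where "T = {\<Oplus>\<^bsub>M\<^esub> l \<in> {..<?k}. (xs ! l) \<odot>\<^bsub>M\<^esub> c l | c. \<forall>l<?k. c l \<in> carrier M}"
  have TI: "(\<Oplus>\<^bsub>M\<^esub> l \<in> {..<?k}. (xs ! l) \<odot>\<^bsub>M\<^esub> c l) \<in> T" if "\<And>l. l < ?k \<Longrightarrow> c l \<in> carrier M" for c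
    unfolding T_def using that by blast
  have T: "submodule T R M"
  proof (rule submoduleI_smult[OF M])
    show "T \<subseteq> carrier M" unfolding T_def using xR by (auto intro!: M.M.finsum_closed)
    have "(\<Oplus>\<^bsub>M\<^esub> l \<in> {..<?k}. (xs ! l) \<odot>\<^bsub>M\<^esub> \<zero>\<^bsub>M\<^esub>) = (\<Oplus>\<^bsub>M\<^esub> l \<in> {..<?k}. \<zero>\<^bsub>M\<^esub>)"
      using xR by (intro M.M.finsum_cong') auto
    then show "\<zero>\<^bsub>M\<^esub> \<in> T" using TI[of "\<lambda>_. \<zero>\<^bsub>M\<^esub>"] by simp
    show "x \<oplus>\<^bsub>M\<^esub> y \<in> T" if xy: "x \<in> T" "y \<in> T" for x y
    proof -
      obtain c d where c: "\<forall>l<?k. c l \<in> carrier M" "x = (\<Oplus>\<^bsub>M\<^esub> l \<in> {..<?k}. (xs ! l) \<odot>\<^bsub>M\<^esub> c l)"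
        and d: "\<forall>l<?k. d l \<in> carrier M" "y = (\<Oplus>\<^bsub>M\<^esub> l \<in> {..<?k}. (xs ! l) \<odot>\<^bsub>M\<^esub> d l)"
        using xy unfolding T_def by blast
      have "x \<oplus>\<^bsub>M\<^esub> y = (\<Oplus>\<^bsub>M\<^esub> l \<in> {..<?k}. (xs ! l) \<odot>\<^bsub>M\<^esub> c l \<oplus>\<^bsub>M\<^esub> (xs ! l) \<odot>\<^bsub>M\<^esub> d l)"
        unfolding c(2) d(2) using c(1) d(1) xR by (intro M.M.finsum_addf[symmetric]) auto
      also have "\<dots> = (\<Oplus>\<^bsub>M\<^esub> l \<in> {..<?k}. (xs ! l) \<odot>\<^bsub>M\<^esub> (c l \<oplus>\<^bsub>M\<^esub> d l))"
        using c(1) d(1) xR by (intro M.M.finsum_cong') (auto simp: M.smult_r_distr)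
      finally show ?thesis using TI[of "\<lambda>l. c l \<oplus>\<^bsub>M\<^esub> d l"] c(1) d(1) by simp
    qed
    show "a \<odot>\<^bsub>M\<^esub> x \<in> T" if a: "a \<in> carrier R" and x: "x \<in> T" for a x
    proof -
      obtain c where c: "\<forall>l<?k. c l \<in> carrier M" "x = (\<Oplus>\<^bsub>M\<^esub> l \<in> {..<?k}. (xs ! l) \<odot>\<^bsub>M\<^esub> c l)"
        using x unfolding T_def by blast
      have "a \<odot>\<^bsub>M\<^esub> x = (\<Oplus>\<^bsub>M\<^esub> l \<in> {..<?k}. a \<odot>\<^bsub>M\<^esub> ((xs ! l) \<odot>\<^bsub>M\<^esub> c l))"
        unfolding c(2) using a c(1) xR by (intro M.finsum_smult_ldistr) auto
      also have "\<dots> = (\<Oplus>\<^bsub>M\<^esub> l \<in> {..<?k}. (xs ! l) \<odot>\<^bsub>M\<^esub> (a \<odot>\<^bsub>M\<^esub> c l))"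
        using a c(1) xR by (intro M.M.finsum_cong') (auto simp: M.smult_assoc1[symmetric] M.R.m_comm)
      finally show ?thesis using TI[of "\<lambda>l. a \<odot>\<^bsub>M\<^esub> c l"] c(1) a by simp
    qed
  qed
  have "a \<odot>\<^bsub>M\<^esub> m \<in> T" if a: "a \<in> Idl\<^bsub>R\<^esub> (set xs)" and m: "m \<in> carrier M" for a m
  proof -
    note RM = ring_module_is_module[OF M.R.is_cring]
    let ?A = "{a \<in> carrier (ring_module R). a \<odot>\<^bsub>M\<^esub> m \<in> T}"
    have "(\<lambda>a. a \<odot>\<^bsub>M\<^esub> m) \<in> module_homs R (ring_module R) M"
      using m by (intro module_homsI) (auto simp: ring_module_def M.smult_l_distr M.smult_assoc1)
    then have A: "ideal ?A R"
      by (intro submodule_is_ideal M.R.is_cring preimage_submodule[OF RM M _ T])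
    have "xs ! n \<odot>\<^bsub>M\<^esub> m \<in> T" if n: "n < ?k" for n
    proof -
      let ?c = "\<lambda>l. if n = l then m else \<zero>\<^bsub>M\<^esub>"
      have "(\<Oplus>\<^bsub>M\<^esub> l \<in> {..<?k}. (xs ! l) \<odot>\<^bsub>M\<^esub> ?c l)
          = (\<Oplus>\<^bsub>M\<^esub> l \<in> {..<?k}. if n = l then (xs ! l) \<odot>\<^bsub>M\<^esub> m else \<zero>\<^bsub>M\<^esub>)"
        using xR m by (intro M.M.finsum_cong') auto
      also have "\<dots> = xs ! n \<odot>\<^bsub>M\<^esub> m"
        using n xR m by (intro M.M.finsum_singleton) auto
      finally show ?thesis using TI[of ?c] m by auto
    qed
    then have "set xs \<subseteq> ?A" using xR by (auto simp: in_set_conv_nth ring_module_def)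
    then have "Idl\<^bsub>R\<^esub> (set xs) \<subseteq> ?A" using M.R.genideal_minimal[OF A] by blast
    then show ?thesis using a by blast
  qed
  then have "ideal_smult R (Idl\<^bsub>R\<^esub> (set xs)) M \<subseteq> T" by (rule ideal_smult_least[OF T])
  then show ?thesis using y unfolding T_def by blast
qed

text \<open>If \<open>x u \<in> (x\<^sub>1, \<dots>, x\<^sub>k) B\<close>, then \<open>u\<close> is the last element of a relation
  \<open>x\<^sub>1 u\<^sub>1 + \<dots> + x\<^sub>k u\<^sub>k + x u = 0\<close>. So regularity of all partial systems of parameters says
  that in each such relation \<open>u \<in> (x\<^sub>1, \<dots>, x\<^sub>k) B\<close>.\<close>

lemma balanced_big_CM_of_relations:
  fixes R :: "'a ring" and B :: "('a, 'b) module"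
  assumes B: "module R B" and mm: "ideal \<mm> R" and proper: "ideal_smult R \<mm> B \<noteq> carrier B"
    and rels: "\<And>xs x us u. modification_relation_holds R \<mm> B xs x us u
      \<Longrightarrow> u \<in> ideal_smult R (Idl\<^bsub>R\<^esub> (set xs)) B"
  shows "balanced_big_CM R \<mm> B"
proof -
  interpret B: module R B by (rule B)
  have mmR: "\<mm> \<subseteq> carrier R" using ideal.Icarr[OF mm] by blast
  have reg: "regular_sequence R B xs" if sop: "partial_sop R \<mm> xs" for xs
    unfolding regular_sequence_def Let_def
  proof (intro conjI allI impI ballI)
    have xs: "set xs \<subseteq> \<mm>" by (rule partial_sop_subset[OF sop])
    have "Idl\<^bsub>R\<^esub> (set xs) \<subseteq> \<mm>" using B.R.genideal_minimal[OF mm xs] .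
    then have "ideal_smult R (Idl\<^bsub>R\<^esub> (set xs)) B \<subseteq> ideal_smult R \<mm> B" by (rule ideal_smult_mono[OF B mmR])
    then show "ideal_smult R (Idl\<^bsub>R\<^esub> (set xs)) B \<noteq> carrier B"
      using proper submodule_subset[OF B ideal_smult_submodule[OF B mmR]] by blast
    fix i q
    assume i: "i < length xs"
    let ?ps = "take i xs" and ?x = "xs ! i"
    let ?IB = "ideal_smult R (Idl\<^bsub>R\<^esub> (set ?ps)) B"
    let ?Q = "quotient_module B ?IB"
    assume q: "q \<in> carrier ?Q" and zero: "?x \<odot>\<^bsub>?Q\<^esub> q = \<zero>\<^bsub>?Q\<^esub>"
    have psR: "set ?ps \<subseteq> carrier R" using xs mmR set_take_subset[of i xs] by blast
    have xR: "?x \<in> carrier R" using subsetD[OF mmR subsetD[OF xs nth_mem[OF i]]] .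
    have IR: "Idl\<^bsub>R\<^esub> (set ?ps) \<subseteq> carrier R" using ideal.Icarr[OF B.R.genideal_ideal[OF psR]] by blast
    have IB: "submodule ?IB R B" by (rule ideal_smult_submodule[OF B IR])
    have "q \<in> (\<lambda>b. ?IB +>\<^bsub>B\<^esub> b) ` carrier B" using q by (simp only: quotient_surj[OF B IB])
    then obtain b where b: "q = ?IB +>\<^bsub>B\<^esub> b" "b \<in> carrier B" by (rule imageE)
    have "?IB +>\<^bsub>B\<^esub> (?x \<odot>\<^bsub>B\<^esub> b) = \<zero>\<^bsub>?Q\<^esub>"
      using zero module_homs_smult[OF quotient_hom[OF B IB] xR b(2)] b(1) by simp
    then have "?x \<odot>\<^bsub>B\<^esub> b \<in> ?IB" using quotient_zero_iff[OF B IB] xR b(2) by simp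
    then have "\<ominus>\<^bsub>B\<^esub> (?x \<odot>\<^bsub>B\<^esub> b) \<in> ?IB" by (rule submodule_neg[OF B IB])
    then obtain c where c: "\<forall>l<length ?ps. c l \<in> carrier B"
      and eq: "\<ominus>\<^bsub>B\<^esub> (?x \<odot>\<^bsub>B\<^esub> b) = (\<Oplus>\<^bsub>B\<^esub> l \<in> {..<length ?ps}. (?ps ! l) \<odot>\<^bsub>B\<^esub> c l)"
      using ideal_smult_combination[OF B psR] by blast
    let ?us = "map c [0..<length ?ps]"
    have "(\<Oplus>\<^bsub>B\<^esub> l \<in> {..<length ?ps}. (?ps ! l) \<odot>\<^bsub>B\<^esub> (?us ! l)) = \<ominus>\<^bsub>B\<^esub> (?x \<odot>\<^bsub>B\<^esub> b)"
    proof -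
      have psl: "?ps ! l \<in> carrier R" if "l < length ?ps" for l using subsetD[OF psR nth_mem[OF that]] .
      show ?thesis unfolding eq using c psl by (intro B.M.finsum_cong') auto
    qed
    then have "(\<Oplus>\<^bsub>B\<^esub> l \<in> {..<length ?ps}. (?ps ! l) \<odot>\<^bsub>B\<^esub> (?us ! l)) \<oplus>\<^bsub>B\<^esub> ?x \<odot>\<^bsub>B\<^esub> b = \<zero>\<^bsub>B\<^esub>"
      using xR b(2) by (simp add: B.M.l_neg)
    moreover have "partial_sop R \<mm> (?ps @ [?x])"
      unfolding take_Suc_conv_app_nth[OF i, symmetric]
      by (rule partial_sop_appendD[where ys = "drop (Suc i) xs"]) (use sop in \<open>simp only: append_take_drop_id\<close>)
    moreover have "set ?us \<subseteq> carrier B" using c by auto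
    ultimately have "modification_relation_holds R \<mm> B ?ps ?x ?us b"
      using b(2) unfolding modification_relation_holds_def by simp
    then have "b \<in> ?IB" by (rule rels)
    then show "q = \<zero>\<^bsub>?Q\<^esub>" using quotient_zero_iff[OF B IB b(2)] b(1) by simp
  qed
  then show ?thesis using B proper unfolding balanced_big_CM_def by blast
qed

section \<open>The limit of a saturated tower\<close>

context realised_tower
begin

lemma below_successor:
  assumes "i \<in> below j" "\<forall>k\<in>below j. (k, i) \<in> r"
  shows "below j = insert i (below i)"
proof
  show "below j \<subseteq> insert i (below i)" using assms(2) by (auto simp: underS_def)
  have "(i, j) \<in> r" using assms(1) by (simp add: underS_def)
  then show "insert i (below i) \<subseteq> below j" using assms(1) below_mono by blast
qed

lemma below_limit:
  assumes "\<not> (\<exists>i\<in>below j. \<forall>k\<in>below j. (k, i) \<in> r)" "i \<in> below j"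
  shows "\<exists>k\<in>below j. i \<in> below k"
  using assms below_iff by blast

lemma tower_modification_sequence: "modification_sequence R \<mm> M r term_at step_map"
  unfolding modification_sequence_def
proof (intro conjI ballI impI allI)
  show "Well_order r" by (rule well)
  show "Field r \<noteq> {}" by (simp add: field)
  show "direct_system R (Field r) r term_at step_map" by (rule tower_direct_system)
  fix j
  show "term_at j = M" if "below j = {}" using that tower_empty by simp
  show "is_module_modification R \<mm> (term_at i) (term_at j) (step_map i j)"
    if i: "i \<in> below j \<and> (\<forall>k\<in>below j. (k, i) \<in> r)" for i
  proof -
    have bj: "below j = insert i (below i)" using below_successor i by blast
    then have sub: "below i \<subseteq> below j" by blast
    obtain g x us where rel: "modification_relation_holds R \<mm> (term_at i) (dxs i) x us (proj (below i) (du i))"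
      and pres: "presents_modification R (term_at i) (dxs i) (proj (below i) (du i)) (term_at j) g"
      and g: "\<forall>p\<in>carrier (stg (below i)). g (proj (below i) p, \<zero>\<^bsub>power_module R (length (dxs i))\<^esub>) = proj (below j) p"
      by (rule tower_step[OF bj])
    have "step_map i j y = g (y, \<zero>\<^bsub>power_module R (length (dxs i))\<^esub>)" if y: "y \<in> carrier (term_at i)" for y
    proof -
      obtain p where p: "p \<in> carrier (stg (below i))" "y = proj (below i) p" by (rule tower_cases[OF closed_below y])
      then show ?thesis using g trans_map_proj[OF closed_below closed_below sub] by simp
    qed
    then show ?thesis
      by (rule is_module_modification_of_presentation[OF tower_module[OF closed_below] tower_module[OF closed_below]
            dxs_R rel pres])
  qed
  show "is_direct_limit R (below j) r term_at step_map (term_at j) (\<lambda>i. step_map i j)"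
    if lim: "below j \<noteq> {} \<and> \<not> (\<exists>i\<in>below j. \<forall>k\<in>below j. (k, i) \<in> r)"
  proof -
    have "\<exists>k\<in>below j. i \<in> below k" if "i \<in> below j" for i using below_limit lim that by blast
    then have "direct_limit_cocone R (below j) r term_at step_map (term_at j) (\<lambda>i. step_map i j)"
      using lim by (intro tower_limit_cocone[OF closed_below]) auto
    then show ?thesis
      using lim by (intro is_direct_limit_of_cocone[OF tower_direct_system r_trans] tower_directed) auto
  qed
qed

lemma tower_is_direct_limit:
  assumes "\<And>i. \<exists>k. i \<in> below k"
  shows "is_direct_limit R (Field r) r term_at step_map (tower UNIV) (\<lambda>i. trans_map (below i) UNIV)"
  unfolding field
  by (intro is_direct_limit_of_cocone[OF tower_direct_system r_trans] tower_directed
      tower_limit_cocone[OF closed_UNIV]) (use assms in auto)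

lemma tower_linearly_phantom_limit:
  assumes S: "closed S" and lim: "\<And>i. i \<in> S \<Longrightarrow> \<exists>k\<in>S. i \<in> below k" and ne: "S \<noteq> {}"
    and e: "e \<in> carrier M"
    and ph: "\<And>i. i \<in> S \<Longrightarrow> linearly_phantom R cl (term_at i) (proj (below i) (e, \<lambda>_. \<zero>\<^bsub>R\<^esub>))"
  shows "linearly_phantom R cl (tower S) (proj S (e, \<lambda>_. \<zero>\<^bsub>R\<^esub>))"
proof -
  let ?e = "(e, \<lambda>_. \<zero>\<^bsub>R\<^esub>)"
  have eS: "?e \<in> carrier (stg T)" for T using e by (simp add: stage_carrier_iff)
  obtain i0 where i0: "i0 \<in> S" using ne by blast
  have "linearly_phantom R cl (tower S) (trans_map (below i0) S (proj (below i0) ?e))"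
  proof (rule linearly_phantom_direct_limit[OF tower_direct_system r_trans tower_directed
        tower_limit_cocone[OF S lim ne] i0 module_homs_closed[OF proj_hom[OF closed_below] eS]])
    show "linearly_phantom R cl (term_at i) (step_map i0 i (proj (below i0) ?e))" if "i \<in> S" "(i0, i) \<in> r" for i
      using ph[OF that(1)] trans_map_proj[OF closed_below closed_below below_mono[OF that(2)] eS] by simp
  qed
  then show ?thesis using trans_map_proj[OF closed_below S _ eS] i0 S unfolding closed_def by simp
qed

lemma tower_linearly_phantom:
  fixes cl :: "('a, 'u) closure_op" and gR :: "'a \<Rightarrow> 'u"
  assumes cl: "big_closure R \<mm> cl" and inf: "infinite (UNIV :: 'u set)" and gR: "inj_on gR (carrier R)"
    and e: "linearly_phantom R cl M e"
  shows "linearly_phantom R cl (term_at j) (proj (below j) (e, \<lambda>_. \<zero>\<^bsub>R\<^esub>))"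
proof -
  let ?e = "(e, \<lambda>_. \<zero>\<^bsub>R\<^esub>)"
  have eM: "e \<in> carrier M" using e by (simp add: linearly_phantom_def)
  have eS: "?e \<in> carrier (stg T)" for T using eM by (simp add: stage_carrier_iff)
  have "wf (r - Id)" using well by (simp add: well_order_on_def)
  then show ?thesis
  proof (induction j rule: wf_induct_rule)
    case (less j)
    have IH: "linearly_phantom R cl (term_at i) (proj (below i) ?e)" if "i \<in> below j" for i
      using less.IH[of i] that by (simp add: underS_def)
    consider (zero) "below j = {}" | (succ) i where "i \<in> below j" "\<forall>k\<in>below j. (k, i) \<in> r"
      | (lim) "below j \<noteq> {}" "\<not> (\<exists>i\<in>below j. \<forall>k\<in>below j. (k, i) \<in> r)" by blast
    then show ?case
    proof cases
      case zero
      then show ?thesis using e tower_empty proj_empty by simp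
    next
      case succ
      obtain g x us where rel: "modification_relation_holds R \<mm> (term_at i) (dxs i) x us (proj (below i) (du i))"
        and pres: "presents_modification R (term_at i) (dxs i) (proj (below i) (du i)) (term_at j) g"
        and g: "\<forall>p\<in>carrier (stg (below i)). g (proj (below i) p, \<zero>\<^bsub>power_module R (length (dxs i))\<^esub>) = proj (below j) p"
        by (rule tower_step[OF below_successor[OF succ]])
      have "set (dxs i @ [x]) \<subseteq> carrier R"
        using rel partial_sop_subset mm unfolding modification_relation_holds_def by blast
      from big_closure.linearly_phantom_modification[OF cl inf gR tower_module[OF closed_below]
          tower_module[OF closed_below] this rel pres IH[OF succ(1)]]
      show ?thesis using g eS by simp
    next
      case lim
      show ?thesis
        by (rule tower_linearly_phantom_limit[OF closed_below below_limit[OF lim(2)] lim(1) eM IH])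
    qed
  qed
qed

text \<open>The element \<open>x\<^sub>1 e\<^sub>1 + \<dots> + x\<^sub>h e\<^sub>h\<close>, with \<open>e\<^sub>l\<close> the new generators of stage \<open>i\<close>, lies in
  every submodule that contains all multiples of the \<open>x\<^sub>l\<close>; the induction adds one generator at a time.\<close>

lemma adjoin_combination_mem:
  assumes h: "h \<le> length (dxs i)" and B: "submodule H R (tower UNIV)"
    and H: "\<And>l n. l < length (dxs i) \<Longrightarrow> n \<in> carrier (tower UNIV) \<Longrightarrow> dxs i ! l \<odot>\<^bsub>tower UNIV\<^esub> n \<in> H"
  shows "proj UNIV (adjoin i (length (dxs i)) \<zero>\<^bsub>A\<^esub> (\<lambda>l. if l < h then dxs i ! l else \<zero>\<^bsub>R\<^esub>)) \<in> H"
  using h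
proof (induction h)
  case 0
  note T = tower_module[OF closed_UNIV]
  have z: "\<zero>\<^bsub>A\<^esub> \<in> carrier (stg (below i))" using submodule_zero[OF A_module stage_submodule] .
  have "proj UNIV \<zero>\<^bsub>A\<^esub> = \<zero>\<^bsub>tower UNIV\<^esub>"
    using module_homs_zero[OF stage_module T proj_hom[OF closed_UNIV]] by (simp only: stage_ops)
  then show ?case using adjoin_zero[OF z, of "length (dxs i)"] submodule_zero[OF T B] by simp
next
  case (Suc h)
  note T = tower_module[OF closed_UNIV] and \<pi> = proj_hom[OF closed_UNIV]
  let ?k = "length (dxs i)"
  let ?v = "\<lambda>h l. if l < h then dxs i ! l else \<zero>\<^bsub>R\<^esub>"
  let ?d = "\<lambda>l. if l = h then \<one>\<^bsub>R\<^esub> else \<zero>\<^bsub>R\<^esub>"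
  have hk: "h < ?k" using Suc.prems by simp
  have xR: "dxs i ! l \<in> carrier R" if "l < ?k" for l using subsetD[OF dxs_R nth_mem[OF that]] .
  have z: "\<zero>\<^bsub>A\<^esub> \<in> carrier (stg (below i))" using submodule_zero[OF A_module stage_submodule] .
  have v: "adjoin i ?k \<zero>\<^bsub>A\<^esub> (?v h) \<in> carrier (stg UNIV)" and d: "adjoin i ?k \<zero>\<^bsub>A\<^esub> ?d \<in> carrier (stg UNIV)"
    by (rule adjoin_stage[OF z]; use xR in simp)+
  interpret Am: module R A by (rule A_module)
  have "adjoin i ?k \<zero>\<^bsub>A\<^esub> (?v (Suc h)) = adjoin i ?k (\<zero>\<^bsub>A\<^esub> \<oplus>\<^bsub>A\<^esub> dxs i ! h \<odot>\<^bsub>A\<^esub> \<zero>\<^bsub>A\<^esub>) (\<lambda>l. ?v h l \<oplus>\<^bsub>R\<^esub> dxs i ! h \<otimes>\<^bsub>R\<^esub> ?d l)"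
    using xR[OF hk] xR by (simp only: Am.smult_r_null Am.M.r_zero Am.M.zero_closed)
      (rule adjoin_cong, auto simp: less_Suc_eq)
  also have "\<dots> = adjoin i ?k \<zero>\<^bsub>A\<^esub> (?v h) \<oplus>\<^bsub>A\<^esub> dxs i ! h \<odot>\<^bsub>A\<^esub> adjoin i ?k \<zero>\<^bsub>A\<^esub> ?d"
    by (simp only: adjoin_smult adjoin_add)
  also have "\<dots> = adjoin i ?k \<zero>\<^bsub>A\<^esub> (?v h) \<oplus>\<^bsub>stg UNIV\<^esub> dxs i ! h \<odot>\<^bsub>stg UNIV\<^esub> adjoin i ?k \<zero>\<^bsub>A\<^esub> ?d"
    by (simp only: stage_ops)
  finally have "proj UNIV (adjoin i ?k \<zero>\<^bsub>A\<^esub> (?v (Suc h))) = proj UNIV (adjoin i ?k \<zero>\<^bsub>A\<^esub> (?v h))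
      \<oplus>\<^bsub>tower UNIV\<^esub> dxs i ! h \<odot>\<^bsub>tower UNIV\<^esub> proj UNIV (adjoin i ?k \<zero>\<^bsub>A\<^esub> ?d)"
    using module_homs_add[OF \<pi> v module.smult_closed[OF stage_module xR[OF hk] d]]
      module_homs_smult[OF \<pi> xR[OF hk] d] by simp
  then show ?case
    using submodule_add[OF T B Suc.IH H[OF hk module_homs_closed[OF \<pi> d]]] hk by simp
qed

text \<open>A relation in the limit comes from an early stage. If its data are processed at a later
  stage \<open>i\<close>, then \<open>u\<close> becomes minus the combination of the new generators with the
  coefficients \<open>x\<^sub>l\<close>.\<close>

lemma tower_relations_trivial:
  assumes nomax: "\<And>i. \<exists>k. i \<in> below k"
    and saturated: "\<And>j t. valid_data R \<mm> M r D j t \<Longrightarrow> \<exists>i. (j, i) \<in> r \<and> D i = t"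
    and rel: "modification_relation_holds R \<mm> (tower UNIV) xs x us u"
  shows "u \<in> ideal_smult R (Idl\<^bsub>R\<^esub> (set xs)) (tower UNIV)"
proof -
  let ?B = "tower UNIV" and ?\<pi> = "proj UNIV" and ?k = "length xs"
  let ?S = "stg UNIV"
  note B = tower_module[OF closed_UNIV] and \<pi> = proj_hom[OF closed_UNIV] and S = stage_module[of UNIV]
  interpret B: module R ?B by (rule B)
  interpret S: module R ?S by (rule S)
  have sop: "partial_sop R \<mm> (xs @ [x])" and len: "length us = ?k" and usB: "set us \<subseteq> carrier ?B"
    and uB: "u \<in> carrier ?B"
    and sum0: "(\<Oplus>\<^bsub>?B\<^esub> l \<in> {..<?k}. (xs ! l) \<odot>\<^bsub>?B\<^esub> (us ! l)) \<oplus>\<^bsub>?B\<^esub> (x \<odot>\<^bsub>?B\<^esub> u) = \<zero>\<^bsub>?B\<^esub>"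
    using rel by (simp_all add: modification_relation_holds_def)
  have xsR: "set xs \<subseteq> carrier R" and xR: "x \<in> carrier R" using partial_sop_subset[OF sop] mm by auto
  have xlR: "xs ! l \<in> carrier R" if "l < ?k" for l using subsetD[OF xsR nth_mem[OF that]] .
  obtain p where p: "p \<in> carrier ?S" "u = ?\<pi> p" by (rule tower_cases[OF closed_UNIV uB])
  have "\<exists>q. q \<in> carrier ?S \<and> us ! l = ?\<pi> q" if "l < ?k" for l
  proof -
    have "us ! l \<in> carrier ?B" using usB len that by auto
    then show ?thesis using tower_cases[OF closed_UNIV] by metis
  qed
  then obtain q where q: "\<And>l. l < ?k \<Longrightarrow> q l \<in> carrier ?S" "\<And>l. l < ?k \<Longrightarrow> us ! l = ?\<pi> (q l)" by metis
  let ?sum = "\<Oplus>\<^bsub>?S\<^esub> l \<in> {..<?k}. (xs ! l) \<odot>\<^bsub>?S\<^esub> q l"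
  have sumS: "?sum \<in> carrier ?S" using q(1) xlR by (intro S.M.finsum_closed) auto
  have "?\<pi> ?sum = (\<Oplus>\<^bsub>?B\<^esub> l \<in> {..<?k}. ?\<pi> ((xs ! l) \<odot>\<^bsub>?S\<^esub> q l))"
    by (rule module_homs_finsum[OF S B \<pi>]) (use q(1) xlR in auto)
  also have "\<dots> = (\<Oplus>\<^bsub>?B\<^esub> l \<in> {..<?k}. (xs ! l) \<odot>\<^bsub>?B\<^esub> (us ! l))"
    using q xlR module_homs_closed[OF \<pi>] by (intro B.M.finsum_cong') (auto simp: module_homs_smult[OF \<pi>])
  finally have "?\<pi> (?sum \<oplus>\<^bsub>?S\<^esub> x \<odot>\<^bsub>?S\<^esub> p) = \<zero>\<^bsub>?B\<^esub>"
    using sum0 sumS p xR by (simp add: module_homs_add[OF \<pi>] module_homs_smult[OF \<pi>])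
  then have rel_S: "?sum \<oplus>\<^bsub>?S\<^esub> x \<odot>\<^bsub>?S\<^esub> p \<in> rels UNIV"
    using proj_zero_iff[OF closed_UNIV] sumS p(1) xR by simp
  let ?qs = "map q [0..<?k]"
  have "?sum = (\<Oplus>\<^bsub>A\<^esub> l \<in> {..<?k}. (xs ! l) \<odot>\<^bsub>?S\<^esub> q l)"
    by (rule module_homs_finsum[OF S A_module stage_incl_hom]) (use q(1) xlR in auto)
  also have "\<dots> = (\<Oplus>\<^bsub>A\<^esub> l \<in> {..<?k}. (xs ! l) \<odot>\<^bsub>A\<^esub> (?qs ! l))"
  proof -
    interpret Am: module R A by (rule A_module)
    show ?thesis unfolding stage_ops(3)
      using xlR stage_carrier_A[OF q(1)] by (intro Am.M.finsum_cong') auto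
  qed
  finally have rel_A: "(\<Oplus>\<^bsub>A\<^esub> l \<in> {..<?k}. (xs ! l) \<odot>\<^bsub>A\<^esub> (?qs ! l)) \<oplus>\<^bsub>A\<^esub> x \<odot>\<^bsub>A\<^esub> p \<in> rels UNIV"
    using rel_S by (simp only: stage_ops)
  have lim: "\<exists>k\<in>UNIV. i \<in> below k" if "i \<in> UNIV" for i using nomax by blast
  obtain j0 where j0: "(\<Oplus>\<^bsub>A\<^esub> l \<in> {..<?k}. (xs ! l) \<odot>\<^bsub>A\<^esub> (?qs ! l)) \<oplus>\<^bsub>A\<^esub> x \<odot>\<^bsub>A\<^esub> p \<in> rels (below j0)"
    using rels_limit[OF lim UNIV_not_empty rel_A] by blast
  have "\<exists>j. (j0, j) \<in> r \<and> (\<forall>v\<in>set vs. v \<in> carrier (stg (below j)))" if "set vs \<subseteq> carrier ?S" for vs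
    using that
  proof (induction vs)
    case Nil
    then show ?case using r_refl by auto
  next
    case (Cons v vs)
    then obtain j where j: "(j0, j) \<in> r" "\<forall>v\<in>set vs. v \<in> carrier (stg (below j))" by auto
    obtain j' where j': "v \<in> carrier (stg (below j'))"
      using stage_limit[OF lim UNIV_not_empty, of v] Cons.prems by auto
    consider "(j, j') \<in> r" | "(j', j) \<in> r" using total by blast
    then show ?case
    proof cases
      case 1
      then have "\<forall>v\<in>set (v # vs). v \<in> carrier (stg (below j'))"
        using j(2) j' stage_mono[OF below_mono[OF 1]] by auto
      then show ?thesis using transD[OF r_trans j(1) 1] by blast
    next
      case 2
      then have "\<forall>v\<in>set (v # vs). v \<in> carrier (stg (below j))"
        using j(2) j' stage_mono[OF below_mono[OF 2]] by auto
      then show ?thesis using j(1) by blast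
    qed
  qed
  moreover have "set (p # ?qs) \<subseteq> carrier ?S" using p(1) q(1) by auto
  ultimately obtain j where j: "(j0, j) \<in> r" and vs: "\<forall>v\<in>set (p # ?qs). v \<in> carrier (stg (below j))" by blast
  have rel_j: "(\<Oplus>\<^bsub>A\<^esub> l \<in> {..<?k}. (xs ! l) \<odot>\<^bsub>A\<^esub> (?qs ! l)) \<oplus>\<^bsub>A\<^esub> x \<odot>\<^bsub>A\<^esub> p \<in> rels (below j)"
    by (rule subsetD[OF rels_mono[OF below_mono[OF j]] j0])
  have "valid_data R \<mm> M r D j (xs, x, ?qs, p)"
    unfolding valid_data_def prod.case using sop vs rel_j by (intro conjI) auto
  then obtain i where Di: "D i = (xs, x, ?qs, p)" using saturated by blast
  have xs_i: "dxs i = xs" and p_i: "du i = p" by (simp_all add: dxs_def du_def Di)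
  have p_below: "p \<in> carrier (stg (below i))" using du_stage[of i] p_i by simp
  have z: "\<zero>\<^bsub>A\<^esub> \<in> carrier (stg (below i))" using submodule_zero[OF A_module stage_submodule] .
  let ?w = "adjoin i ?k \<zero>\<^bsub>A\<^esub> (\<lambda>l. if l < ?k then xs ! l else \<zero>\<^bsub>R\<^esub>)"
  have w: "?w \<in> carrier ?S"
    unfolding xs_i[symmetric] by (rule adjoin_stage[OF z]) (use xlR xs_i in auto)
  interpret Am: module R A by (rule A_module)
  have "p \<oplus>\<^bsub>A\<^esub> ?w = adjoin i ?k p (\<lambda>_. \<zero>\<^bsub>R\<^esub>) \<oplus>\<^bsub>A\<^esub> ?w" by (simp only: adjoin_zero[OF p_below])
  also have "\<dots> = adjoin i ?k (p \<oplus>\<^bsub>A\<^esub> \<zero>\<^bsub>A\<^esub>) (\<lambda>l. xs ! l)"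
    unfolding adjoin_add by (rule adjoin_cong) (use xlR in simp)
  also have "\<dots> = stage_vector D i"
    using stage_carrier_A[OF p(1)] by (simp add: stage_vector_eq xs_i p_i)
  finally have sv: "stage_vector D i = p \<oplus>\<^bsub>?S\<^esub> ?w" by (simp only: stage_ops)
  have "stage_vector D i \<in> rels UNIV"
    using lspan_superset[OF A_module vectors_A] unfolding stage_rels_def by blast
  then have "?\<pi> p \<oplus>\<^bsub>?B\<^esub> ?\<pi> ?w = \<zero>\<^bsub>?B\<^esub>"
    using proj_zero_iff[OF closed_UNIV S.M.a_closed[OF p(1) w]] module_homs_add[OF \<pi> p(1) w] sv by simp
  then have u_eq: "u = \<ominus>\<^bsub>?B\<^esub> ?\<pi> ?w"
    using B.M.minus_equality[of u "?\<pi> ?w"] uB module_homs_closed[OF \<pi> w] p(2) by simp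
  have J: "ideal (Idl\<^bsub>R\<^esub> (set xs)) R" by (rule M.R.genideal_ideal[OF xsR])
  have JR: "Idl\<^bsub>R\<^esub> (set xs) \<subseteq> carrier R" using ideal.Icarr[OF J] by blast
  note IB = ideal_smult_submodule[OF B JR]
  have "proj UNIV (adjoin i (length (dxs i)) \<zero>\<^bsub>A\<^esub> (\<lambda>l. if l < ?k then dxs i ! l else \<zero>\<^bsub>R\<^esub>))
      \<in> ideal_smult R (Idl\<^bsub>R\<^esub> (set xs)) ?B"
  proof (rule adjoin_combination_mem[OF _ IB])
    show "?k \<le> length (dxs i)" by (simp add: xs_i)
    show "dxs i ! l \<odot>\<^bsub>?B\<^esub> n \<in> ideal_smult R (Idl\<^bsub>R\<^esub> (set xs)) ?B" if "l < length (dxs i)" "n \<in> carrier ?B" for l n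
      using that xs_i M.R.genideal_self[OF xsR] by (intro ideal_smult_mem) auto
  qed
  then show ?thesis unfolding u_eq xs_i by (rule submodule_neg[OF B IB])
qed

end

section \<open>Saturated towers exist\<close>

lemma ex_tower_data:
  assumes "Well_order r"
  shows "\<exists>D. \<forall>i. D i = (if valid_data R \<mm> M r D i (d i) then d i else t0)"
proof -
  define F where "F D i = (if valid_data R \<mm> M r D i (d i) then d i else t0)" for D i
  have wf: "wf (r - Id)" using assms by (simp add: well_order_on_def)
  have "wfrec (r - Id) F i = F (wfrec (r - Id) F) i" for i
  proof -
    have "wfrec (r - Id) F i = F (cut (wfrec (r - Id) F) (r - Id) i) i" by (rule wfrec[OF wf])
    also have "\<dots> = F (wfrec (r - Id) F) i"
    proof -
      have "cut (wfrec (r - Id) F) (r - Id) i j = wfrec (r - Id) F j" if "j \<in> underS r i" for j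
        using that by (intro cut_apply) (simp add: underS_def)
      from valid_data_cong[OF this] show ?thesis by (simp add: F_def)
    qed
    finally show ?thesis .
  qed
  then show ?thesis unfolding F_def by blast
qed

text \<open>In the order of a cardinal every proper initial segment is smaller than the whole set, so
  an enumeration that takes each value as often as there are elements takes each value
  cofinally often.\<close>

lemma cofinal_enumeration:
  fixes e :: "'t \<Rightarrow> 'u"
  assumes inf: "infinite (UNIV :: 'u set)" and e: "inj_on e X"
  obtains d :: "'u \<Rightarrow> 't" where "\<And>t j. t \<in> X \<Longrightarrow> \<exists>i. (j, i) \<in> card_of (UNIV :: 'u set) \<and> d i = t"
proof -
  let ?r = "card_of (UNIV :: 'u set)"
  obtain p :: "'u \<times> 'u \<Rightarrow> 'u" where p: "inj p" using pairs_embed[OF inf] .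
  define d where "d i = inv_into X e (snd (inv_into UNIV p i))" for i
  show thesis
  proof (rule that)
    fix t j assume t: "t \<in> X"
    show "\<exists>i. (j, i) \<in> ?r \<and> d i = t"
    proof (rule ccontr)
      assume none: "\<not> (\<exists>i. (j, i) \<in> ?r \<and> d i = t)"
      have wo: "Well_order ?r" "Field ?r = UNIV" by (rule card_of_Well_order, rule Field_card_of)
      have "p (a, e t) \<in> underS ?r j" for a
      proof -
        have "d (p (a, e t)) = t" using p t by (simp add: d_def inv_into_f_f[OF e])
        then have "(j, p (a, e t)) \<notin> ?r" using none by blast
        then show ?thesis
          using wo unfolding well_order_on_def linear_order_on_def total_on_def partial_order_on_def
            preorder_on_def refl_on_def underS_def by (metis (mono_tags, lifting) UNIV_I mem_Collect_eq)
      qed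
      moreover have "inj (\<lambda>a. p (a, e t))" by (rule injI) (auto dest: injD[OF p])
      ultimately have "ordLeq3 (card_of (UNIV :: 'u set)) (card_of (underS ?r j))"
        unfolding card_of_ordLeq[symmetric] by blast
      moreover have "ordLess2 (card_of (underS ?r j)) ?r"
        by (rule card_of_underS[OF card_of_Card_order]) (simp add: Field_card_of)
      ultimately show False using not_ordLess_ordLeq by blast
    qed
  qed
qed

lemma ambient_module_embeds:
  fixes R :: "'a ring" and M :: "('a, 'u) module" and gR :: "'a \<Rightarrow> 'u"
  assumes inf: "infinite (UNIV :: 'u set)" and gR: "inj_on gR (carrier R)"
  obtains k :: "('a, 'u, 'u) ambient \<Rightarrow> 'u" where "inj_on k (carrier (ambient_module R M))"
proof -
  obtain \<nu> :: "nat \<Rightarrow> 'u" where \<nu>: "inj \<nu>" using infinite_countable_subset[OF inf] by auto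
  obtain c :: "'u \<times> nat \<Rightarrow> 'u" where "inj_on c (UNIV \<times> UNIV)" using prod_embed[OF inf inj_on_id \<nu>] .
  then have c: "inj c" by simp
  obtain f :: "('u \<times> nat \<Rightarrow> 'a) \<Rightarrow> 'u" where f: "inj_on f (carrier (finsupp_module R UNIV))"
    using finsupp_module_embeds[OF inf gR c] .
  obtain k :: "'u \<times> ('u \<times> nat \<Rightarrow> 'a) \<Rightarrow> 'u" where "inj_on k (carrier M \<times> carrier (finsupp_module R UNIV))"
    using prod_embed[OF inf inj_on_id f] .
  then show thesis using that unfolding ambient_module_def module_sum_simps(1) by blast
qed

text \<open>Stage \<open>i\<close> uses the data \<open>d i\<close> if they are a relation at that stage. Otherwise it uses the
  relation \<open>x\<^sub>0 0 = 0\<close> with \<open>k = 0\<close>, whose modification is an isomorphism. Data that are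
  a relation at stage \<open>j\<close> remain one at all later stages, and \<open>d\<close> takes each value cofinally often.\<close>

lemma saturated_tower_exists:
  fixes R :: "'a ring" and M :: "('a, 'u) module" and gR :: "'a \<Rightarrow> 'u"
  assumes inf: "infinite (UNIV :: 'u set)" and gR: "inj_on gR (carrier R)"
    and M: "module R M" and mm: "\<mm> \<subseteq> carrier R" and x0: "partial_sop R \<mm> [x0]"
  obtains r :: "'u rel" and D emb where "realised_tower R \<mm> M r D emb"
    "\<And>i. \<exists>k. i \<in> underS r k"
    "\<And>j t. valid_data R \<mm> M r D j t \<Longrightarrow> \<exists>i. (j, i) \<in> r \<and> D i = t"
proof -
  interpret M: module R M by (rule M)
  let ?A = "ambient_module R M :: ('a, ('a, 'u, 'u) ambient) module"
  have A: "module R ?A"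
    unfolding ambient_module_def by (intro module_sum_is_module M finsupp_module_is_module M.R.is_cring)
  interpret Am: module R ?A by (rule A)
  obtain emb :: "('a, 'u, 'u) ambient \<Rightarrow> 'u" where emb: "inj_on emb (carrier ?A)"
    using ambient_module_embeds[OF inf gR] .
  define X :: "('a, 'u, 'u) mod_data set"
    where "X = lists (carrier R) \<times> carrier R \<times> lists (carrier ?A) \<times> carrier ?A"
  obtain e :: "('a, 'u, 'u) mod_data \<Rightarrow> 'u" where e: "inj_on e X"
  proof -
    obtain l1 :: "'a list \<Rightarrow> 'u" where l1: "inj_on l1 (lists (carrier R))" using list_embed[OF inf gR] .
    obtain l2 :: "('a, 'u, 'u) ambient list \<Rightarrow> 'u" where l2: "inj_on l2 (lists (carrier ?A))"
      using list_embed[OF inf emb] .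
    obtain k1 :: "('a, 'u, 'u) ambient list \<times> ('a, 'u, 'u) ambient \<Rightarrow> 'u"
      where k1: "inj_on k1 (lists (carrier ?A) \<times> carrier ?A)" using prod_embed[OF inf l2 emb] .
    obtain k2 :: "'a \<times> ('a, 'u, 'u) ambient list \<times> ('a, 'u, 'u) ambient \<Rightarrow> 'u"
      where k2: "inj_on k2 (carrier R \<times> lists (carrier ?A) \<times> carrier ?A)" using prod_embed[OF inf gR k1] .
    show thesis using prod_embed[OF inf l1 k2] that unfolding X_def by blast
  qed
  define r where "r = card_of (UNIV :: 'u set)"
  have wo: "Well_order r" and field: "Field r = UNIV" and co: "Card_order r"
    unfolding r_def by (rule card_of_Well_order, rule Field_card_of, rule card_of_Card_order)
  obtain d :: "'u \<Rightarrow> ('a, 'u, 'u) mod_data" where d: "\<And>t j. t \<in> X \<Longrightarrow> \<exists>i. (j, i) \<in> r \<and> d i = t"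
    using cofinal_enumeration[OF inf e] unfolding r_def by blast
  let ?t0 = "([], x0, [], \<zero>\<^bsub>?A\<^esub>) :: ('a, 'u, 'u) mod_data"
  obtain D where D: "\<And>i. D i = (if valid_data R \<mm> M r D i (d i) then d i else ?t0)"
    using ex_tower_data[OF wo, of R \<mm> M d ?t0] by blast
  have x0R: "x0 \<in> carrier R" using partial_sop_subset[OF x0] mm by auto
  have "\<zero>\<^bsub>?A\<^esub> \<in> carrier (stage R M D S)" for S
    by (simp add: ambient_module_def stage_def module_sum_simps finsupp_module_simps)
  then have "valid_data R \<mm> M r D i ?t0" for i
    using x0 x0R by (simp add: valid_data_def stage_rels_def lspan.zero)
  then have valid: "valid_data R \<mm> M r D i (D i)" for i using D[of i] by (cases "valid_data R \<mm> M r D i (d i)") simp_all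
  interpret T: realised_tower R \<mm> M r D emb
    by (unfold_locales; fact M wo field mm valid emb)
  have nomax: "\<exists>k. i \<in> underS r k" for i
    using infinite_Card_order_limit[OF co, of i] field inf by (auto simp: underS_def)
  have sat: "\<exists>i. (j, i) \<in> r \<and> D i = t" if t: "valid_data R \<mm> M r D j t" for j t
  proof -
    obtain xs x us u where t_eq: "t = (xs, x, us, u)" by (cases t)
    have parts: "partial_sop R \<mm> (xs @ [x])" "set us \<subseteq> carrier (stage R M D (underS r j))"
      "u \<in> carrier (stage R M D (underS r j))"
      using t unfolding valid_data_def t_eq by auto
    have "set (xs @ [x]) \<subseteq> carrier R" using partial_sop_subset[OF parts(1)] mm by blast
    then have "t \<in> X" using parts(2,3) T.stage_carrier_A unfolding X_def t_eq by auto
    then obtain i where i: "(j, i) \<in> r" "d i = t" using d by blast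
    note sub = T.below_mono[OF i(1)]
    have "valid_data R \<mm> M r D i t"
      using t T.stage_mono[OF sub] T.rels_mono[OF sub] unfolding valid_data_def t_eq by auto
    then have "D i = t" using D[of i] i(2) by simp
    then show ?thesis using i(1) by blast
  qed
  show thesis by (rule that[OF T.realised_tower_axioms nomax sat])
qed

section \<open>Phantom extensions and balanced big Cohen--Macaulay modules\<close>

text \<open>A finite domain is a field.\<close>

lemma finite_domain_trivial_sop:
  fixes R :: "'a ring"
  assumes "domain R" and fin: "finite (carrier R)" and mm: "maximalideal \<mm> R"
  shows "\<mm> = {\<zero>\<^bsub>R\<^esub>}" and "partial_sop R \<mm> xs \<Longrightarrow> xs = []"
proof -
  interpret domain R by fact
  have ideal_zero: "I = {\<zero>\<^bsub>R\<^esub>}" if I: "ideal I R" "carrier R \<noteq> I" for I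
  proof -
    have "a = \<zero>\<^bsub>R\<^esub>" if a: "a \<in> I" for a
    proof (rule ccontr)
      assume nz: "a \<noteq> \<zero>\<^bsub>R\<^esub>"
      have aR: "a \<in> carrier R" by (rule ideal.Icarr[OF I(1) a])
      have "inj_on (\<lambda>x. x \<otimes>\<^bsub>R\<^esub> a) (carrier R)"
        by (rule inj_onI) (use m_rcancel[OF nz aR] in blast)
      then have "(\<lambda>x. x \<otimes>\<^bsub>R\<^esub> a) ` carrier R = carrier R"
        using aR by (intro endo_inj_surj[OF fin]) auto
      then obtain x where "x \<in> carrier R" "x \<otimes>\<^bsub>R\<^esub> a = \<one>\<^bsub>R\<^esub>" using one_closed by (metis imageE)
      then have "\<one>\<^bsub>R\<^esub> \<in> I" using ideal.I_l_closed[OF I(1) a] by metis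
      then show False using ideal.one_imp_carrier[OF I(1)] I(2) by simp
    qed
    then show ?thesis using additive_subgroup.zero_closed[OF ideal.axioms(1)[OF I(1)]] by blast
  qed
  show "\<mm> = {\<zero>\<^bsub>R\<^esub>}"
    by (rule ideal_zero[OF maximalideal.axioms(1)[OF mm] maximalideal.I_notcarr[OF mm]])
  have "n = 0" if P: "\<forall>i\<le>n. primeideal (P i) R" "\<forall>i<n. P i \<subset> P (Suc i)" for n :: nat and P
  proof (rule ccontr)
    assume "n \<noteq> 0"
    then have "primeideal (P 0) R" "primeideal (P 1) R" "P 0 \<subset> P 1" using P by auto
    then show False
      using ideal_zero[OF primeideal.axioms(1) primeideal.I_notcarr] by (metis psubsetE subset_refl)
  qed
  then have "krull_dim R \<le> enat 0"
    unfolding krull_dim_def by (intro Sup_least) (auto simp: zero_enat_def)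
  moreover assume "partial_sop R \<mm> xs"
  then obtain ys where "enat (length (xs @ ys)) = krull_dim R"
    unfolding partial_sop_def system_of_parameters_def by blast
  ultimately have "enat (length (xs @ ys)) \<le> enat 0" by simp
  then show "xs = []" by (simp only: enat_ord_simps) simp
qed

lemma can_be_modified_into_refl:
  fixes M :: "('a, 'u) module"
  assumes M: "module R M"
  shows "can_be_modified_into R \<mm> M M"
proof -
  define r :: "'u rel" where "r = {(undefined, undefined)}"
  have field: "Field r = {undefined}" by (simp add: r_def Field_def)
  have below: "underS r j = {}" for j by (auto simp: underS_def r_def)
  have wo: "Well_order r"
    unfolding well_order_on_def linear_order_on_def partial_order_on_def preorder_on_def field
    by (auto simp: r_def refl_on_def trans_def antisym_def total_on_def)
  have id_hom: "(\<lambda>x. x) \<in> module_homs R M M" by (rule module_homsI) auto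
  have sys: "direct_system R (Field r) r (\<lambda>_. M) (\<lambda>_ _ x. x)"
    using M id_hom by (simp add: direct_system_def)
  have "modification_sequence R \<mm> M r (\<lambda>_. M) (\<lambda>_ _ x. x)"
    unfolding modification_sequence_def using wo sys below by (simp add: field)
  moreover have "is_direct_limit R (Field r) r (\<lambda>_. M) (\<lambda>_ _ x. x) M (\<lambda>_ x. x)"
  proof (rule is_direct_limit_of_cocone[OF sys])
    show "direct_limit_cocone R (Field r) r (\<lambda>_. M) (\<lambda>_ _ x. x) M (\<lambda>_ x. x)"
      using M id_hom by (simp add: direct_limit_cocone_def field r_def)
  qed (auto simp: r_def trans_def Field_def)
  ultimately show ?thesis unfolding can_be_modified_into_def by blast
qed

theorem theorem3p7:
  fixes R :: "'a ring" and \<mm> :: "'a set"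
    and cl :: "('a, 'u) module \<Rightarrow> 'u set \<Rightarrow> 'u set"
    and M :: "('a, 'u) module" and \<alpha> :: "'a \<Rightarrow> 'u"
  assumes "local_domain R \<mm>"
    and "big_axioms R \<mm> cl"
    and "phantom_extension R cl M \<alpha>"
  shows "\<exists>B :: ('a, 'u) module. can_be_modified_into R \<mm> M B \<and> balanced_big_CM R \<mm> B"
proof -
  have dom: "domain R" and max: "maximalideal \<mm> R"
    using assms(1) unfolding local_domain_def noetherian_domain_def by blast+
  interpret R: domain R by (rule dom)
  have mm: "ideal \<mm> R" by (rule maximalideal.axioms(1)[OF max])
  have mmR: "\<mm> \<subseteq> carrier R" using ideal.Icarr[OF mm] by blast
  have one: "\<one>\<^bsub>R\<^esub> \<notin> \<mm>" using maximalideal.I_notcarr[OF max] ideal.one_imp_carrier[OF mm] by blast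
  have cl: "big_closure R \<mm> cl" using assms(2) by (simp add: big_closure_def R.is_cring)
  interpret big_closure R \<mm> cl by (rule cl)
  have M: "module R M" and \<alpha>: "\<alpha> \<in> module_homs R (ring_module R) M" and inj: "inj_on \<alpha> (carrier R)"
    using assms(3) unfolding phantom_extension_def by blast+
  let ?e = "\<alpha> \<one>\<^bsub>R\<^esub>"
  have e: "?e \<in> carrier M" using module_homs_closed[OF \<alpha>] by (simp add: ring_module_def)
  have phantom: "linearly_phantom R cl M ?e" and inf: "infinite (UNIV :: 'u set)" if "infinite (carrier R)"
  proof -
    show inf: "infinite (UNIV :: 'u set)" using inj_on_finite[OF inj subset_UNIV] that by blast
    show "linearly_phantom R cl M ?e" by (rule linearly_phantom_of_phantom_extension[OF inf assms(3)])
  qed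
  show ?thesis
  proof (cases "\<exists>x. partial_sop R \<mm> [x]")
    case True
    \<comment> \<open>A finite domain has dimension zero. So \<open>R\<close> and \<open>'u\<close> are infinite.\<close>
    then obtain x0 where x0: "partial_sop R \<mm> [x0]" ..
    then have R_inf: "infinite (carrier R)" using finite_domain_trivial_sop(2)[OF dom _ max] by blast
    obtain r :: "'u rel" and D emb where tower: "realised_tower R \<mm> M r D emb"
      and nomax: "\<And>i. \<exists>k. i \<in> underS r k"
      and saturated: "\<And>j t. valid_data R \<mm> M r D j t \<Longrightarrow> \<exists>i. (j, i) \<in> r \<and> D i = t"
      using saturated_tower_exists[OF inf[OF R_inf] inj M mmR x0] by metis
    interpret T: realised_tower R \<mm> M r D emb by (rule tower)
    let ?B = "T.tower UNIV"
    have "linearly_phantom R cl ?B (T.proj UNIV (?e, \<lambda>_. \<zero>\<^bsub>R\<^esub>))"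
      using nomax
      by (intro T.tower_linearly_phantom_limit[OF T.closed_UNIV _ _ e]
          T.tower_linearly_phantom[OF cl inf[OF R_inf] inj phantom[OF R_inf]]) auto
    from linearly_phantom_imp_proper[OF T.tower_module[OF T.closed_UNIV] this inj mm one]
    have "balanced_big_CM R \<mm> ?B"
      by (intro balanced_big_CM_of_relations[OF T.tower_module[OF T.closed_UNIV] mm]
          T.tower_relations_trivial nomax saturated)
    moreover have "can_be_modified_into R \<mm> M ?B"
      using T.tower_modification_sequence T.tower_is_direct_limit[OF nomax]
      unfolding can_be_modified_into_def by blast
    ultimately show ?thesis by blast
  next
    case False
    \<comment> \<open>The only partial system of parameters is the empty one, and \<open>B = M\<close> works.\<close>
    have proper: "ideal_smult R \<mm> M \<noteq> carrier M"
    proof (cases "finite (carrier R)")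
      case True
      have "ideal_smult R \<mm> M \<subseteq> {\<zero>\<^bsub>M\<^esub>}"
        unfolding finite_domain_trivial_sop(1)[OF dom True max]
        by (rule ideal_smult_least[OF zero_submodule[OF M]]) (use module.smult_l_null[OF M] in simp)
      moreover have "?e \<noteq> \<zero>\<^bsub>M\<^esub>"
        using inj_onD[OF inj, of "\<one>\<^bsub>R\<^esub>" "\<zero>\<^bsub>R\<^esub>"]
          module_homs_zero[OF ring_module_is_module[OF R.is_cring] M \<alpha>] by (auto simp: ring_module_def)
      ultimately show ?thesis using e by blast
    next
      case False
      then show ?thesis using linearly_phantom_imp_proper[OF M phantom inj mm one] by blast
    qed
    have "\<not> modification_relation_holds R \<mm> M xs x us u" for xs x us u
    proof
      assume "modification_relation_holds R \<mm> M xs x us u"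
      then have sop: "partial_sop R \<mm> (xs @ [x])" by (simp add: modification_relation_holds_def)
      show False
      proof (cases xs)
        case Nil
        then show False using sop False by simp
      next
        case (Cons y ys)
        then show False using partial_sop_appendD[of R \<mm> "[y]" "ys @ [x]"] sop \<open>\<nexists>x. _\<close> by simp
      qed
    qed
    then have "balanced_big_CM R \<mm> M" by (intro balanced_big_CM_of_relations[OF M mm proper]) blast
    then show ?thesis using can_be_modified_into_refl[OF M] by blast
  qed
qed

end
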